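(* In the fermionic lattice setting of the context (with $\iota:I\to L\setminus I$ a bijection and $p_s>0$ for all $s\in D_I$), let $B_\varphi:\mathcal A(I)\times\mathcal A(L\setminus I)\to\mathbb C$ be the bilinear form given by $$B_\varphi(a,b):=\varphi(ab)=\langle ab\zeta,\zeta\rangle,\qquad a\in\mathcal A(I),\ b\in\mathcal A(L\setminus I).$$ Then, for any positive and even linear map $\Psi:\mathcal A(I)\to\mathcal A(I)$ such that $\varphi\circ\Psi(a)=\varphi(a)$ for all $a\in\mathcal A(I)$, there exists a unique (and necessarily linear) fermionic dual map $\Psi^\varphi:\mathcal A(L\setminus I)\to\mathcal A(L\setminus I)$ such that $$B_\varphi(\Psi(a),b)=B_\varphi(a,\Psi^\varphi(b)),\qquad a\in\mathcal A(I),\ b\in\mathcal A(L\setminus I).$$ Furthermore, $\Psi^\varphi$ is positive, unital, faithful and even. In addition: (i) if $\Psi$ is $n$-positive for some $n\in\mathbb N$, then $\Psi^\varphi$ is $n$-positive; (ii) if $\Psi$ is completely positive, then $\Psi^\varphi$ is completely positive; (iii) if $\Psi$ is unital, then $\varphi\circ\Psi^\varphi(b)=\varphi(b)$ for all $b\in\mathcal A(L\setminus I)$. Moreover, $\Psi^{\varphi\varphi}:=(\Psi^\varphi)^\varphi:\mathcal A(I)\to\mathcal A(I)$ is well-defined, i.e. it exists and is uniquely determined by $$B_\varphi(\Psi^{\varphi\varphi}(a),b)=B_\varphi(a,\Psi^\varphi(b)),\qquad a\in\mathcal A(I),\ b\in\mathcal A(L\setminus I).$$ Finally, $\Psi^{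\varphi\varphi}=\Psi$.
   Context: $h$ is a complex Hilbert space, finite dimensional or separable infinite dimensional, with orthonormal basis $(e_l)_{l\in L}$, and $\mathcal H$ is the anti-symmetric Fock space over $h$, with vacuum vector $f_\varnothing$. With $a^\dagger(x),a(x)$ ($x\in h$) the usual mutually adjoint creation and annihilation operators ($\{a(x),a(y)\}=0$, $\{a^\dagger(x),a(y)\}=\langle x,y\rangle 1$, inner product linear in the first variable), put $a_l=a(e_l)$, $a_l^\dagger=a^\dagger(e_l)$, and $f_{(l_1,\dots,l_n)}=a_{l_1}^\dagger\cdots a_{l_n}^\dagger f_\varnothing$. For $I\subseteq L$, $D_I$ is a fixed set of finite sequences of distinct elements of $I$ (including the empty sequence) such that each finite subset of $I$ corresponds to (is the set of entries of) exactly one element of $D_I$. $(f_s)_{s\in D_L}$ is an orthonormal basis of $\mathcal H$. $\mathcal A(I)$ is the von Neumann algebra on $\mathcal H$ generated by $\{a_l:l\in I\}$. $I\subseteq L$ is fixed together with a bijection $\iota:I\to L\setminus I$; for $s=(l_1,\dots,l_n)$ put $\iota(s)=(\iota(l_1),\dots,\iota(l_n))$, and $s\iota(s)$ denotes concatenation. $(p_s)_{s\in D_I}$ satisfies $p_s>0$ for all $s$ and $\sum_s p_s=1$. The fermionic entangled vector is $\zeta=\sum_{s\in D_I}p_s^{1/2}f_{s\iota(s)}\in\mathcal H$, and $\varphi(a)=\langle a\zeta,\zeta\rangle$ for $a\in\mathcal A(L)$. $\Gamma$ is the self-adjoint unitary on $\mathcal H$ with $\Gamma f_s=f_s$ if $s$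 has even length and $\Gamma f_s=-f_s$ if $s$ has odd length ($s\in D_L$); $\gamma=\Gamma(\cdot)\Gamma$ leaves $\mathcal A(I)$ and $\mathcal A(L\setminus I)$ invariant. A map $T$ of one of these algebras into itself is even if $T\circ\gamma=\gamma\circ T$; it is faithful if $T(x^*x)=0$ implies $x=0$; it is $n$-positive if $T\otimes\mathrm{id}$ is positive on $n\times n$ matrices over the algebra, and completely positive if it is $n$-positive for all $n$.
   Formalization: Faithfulness of Ψ^φ is asserted only when the operator Ψ(1) is injective (in particular for unital Ψ); as printed it fails, e.g. for Ψ(a) = (φ(a)/φ(q)) q with q = a_l a_l^†, whose dual annihilates a_{ι(l)}^† a_{ι(l)}. *)

theory Defs
  imports
    "HOL-Analysis.Analysis"
    "HOL-Combinatorics.Permutations"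
begin

section \<open>Complex Hilbert spaces\<close>

text \<open>
  The complex inner product is linear in its first variable. Its real part is the real inner
  product of the library, so that norm, topology and completeness are the library's.
\<close>

class complex_hilbert_space = real_inner + banach +
  fixes scaleC :: "complex \<Rightarrow> 'a \<Rightarrow> 'a"  (infixr \<open>*\<^sub>C\<close> 75)
    and cinner :: "'a \<Rightarrow> 'a \<Rightarrow> complex"
  assumes scaleC_add_right: "c *\<^sub>C (x + y) = c *\<^sub>C x + c *\<^sub>C y"
    and scaleC_add_left: "(c + d) *\<^sub>C x = c *\<^sub>C x + d *\<^sub>C x"
    and scaleC_scaleC: "c *\<^sub>C (d *\<^sub>C x) = (c * d) *\<^sub>C x"
    and scaleC_of_real: "complex_of_real r *\<^sub>C x = r *\<^sub>R x"
    and cinner_commute: "cinner x y = cnj (cinner y x)"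
    and cinner_add_left: "cinner (x + y) z = cinner x z + cinner y z"
    and cinner_scaleC_left: "cinner (c *\<^sub>C x) y = c * cinner x y"
    and inner_eq_Re_cinner: "inner x y = Re (cinner x y)"

lemma norm_scaleC:
  fixes x :: "'a :: complex_hilbert_space"
  shows "norm (c *\<^sub>C x) = cmod c * norm x"
proof -
  have "cinner (c *\<^sub>C x) (c *\<^sub>C x) = c * cnj (c * cinner x x)"
    by (metis cinner_scaleC_left cinner_commute)
  also have "\<dots> = (c * cnj c) * cinner x x"
    by (metis cinner_commute complex_cnj_mult mult.assoc)
  also have "c * cnj c = complex_of_real ((cmod c)\<^sup>2)"
    by (rule complex_norm_square [symmetric])
  finally have "inner (c *\<^sub>C x) (c *\<^sub>C x) = (cmod c)\<^sup>2 * inner x x"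
    by (simp add: inner_eq_Re_cinner)
  then show ?thesis
    by (simp add: norm_eq_sqrt_inner real_sqrt_mult)
qed

lemma bounded_linear_scaleC: "bounded_linear (\<lambda>x :: 'a :: complex_hilbert_space. c *\<^sub>C x)"
proof (rule bounded_linear_intro [where K = "cmod c"])
  fix r :: real and x y :: 'a
  show "c *\<^sub>C (x + y) = c *\<^sub>C x + c *\<^sub>C y"
    by (rule scaleC_add_right)
  show "c *\<^sub>C (r *\<^sub>R x) = r *\<^sub>R (c *\<^sub>C x)"
    by (metis scaleC_of_real scaleC_scaleC mult.commute)
  show "norm (c *\<^sub>C x) \<le> norm x * cmod c"
    by (simp add: norm_scaleC mult.commute)
qed

definition total_set :: "'a :: complex_hilbert_space set \<Rightarrow> bool" where
  "total_set S \<longleftrightarrow> closure (module.span (*\<^sub>C) S) = UNIV"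

definition orthonormal_basis :: "'l set \<Rightarrow> ('l \<Rightarrow> 'a :: complex_hilbert_space) \<Rightarrow> bool" where
  "orthonormal_basis L e \<longleftrightarrow>
     (\<forall>k\<in>L. \<forall>l\<in>L. cinner (e k) (e l) = (if k = l then 1 else 0)) \<and> total_set (e ` L)"


section \<open>Bounded operators and von Neumann algebras\<close>

text \<open>
  The elements of the library type \<open>'a \<Rightarrow>\<^sub>L 'a\<close> are only real-linear; \<open>bounded_ops\<close> is the algebra
  of all bounded complex-linear operators.
\<close>

type_synonym 'a op = "'a \<Rightarrow>\<^sub>L 'a"

definition bounded_ops :: "'a :: complex_hilbert_space op set" where
  "bounded_ops = {T :: 'a op. \<forall>c x. T (c *\<^sub>C x) = c *\<^sub>C T x}"

lift_definition scaleC_op :: "complex \<Rightarrow> 'a :: complex_hilbert_space op \<Rightarrow> 'a op"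
  is "\<lambda>c T x. c *\<^sub>C T x"
  by (rule bounded_linear_compose [OF bounded_linear_scaleC])

definition adj :: "'a :: complex_hilbert_space op \<Rightarrow> 'a op" where
  "adj T = (THE S :: 'a op. \<forall>x y. cinner (T x) y = cinner x (S y))"

definition commutant :: "'a :: complex_hilbert_space op set \<Rightarrow> 'a op set" where
  "commutant S = {T \<in> bounded_ops. \<forall>X\<in>S. T o\<^sub>L X = X o\<^sub>L T}"

definition von_neumann_algebra :: "'a :: complex_hilbert_space op set \<Rightarrow> bool" where
  "von_neumann_algebra M \<longleftrightarrow>
     M \<subseteq> bounded_ops \<and> (\<forall>T\<in>M. adj T \<in> M) \<and> commutant (commutant M) = M"

definition vn_generated :: "'a :: complex_hilbert_space op set \<Rightarrow> 'a op set" where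
  "vn_generated S = \<Inter> {M. von_neumann_algebra M \<and> S \<subseteq> M}"

definition positive_op :: "'a :: complex_hilbert_space op \<Rightarrow> bool" where
  "positive_op T \<longleftrightarrow> (\<forall>x. cinner (T x) x \<in> \<real>\<^sub>\<ge>\<^sub>0)"

text \<open>Positivity of the operator matrix \<open>(X i j)\<close>, \<open>i, j < n\<close>, acting on the \<open>n\<close>-fold direct sum.\<close>

definition positive_matrix :: "nat \<Rightarrow> (nat \<Rightarrow> nat \<Rightarrow> 'a :: complex_hilbert_space op) \<Rightarrow> bool" where
  "positive_matrix n X \<longleftrightarrow> (\<forall>v. (\<Sum>i<n. \<Sum>j<n. cinner (X i j (v j)) (v i)) \<in> \<real>\<^sub>\<ge>\<^sub>0)"


section \<open>Maps of an operator algebra into itself\<close>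

definition linear_map_on :: "'a :: complex_hilbert_space op set \<Rightarrow> ('a op \<Rightarrow> 'a op) \<Rightarrow> bool" where
  "linear_map_on M T \<longleftrightarrow>
     (\<forall>x\<in>M. \<forall>y\<in>M. T (x + y) = T x + T y) \<and> (\<forall>c. \<forall>x\<in>M. T (scaleC_op c x) = scaleC_op c (T x))"

definition positive_map :: "'a :: complex_hilbert_space op set \<Rightarrow> ('a op \<Rightarrow> 'a op) \<Rightarrow> bool" where
  "positive_map M T \<longleftrightarrow> (\<forall>x\<in>M. positive_op x \<longrightarrow> positive_op (T x))"

definition n_positive_map ::
  "nat \<Rightarrow> 'a :: complex_hilbert_space op set \<Rightarrow> ('a op \<Rightarrow> 'a op) \<Rightarrow> bool" where
  "n_positive_map n M T \<longleftrightarrow>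
     (\<forall>X. (\<forall>i<n. \<forall>j<n. X i j \<in> M) \<and> positive_matrix n X \<longrightarrow> positive_matrix n (\<lambda>i j. T (X i j)))"

definition completely_positive_map ::
  "'a :: complex_hilbert_space op set \<Rightarrow> ('a op \<Rightarrow> 'a op) \<Rightarrow> bool" where
  "completely_positive_map M T \<longleftrightarrow> (\<forall>n. n_positive_map n M T)"

definition unital_map :: "('a :: complex_hilbert_space op \<Rightarrow> 'a op) \<Rightarrow> bool" where
  "unital_map T \<longleftrightarrow> T id_blinfun = id_blinfun"

text \<open>
  The dual of a positive, even, state-preserving map \<open>\<Psi>\<close> need not be faithful: for
  \<open>\<Psi> a = (\<phi> a / \<phi> q) \<cdot> q\<close> with \<open>q = a\<^sub>l a\<^sub>l\<^sup>\<dagger>\<close>, \<open>l \<in> I\<close>, the dual is \<open>b \<mapsto> (\<phi> (q b) / \<phi> q) \<cdot> 1\<close>, which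
  annihilates \<open>a\<^sub>k\<^sup>\<dagger> a\<^sub>k\<close> for \<open>k = \<iota> l\<close>. Faithfulness is therefore asserted under the assumption that
  \<open>\<Psi> 1\<close> is injective, which includes all unital \<open>\<Psi>\<close>.
\<close>

definition faithful_map :: "'a :: complex_hilbert_space op set \<Rightarrow> ('a op \<Rightarrow> 'a op) \<Rightarrow> bool" where
  "faithful_map M T \<longleftrightarrow> (\<forall>x\<in>M. T (adj x o\<^sub>L x) = 0 \<longrightarrow> x = 0)"

definition even_map ::
  "('a :: complex_hilbert_space op \<Rightarrow> 'a op) \<Rightarrow> 'a op set \<Rightarrow> ('a op \<Rightarrow> 'a op) \<Rightarrow> bool" where
  "even_map \<gamma> M T \<longleftrightarrow> (\<forall>x\<in>M. T (\<gamma> x) = \<gamma> (T x))"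

text \<open>
  \<open>\<Phi>\<close> is dual to \<open>\<Psi>\<close> with respect to the form \<open>B\<close> on \<open>M \<times> N\<close>. Membership in the extensional
  function space makes \<open>\<Phi>\<close> literally a map from \<open>N\<close> to \<open>N\<close>, so uniqueness is among all such maps,
  linear or not. Exchanging the arguments of \<open>B\<close> gives the duals of maps on \<open>N\<close>.
\<close>

definition is_dual_map ::
  "('a \<Rightarrow> 'b \<Rightarrow> complex) \<Rightarrow> 'a set \<Rightarrow> 'b set \<Rightarrow> ('a \<Rightarrow> 'a) \<Rightarrow> ('b \<Rightarrow> 'b) \<Rightarrow> bool" where
  "is_dual_map B M N \<Psi> \<Phi> \<longleftrightarrow> \<Phi> \<in> N \<rightarrow>\<^sub>E N \<and> (\<forall>a\<in>M. \<forall>b\<in>N. B (\<Psi> a) b = B a (\<Phi> b))"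

definition dual_map ::
  "('a \<Rightarrow> 'b \<Rightarrow> complex) \<Rightarrow> 'a set \<Rightarrow> 'b set \<Rightarrow> ('a \<Rightarrow> 'a) \<Rightarrow> 'b \<Rightarrow> 'b" where
  "dual_map B M N \<Psi> = (THE \<Phi>. is_dual_map B M N \<Psi> \<Phi>)"


section \<open>The anti-symmetric Fock space\<close>

definition gram_det :: "'h :: complex_hilbert_space list \<Rightarrow> 'h list \<Rightarrow> complex" where
  "gram_det xs ys = (\<Sum>\<sigma> | \<sigma> permutes {..<length xs}.
     of_int (sign \<sigma>) * (\<Prod>i<length xs. cinner (xs ! i) (ys ! \<sigma> i)))"

text \<open>
  The Hilbert space \<open>'f\<close>, together with \<open>w [x\<^sub>1, \<dots>, x\<^sub>n] = x\<^sub>1 \<and> \<dots> \<and> x\<^sub>n\<close>, is the completed exterior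
  algebra of \<open>'h\<close>: the inner products of the exterior products are the Gram determinants, different
  particle numbers are orthogonal, and the exterior products are total. (Multilinearity and
  antisymmetry of \<open>w\<close> follow from the inner products.) The vacuum is \<open>w []\<close>.
\<close>

definition antisymmetric_fock_space ::
  "('h :: complex_hilbert_space list \<Rightarrow> 'f :: complex_hilbert_space) \<Rightarrow> bool" where
  "antisymmetric_fock_space w \<longleftrightarrow>
     (\<forall>xs ys. cinner (w xs) (w ys) = (if length xs = length ys then gram_det xs ys else 0)) \<and>
     total_set (range w)"

text \<open>
  \<open>cr x\<close> is the bounded operator \<open>x\<^sub>1 \<and> \<dots> \<and> x\<^sub>n \<mapsto> x \<and> x\<^sub>1 \<and> \<dots> \<and> x\<^sub>n\<close>; by totality it is determined
  by \<open>w\<close>. The annihilation operator is \<open>adj (cr x)\<close>.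
\<close>

definition creation_operators ::
  "('h :: complex_hilbert_space list \<Rightarrow> 'f :: complex_hilbert_space) \<Rightarrow> ('h \<Rightarrow> 'f op) \<Rightarrow> bool" where
  "creation_operators w cr \<longleftrightarrow> (\<forall>x. cr x \<in> bounded_ops \<and> (\<forall>xs. cr x (w xs) = w (x # xs)))"

text \<open>The choice \<open>S\<close> of one ordering of each finite subset of \<open>J\<close>.\<close>

definition ordering_system :: "'l set \<Rightarrow> 'l list set \<Rightarrow> bool" where
  "ordering_system J S \<longleftrightarrow> (\<forall>s\<in>S. distinct s) \<and> bij_betw set S {F. F \<subseteq> J \<and> finite F}"


section \<open>The fermionic lattice\<close>

definition fock_vector ::
  "('h :: complex_hilbert_space list \<Rightarrow> 'f :: complex_hilbert_space) \<Rightarrow> ('h \<Rightarrow> 'f op) \<Rightarrow>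
   ('l \<Rightarrow> 'h) \<Rightarrow> 'l list \<Rightarrow> 'f" where
  "fock_vector w cr e s = foldr (\<lambda>l v. cr (e l) v) s (w [])"

definition lattice_algebra ::
  "('h :: complex_hilbert_space \<Rightarrow> 'f :: complex_hilbert_space op) \<Rightarrow> ('l \<Rightarrow> 'h) \<Rightarrow> 'l set \<Rightarrow> 'f op set"
  where "lattice_algebra cr e J = vn_generated ((\<lambda>l. adj (cr (e l))) ` J)"

definition entangled_vector ::
  "('l list \<Rightarrow> 'f :: complex_hilbert_space) \<Rightarrow> ('l \<Rightarrow> 'l) \<Rightarrow> ('l list \<Rightarrow> real) \<Rightarrow> 'l list set \<Rightarrow> 'f" where
  "entangled_vector f \<iota> p S = (\<Sum>\<^sub>\<infinity>s\<in>S. sqrt (p s) *\<^sub>R f (s @ map \<iota> s))"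

definition vector_state :: "'a :: complex_hilbert_space \<Rightarrow> 'a op \<Rightarrow> complex" where
  "vector_state \<zeta> a = cinner (a \<zeta>) \<zeta>"

definition vector_form :: "'a :: complex_hilbert_space \<Rightarrow> 'a op \<Rightarrow> 'a op \<Rightarrow> complex" where
  "vector_form \<zeta> a b = vector_state \<zeta> (a o\<^sub>L b)"

definition parity_operator ::
  "('l list \<Rightarrow> 'f :: complex_hilbert_space) \<Rightarrow> 'l list set \<Rightarrow> 'f op \<Rightarrow> bool" where
  "parity_operator f S \<Gamma> \<longleftrightarrow>
     \<Gamma> \<in> bounded_ops \<and> adj \<Gamma> = \<Gamma> \<and> \<Gamma> o\<^sub>L \<Gamma> = id_blinfun \<and>
     (\<forall>s\<in>S. \<Gamma> (f s) = (if even (length s) then f s else - f s))"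

definition parity_automorphism :: "'f :: complex_hilbert_space op \<Rightarrow> 'f op \<Rightarrow> 'f op" where
  "parity_automorphism \<Gamma> a = \<Gamma> o\<^sub>L a o\<^sub>L \<Gamma>"

end

(* Write M for the algebra of I, N for the algebra of L - I. The unitary V = (1 + i Gamma) / sqrt 2
   fixes even operators and sends an odd b to V b V* = i Gamma b, which commutes with the odd elements
   of M. In fact V N V* is the whole commutant M': an operator in V* M' V commutes with Gamma a_k for
   k in I, every X in N' commutes with a_l for l outside I, and the matrix elements of their two
   products between the Fock basis vectors factorise over the vacuum.

   As all p_s are positive, zeta is separating for M' and N', hence cyclic for M and N. For a positive
   c in M' the functional a |-> <Psi(a) c zeta, zeta> is positive and dominated by a multiple of phi, so
   it equals a |-> <a c' zeta, zeta> for some c' in M'. This gives a dual map on M', hence on N = V* M' V.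
   Since zeta is even, B(a, b) and <a V b V* zeta, zeta> determine each other by combining a and its
   parity transform, with which Psi commutes, so the map on N is dual for B.

   n-positivity is tested on the vectors a_j zeta, where it becomes the positivity of
   sum_ij <Psi(a_i* a_j) b_ij zeta, zeta> for commuting positive matrices. *)

theory Submission
  imports Defs
begin

text \<open>The obstacle is that \<open>B\<close> carries no positivity: positive operators of
  \<open>M\<close> and of \<open>N\<close> with nonzero odd parts need not commute, so
  \<open>B a b\<close> need not be nonnegative and no Radon-Nikodym argument applies to
  \<open>B\<close> itself. The twist is a conjugation by a unitary, so it transports positivity,
  adjoints and products to the commutant of \<open>M\<close>, where positive pairs do commute. Its
  two inclusions have different weight. That twisted elements of \<open>N\<close> commute with
  \<open>M\<close> is a matter of signs in the anticommutation relations. That they fill the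
  commutant is the substantial half: the Radon-Nikodym derivative is only known to lie in the
  commutant and has to be brought back to \<open>N\<close>. Positivity of products of commuting
  positive matrices is usually drawn from a square root of one of them. Here an iteration due to
  Riesz and Nagy expands a positive contraction into a series of squares, each of which inherits the
  commutation relations.\<close>

section \<open>Complex scaling and the complex inner product\<close>

lemma module_scaleC: "module ((*\<^sub>C) :: complex \<Rightarrow> 'a :: complex_hilbert_space \<Rightarrow> 'a)"
proof
  fix x :: 'a
  have "complex_of_real 1 *\<^sub>C x = 1 *\<^sub>R x"
    by (rule scaleC_of_real)
  then show "1 *\<^sub>C x = x"
    by simp
qed (simp_all add: scaleC_add_right scaleC_add_left scaleC_scaleC)

lemma scaleC_one [simp]: "1 *\<^sub>C x = x"
  for x :: "'a :: complex_hilbert_space"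
  using module.scale_one [OF module_scaleC] .

lemma scaleC_zero_left [simp]: "0 *\<^sub>C x = 0"
  and scaleC_zero_right [simp]: "c *\<^sub>C 0 = 0"
  and scaleC_minus_left: "(- c) *\<^sub>C x = - (c *\<^sub>C x)"
  and scaleC_minus_right: "c *\<^sub>C (- x) = - (c *\<^sub>C x)"
  and scaleC_diff_left: "(c - d) *\<^sub>C x = c *\<^sub>C x - d *\<^sub>C x"
  and scaleC_diff_right: "c *\<^sub>C (x - y) = c *\<^sub>C x - c *\<^sub>C y"
  for x :: "'a :: complex_hilbert_space"
  using module.scale_zero_left [OF module_scaleC] module.scale_zero_right [OF module_scaleC]
    module.scale_minus_left [OF module_scaleC] module.scale_minus_right [OF module_scaleC]
    module.scale_left_diff_distrib [OF module_scaleC]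
    module.scale_right_diff_distrib [OF module_scaleC]
  by auto

lemma cinner_add_right: "cinner x (y + z) = cinner x y + cinner x z"
  by (metis cinner_commute cinner_add_left complex_cnj_add)

lemma cinner_scaleC_right: "cinner x (c *\<^sub>C y) = cnj c * cinner x y"
  by (metis cinner_commute cinner_scaleC_left complex_cnj_mult)

lemma cinner_same: "cinner x x = of_real ((norm x)\<^sup>2)"
proof -
  have "cinner x x \<in> \<real>"
    by (metis cinner_commute Reals_cnj_iff)
  moreover have "Re (cinner x x) = (norm x)\<^sup>2"
    by (metis inner_eq_Re_cinner power2_norm_eq_inner)
  ultimately show ?thesis
    by (metis of_real_Re)
qed

text \<open>Multiplying \<open>x\<close> by a phase makes the inner product real and nonnegative,
  which leaves the real Cauchy-Schwarz inequality.\<close>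

lemma cmod_cinner_le: "cmod (cinner x y) \<le> norm x * norm y"
proof (cases "cinner x y = 0")
  case False
  define c where "c = cnj (sgn (cinner x y))"
  have c: "cmod c = 1"
    using False by (simp add: c_def norm_sgn)
  have "c * cinner x y = of_real (cmod (cinner x y))"
    using False complex_norm_square [of "cinner x y"]
    by (simp add: c_def sgn_eq power2_eq_square field_simps)
  then have "cmod (cinner x y) = inner (c *\<^sub>C x) y"
    by (simp add: inner_eq_Re_cinner cinner_scaleC_left)
  also have "\<dots> \<le> norm (c *\<^sub>C x) * norm y"
    by (rule norm_cauchy_schwarz)
  finally show ?thesis
    by (simp add: norm_scaleC c)
qed simp

text \<open>Conjugate linearity is invisible to real scalars, so the theory of bounded bilinear maps
  supplies continuity, limits and sums in both variables.\<close>

interpretation cinner: bounded_bilinear cinner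
proof
  fix x y z :: 'a and r :: real
  show "cinner (x + y) z = cinner x z + cinner y z" "cinner x (y + z) = cinner x y + cinner x z"
    by (rule cinner_add_left, rule cinner_add_right)
  show "cinner (r *\<^sub>R x) y = r *\<^sub>R cinner x y" "cinner x (r *\<^sub>R y) = r *\<^sub>R cinner x y"
    by (simp_all add: scaleC_of_real [symmetric] cinner_scaleC_left cinner_scaleC_right
        scaleR_conv_of_real)
  show "\<exists>K. \<forall>x y :: 'a. cmod (cinner x y) \<le> norm x * norm y * K"
    by (rule exI [of _ 1]) (simp add: cmod_cinner_le)
qed

lemmas cinner_simps = cinner_add_left cinner_add_right cinner_scaleC_left cinner_scaleC_right
  cinner.diff_left cinner.diff_right cinner.minus_left cinner.minus_right
  cinner.zero_left cinner.zero_right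

lemma cinner_ext_left: "x = y" if "\<And>z. cinner x z = cinner y z"
proof -
  have "cinner (x - y) (x - y) = 0"
    by (simp add: cinner.diff_left that)
  then show ?thesis
    by (simp add: cinner_same)
qed

lemma cinner_ext_right: "x = y" if "\<And>z. cinner z x = cinner z y"
  by (metis cinner_commute cinner_ext_left that)

section \<open>Closed complex subspaces and total sets\<close>

definition csubspace :: "'a :: complex_hilbert_space set \<Rightarrow> bool" where
  "csubspace W \<longleftrightarrow> 0 \<in> W \<and> (\<forall>x\<in>W. \<forall>y\<in>W. x + y \<in> W) \<and> (\<forall>c. \<forall>x\<in>W. c *\<^sub>C x \<in> W)"

lemma csubspaceI:
  assumes "0 \<in> W" and "\<And>x y. x \<in> W \<Longrightarrow> y \<in> W \<Longrightarrow> x + y \<in> W"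
    and "\<And>c x. x \<in> W \<Longrightarrow> c *\<^sub>C x \<in> W"
  shows "csubspace W"
  using assms by (simp add: csubspace_def)

lemma csubspace_zero: "csubspace W \<Longrightarrow> 0 \<in> W"
  and csubspace_add: "csubspace W \<Longrightarrow> x \<in> W \<Longrightarrow> y \<in> W \<Longrightarrow> x + y \<in> W"
  and csubspace_scaleC: "csubspace W \<Longrightarrow> x \<in> W \<Longrightarrow> c *\<^sub>C x \<in> W"
  by (simp_all add: csubspace_def)

lemma csubspace_diff: "csubspace W \<Longrightarrow> x \<in> W \<Longrightarrow> y \<in> W \<Longrightarrow> x - y \<in> W"
  by (metis csubspace_add csubspace_scaleC diff_conv_add_uminus scaleC_minus_left scaleC_one)

lemma csubspace_scaleR: "csubspace W \<Longrightarrow> x \<in> W \<Longrightarrow> r *\<^sub>R x \<in> W"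
  by (metis csubspace_scaleC scaleC_of_real)

lemma csubspace_UNIV [simp]: "csubspace UNIV"
  by (simp add: csubspace_def)

lemma csubspace_Int: "csubspace V \<Longrightarrow> csubspace W \<Longrightarrow> csubspace (V \<inter> W)"
  by (simp add: csubspace_def)

lemma csubspace_INT: "(\<And>i. i \<in> A \<Longrightarrow> csubspace (W i)) \<Longrightarrow> csubspace (\<Inter>i\<in>A. W i)"
  by (simp add: csubspace_def)

lemma csubspace_imp_module_subspace: "csubspace W \<Longrightarrow> module.subspace (*\<^sub>C) W"
  by (simp add: csubspace_def module.subspace_def [OF module_scaleC])

lemma csubspace_closure:
  assumes W: "csubspace W"
  shows "csubspace (closure W)"
proof (rule csubspaceI)
  show "0 \<in> closure W"
    using W closure_subset csubspace_zero by blast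
  show "c *\<^sub>C x \<in> closure W" if x: "x \<in> closure W" for c x
  proof -
    obtain u where "\<And>n. u n \<in> W" and "u \<longlonglongrightarrow> x"
      using x by (auto simp: closure_sequential)
    then show ?thesis
      unfolding closure_sequential
      by (intro exI [of _ "\<lambda>n. c *\<^sub>C u n"])
         (auto intro: csubspace_scaleC [OF W] bounded_linear.tendsto [OF bounded_linear_scaleC])
  qed
  show "x + y \<in> closure W" if x: "x \<in> closure W" and y: "y \<in> closure W" for x y
  proof -
    obtain u where "\<And>n. u n \<in> W" and "u \<longlonglongrightarrow> x"
      using x by (auto simp: closure_sequential)
    moreover obtain v where "\<And>n. v n \<in> W" and "v \<longlonglongrightarrow> y"
      using y by (auto simp: closure_sequential)
    ultimately show ?thesis
      unfolding closure_sequential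
      by (intro exI [of _ "\<lambda>n. u n + v n"]) (auto intro: csubspace_add [OF W] tendsto_add)
  qed
qed

lemma total_set_induct:
  assumes S: "total_set S" and W: "csubspace W" "closed W" and "S \<subseteq> W"
  shows "x \<in> W"
proof -
  have "module.span (*\<^sub>C) S \<subseteq> W"
    by (rule module.span_minimal [OF module_scaleC])
       (use assms csubspace_imp_module_subspace in auto)
  then have "closure (module.span (*\<^sub>C) S) \<subseteq> W"
    using W(2) by (rule closure_minimal)
  then show ?thesis
    using S by (auto simp: total_set_def)
qed

text \<open>Eliminates the span: totality becomes a statement about containment in closed subspaces,
  and so passes to larger sets at once.\<close>

lemma total_set_iff:
  "total_set S \<longleftrightarrow> (\<forall>W. csubspace W \<longrightarrow> closed W \<longrightarrow> S \<subseteq> W \<longrightarrow> W = UNIV)"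
proof
  assume "total_set S"
  then show "\<forall>W. csubspace W \<longrightarrow> closed W \<longrightarrow> S \<subseteq> W \<longrightarrow> W = UNIV"
    using total_set_induct by blast
next
  assume *: "\<forall>W. csubspace W \<longrightarrow> closed W \<longrightarrow> S \<subseteq> W \<longrightarrow> W = UNIV"
  let ?W = "module.span (*\<^sub>C) S"
  have "csubspace ?W"
    using module.subspace_span [OF module_scaleC, of S]
    by (simp add: csubspace_def module.subspace_def [OF module_scaleC])
  moreover have "S \<subseteq> closure ?W"
    using module.span_superset [OF module_scaleC, of S] closure_subset by blast
  ultimately show "total_set S"
    unfolding total_set_def using * csubspace_closure closed_closure by blast
qed

lemma closed_cinner_eq_zero_left: "closed {x. cinner x y = 0}"
  by (intro closed_Collect_eq continuous_intros cinner.continuous_on)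

lemma csubspace_cinner_eq_zero_left: "csubspace {x. cinner x y = 0}"
  by (auto intro!: csubspaceI simp: cinner_simps)

lemma cinner_closure_eq_zero:
  assumes "x \<in> closure W" and "\<And>y. y \<in> W \<Longrightarrow> cinner y z = 0"
  shows "cinner x z = 0"
proof -
  have "closure W \<subseteq> {x. cinner x z = 0}"
    by (rule closure_minimal) (use assms(2) closed_cinner_eq_zero_left in auto)
  then show ?thesis
    using assms(1) by blast
qed

lemma eq_zero_of_orthogonal_total:
  assumes "total_set S" and "\<And>x. x \<in> S \<Longrightarrow> cinner x y = 0"
  shows "y = 0"
proof -
  have "y \<in> {x. cinner x y = 0}"
    by (rule total_set_induct [OF assms(1) csubspace_cinner_eq_zero_left closed_cinner_eq_zero_left])
       (use assms(2) in auto)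
  then show ?thesis
    by (simp add: cinner_same)
qed

section \<open>Riesz representation\<close>

text \<open>The representing vector is the limit of a minimising sequence of
  \<open>\<lambda>x. (norm x)\<^sup>2 - 2 * F x\<close>, which is Cauchy by the parallelogram law.\<close>

lemma riesz_real:
  fixes W :: "'a :: {real_inner, banach} set" and F :: "'a \<Rightarrow> real"
  assumes W: "subspace W"
    and F_add: "\<And>x y. x \<in> W \<Longrightarrow> y \<in> W \<Longrightarrow> F (x + y) = F x + F y"
    and F_scaleR: "\<And>r x. x \<in> W \<Longrightarrow> F (r *\<^sub>R x) = r * F x"
    and F_bound: "\<And>x. x \<in> W \<Longrightarrow> \<bar>F x\<bar> \<le> K * norm x"
  obtains y where "y \<in> closure W" and "\<And>x. x \<in> W \<Longrightarrow> F x = inner x y"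
proof -
  define J where "J x = (norm x)\<^sup>2 - 2 * F x" for x
  define m where "m = Inf (J ` W)"
  have "- K\<^sup>2 \<le> J x" if "x \<in> W" for x
  proof -
    have "0 \<le> (norm x - K)\<^sup>2"
      by simp
    also have "\<dots> = (norm x)\<^sup>2 - 2 * (K * norm x) + K\<^sup>2"
      by (simp add: power2_diff)
    finally show ?thesis
      using F_bound [OF that] by (simp add: J_def)
  qed
  then have bdd: "bdd_below (J ` W)"
    by (auto intro!: bdd_belowI)
  have ne: "J ` W \<noteq> {}"
    using subspace_0 [OF W] by blast
  have m_le: "m \<le> J x" if "x \<in> W" for x
    unfolding m_def by (rule cInf_lower) (use that bdd in auto)
  have "\<exists>x\<in>W. J x < m + 1 / real (Suc n)" for n
  proof -
    have "Inf (J ` W) < m + 1 / real (Suc n)"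
      by (simp add: m_def)
    then show ?thesis
      using cInf_less_iff [OF ne bdd] by auto
  qed
  then obtain u where u: "\<And>n. u n \<in> W" "\<And>n. J (u n) < m + 1 / real (Suc n)"
    by metis
  \<comment> \<open>Excess over the infimum controls distance: \<open>W\<close> contains the
    midpoint of \<open>x\<close> and \<open>y\<close>, where \<open>J\<close> is at least
    \<open>m\<close>.\<close>
  have para: "(norm (x - y))\<^sup>2 \<le> 2 * (J x - m) + 2 * (J y - m)" if "x \<in> W" "y \<in> W" for x y
  proof -
    have in_W: "(1/2) *\<^sub>R (x + y) \<in> W"
      using W that by (simp add: subspace_add subspace_scale)
    have "F ((1/2) *\<^sub>R (x + y)) = (F x + F y) / 2"
      using W that by (simp add: F_add F_scaleR subspace_add)
    then have "4 * J ((1/2) *\<^sub>R (x + y)) = (norm (x + y))\<^sup>2 - 4 * (F x + F y)"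
      by (simp add: J_def power_mult_distrib power2_eq_square)
    moreover have "(norm (x - y))\<^sup>2 = 2 * (norm x)\<^sup>2 + 2 * (norm y)\<^sup>2 - (norm (x + y))\<^sup>2"
      by (simp add: power2_norm_eq_inner inner_add_left inner_add_right inner_diff_left
          inner_diff_right inner_commute)
    ultimately show ?thesis
      using m_le [OF in_W] by (simp add: J_def)
  qed
  have "Cauchy u"
  proof (rule CauchyI)
    fix \<epsilon> :: real assume \<epsilon>: "\<epsilon> > 0"
    define \<delta> where "\<delta> = \<epsilon>\<^sup>2 / 4"
    obtain N where N: "1 / real (Suc N) < \<delta>"
      using nat_approx_posE [of \<delta>] \<epsilon> by (auto simp: \<delta>_def)
    have "norm (u i - u j) < \<epsilon>" if "i \<ge> N" "j \<ge> N" for i j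
    proof -
      have J_less: "J (u k) < m + \<delta>" if "k \<ge> N" for k
      proof -
        have "1 / real (Suc k) \<le> 1 / real (Suc N)"
          using that by (simp add: frac_le)
        then show ?thesis
          using u(2) [of k] N by linarith
      qed
      have "(norm (u i - u j))\<^sup>2 < 4 * \<delta>"
        using para [OF u(1) u(1), of i j] J_less [OF that(1)] J_less [OF that(2)] by argo
      then have "(norm (u i - u j))\<^sup>2 < \<epsilon>\<^sup>2"
        by (simp add: \<delta>_def)
      then show ?thesis
        using \<epsilon> by (auto intro: power2_less_imp_less)
    qed
    then show "\<exists>M. \<forall>i\<ge>M. \<forall>j\<ge>M. norm (u i - u j) < \<epsilon>"
      by blast
  qed
  then obtain y where y: "u \<longlonglongrightarrow> y"
    using Cauchy_convergent convergent_def by blast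
  have "F x = inner x y" if x: "x \<in> W" for x
  proof -
    define d where "d = inner y x - F x"
    \<comment> \<open>First-order condition: moving from \<open>u n\<close> by
      \<open>t *\<^sub>R x\<close> cannot lower \<open>J\<close> by more than the excess of
      \<open>u n\<close> over \<open>m\<close>, which vanishes in the limit.\<close>
    have nonneg: "0 \<le> 2 * t * d + t\<^sup>2 * (norm x)\<^sup>2" for t
    proof -
      have "- (1 / real (Suc n)) \<le> 2 * t * (inner (u n) x - F x) + t\<^sup>2 * (norm x)\<^sup>2" for n
      proof -
        have "u n + t *\<^sub>R x \<in> W"
          using W x u(1) by (simp add: subspace_add subspace_scale)
        then have "m \<le> J (u n + t *\<^sub>R x)"
          by (rule m_le)
        also have "(norm (u n + t *\<^sub>R x))\<^sup>2
            = (norm (u n))\<^sup>2 + 2 * t * inner (u n) x + t\<^sup>2 * (norm x)\<^sup>2"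
          unfolding power2_norm_eq_inner
          by (simp add: inner_add_left inner_add_right inner_commute power2_eq_square)
        then have "J (u n + t *\<^sub>R x)
            = J (u n) + 2 * t * (inner (u n) x - F x) + t\<^sup>2 * (norm x)\<^sup>2"
          using W x u(1) by (simp add: J_def F_add F_scaleR subspace_scale algebra_simps)
        finally show ?thesis
          using u(2) [of n] by linarith
      qed
      moreover have "(\<lambda>n. - (1 / real (Suc n))) \<longlonglongrightarrow> - 0"
        by (intro tendsto_minus lim_1_over_n [THEN LIMSEQ_Suc])
      moreover have "(\<lambda>n. 2 * t * (inner (u n) x - F x) + t\<^sup>2 * (norm x)\<^sup>2)
          \<longlonglongrightarrow> 2 * t * (inner y x - F x) + t\<^sup>2 * (norm x)\<^sup>2"
        by (intro tendsto_intros y)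
      ultimately have "- 0 \<le> 2 * t * (inner y x - F x) + t\<^sup>2 * (norm x)\<^sup>2"
        by (meson LIMSEQ_le)
      then show ?thesis
        by (simp add: d_def)
    qed
    have "d = 0"
    proof (rule ccontr)
      assume "d \<noteq> 0"
      \<comment> \<open>The quadratic in \<open>t\<close> is smallest at \<open>- d\<close> over the
        squared norm of \<open>x\<close>. Adding 1 to the denominator covers \<open>x = 0\<close>
        and still makes the value negative.\<close>
      define N where "N = 1 + (norm x)\<^sup>2"
      have N: "N > 0"
        by (simp add: N_def add_pos_nonneg)
      have norm_x: "(norm x)\<^sup>2 = N - 1"
        by (simp add: N_def)
      have "0 \<le> (2 * (- d / N) * d + (- d / N)\<^sup>2 * (norm x)\<^sup>2) * N\<^sup>2"
        using nonneg [of "- d / N"] N by (intro mult_nonneg_nonneg) auto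
      also have "\<dots> = - d\<^sup>2 * (N + 1)"
        unfolding norm_x using N by (simp add: field_simps power2_eq_square)
      also have "\<dots> < 0"
        using \<open>d \<noteq> 0\<close> N by (simp add: mult_pos_pos)
      finally show False
        by simp
    qed
    then show ?thesis
      by (simp add: d_def inner_commute)
  qed
  moreover have "y \<in> closure W"
    unfolding closure_sequential using u(1) y by blast
  ultimately show ?thesis
    using that by blast
qed

text \<open>A complex linear functional is determined by its real part, since its imaginary part at
  \<open>x\<close> is its real part at \<open>- \<i> *\<^sub>C x\<close>; so the real representing
  vector also represents the complex functional.\<close>

lemma riesz:
  fixes W :: "'a :: complex_hilbert_space set" and F :: "'a \<Rightarrow> complex"
  assumes W: "csubspace W"
    and F_add: "\<And>x y. x \<in> W \<Longrightarrow> y \<in> W \<Longrightarrow> F (x + y) = F x + F y"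
    and F_scaleC: "\<And>c x. x \<in> W \<Longrightarrow> F (c *\<^sub>C x) = c * F x"
    and F_bound: "\<And>x. x \<in> W \<Longrightarrow> cmod (F x) \<le> K * norm x"
  obtains y where "y \<in> closure W" and "\<And>x. x \<in> W \<Longrightarrow> F x = cinner x y"
proof -
  have subspace: "subspace W"
    using W by (auto simp: subspace_def csubspace_zero csubspace_add csubspace_scaleR)
  have add: "Re (F (x + x')) = Re (F x) + Re (F x')" if "x \<in> W" "x' \<in> W" for x x'
    using F_add [OF that] by simp
  have scaleR: "Re (F (r *\<^sub>R x)) = r * Re (F x)" if "x \<in> W" for r x
    using F_scaleC [OF that, of "of_real r"] by (simp add: scaleC_of_real)
  have bound: "\<bar>Re (F x)\<bar> \<le> K * norm x" if "x \<in> W" for x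
    using abs_Re_le_cmod F_bound [OF that] by (rule order_trans)
  have "\<exists>y. y \<in> closure W \<and> (\<forall>x\<in>W. Re (F x) = inner x y)"
    by (rule riesz_real [of W "\<lambda>x. Re (F x)" K, OF subspace add scaleR bound]) auto
  then obtain y where y: "y \<in> closure W" "\<And>x. x \<in> W \<Longrightarrow> Re (F x) = inner x y"
    by blast
  have "F x = cinner x y" if x: "x \<in> W" for x
  proof (rule complex_eqI)
    show "Re (F x) = Re (cinner x y)"
      using y(2) [OF x] by (simp add: inner_eq_Re_cinner)
    have "Re (F (- \<i> *\<^sub>C x)) = Re (cinner (- \<i> *\<^sub>C x) y)"
      using y(2) W x by (simp add: inner_eq_Re_cinner csubspace_scaleC)
    then show "Im (F x) = Im (cinner x y)"
      by (simp add: F_scaleC [OF x] cinner_scaleC_left)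
  qed
  then show ?thesis
    by (rule that [OF y(1)])
qed

lemma closure_eq_zero_of_orthogonal:
  assumes "y \<in> closure W" and "\<And>x. x \<in> W \<Longrightarrow> cinner x y = 0"
  shows "y = 0"
  using cinner_closure_eq_zero [OF assms] by (simp add: cinner_same)

lemma eq_of_cinner_eq_on_closure:
  assumes W: "csubspace W" and "y \<in> closure W" "z \<in> closure W"
    and eq: "\<And>x. x \<in> W \<Longrightarrow> cinner x y = cinner x z"
  shows "y = z"
proof -
  have "y - z = 0"
    using csubspace_diff [OF csubspace_closure [OF W] assms(2,3)]
    by (rule closure_eq_zero_of_orthogonal) (simp add: cinner_simps eq)
  then show ?thesis
    by simp
qed

text \<open>By continuity the bound holds on the closure, where \<open>x = y\<close> is an
  admissible choice.\<close>

lemma norm_le_of_cinner_bound: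
  assumes y: "y \<in> closure W" and bound: "\<And>x. x \<in> W \<Longrightarrow> cmod (cinner x y) \<le> K * norm x"
    and K: "0 \<le> K"
  shows "norm y \<le> K"
proof -
  have "closed {x. cmod (cinner x y) \<le> K * norm x}"
    by (intro closed_Collect_le continuous_on_norm continuous_on_mult cinner.continuous_on
        continuous_on_const continuous_on_id)
  then have "closure W \<subseteq> {x. cmod (cinner x y) \<le> K * norm x}"
    by (intro closure_minimal) (auto intro: bound)
  then have "cmod (cinner y y) \<le> K * norm y"
    using y by blast
  then have "norm y * norm y \<le> K * norm y"
    by (simp add: cinner_same power2_eq_square norm_mult)
  then show ?thesis
    using K by (cases "y = 0") auto
qed

text \<open>Common source of adjoints, projections and Radon-Nikodym derivatives. Requiring the
  values of \<open>T\<close> to lie in the closure of \<open>W\<close> makes the representing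
  vectors unique also when \<open>W\<close> is not dense, and uniqueness yields linearity of
  \<open>T\<close>.\<close>

lemma operator_of_form:
  fixes W :: "'a :: complex_hilbert_space set" and G :: "'a \<Rightarrow> 'a \<Rightarrow> complex"
  assumes W: "csubspace W"
    and add_right: "\<And>v x y. x \<in> W \<Longrightarrow> y \<in> W \<Longrightarrow> G v (x + y) = G v x + G v y"
    and scaleC_right: "\<And>v c x. x \<in> W \<Longrightarrow> G v (c *\<^sub>C x) = c * G v x"
    and add_left: "\<And>u v x. x \<in> W \<Longrightarrow> G (u + v) x = G u x + G v x"
    and scaleC_left: "\<And>v c x. x \<in> W \<Longrightarrow> G (c *\<^sub>C v) x = cnj c * G v x"
    and bound: "\<And>v x. x \<in> W \<Longrightarrow> cmod (G v x) \<le> K * norm v * norm x"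
    and K: "0 \<le> K"
  obtains T where "T \<in> bounded_ops" and "\<And>v. T v \<in> closure W"
    and "\<And>v x. x \<in> W \<Longrightarrow> G v x = cinner x (T v)"
proof -
  have "\<exists>y\<in>closure W. \<forall>x\<in>W. G v x = cinner x y" for v
    by (rule riesz [of W "G v" "K * norm v", OF W add_right scaleC_right bound]) auto
  then obtain T where T: "\<And>v. T v \<in> closure W" "\<And>v x. x \<in> W \<Longrightarrow> G v x = cinner x (T v)"
    by metis
  note cl = csubspace_closure [OF W]
  note eqI = eq_of_cinner_eq_on_closure [OF W]
  have T_add: "T (u + v) = T u + T v" for u v
    by (rule eqI) (auto simp: T(1) csubspace_add [OF cl] cinner_simps T(2) [symmetric] add_left)
  have T_scaleC: "T (c *\<^sub>C v) = c *\<^sub>C T v" for c v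
    by (rule eqI) (auto simp: T(1) csubspace_scaleC [OF cl] cinner_simps T(2) [symmetric] scaleC_left)
  have T_norm: "norm (T v) \<le> norm v * K" for v
    by (rule norm_le_of_cinner_bound [OF T(1)])
       (use bound K in \<open>auto simp: T(2) [symmetric] mult_ac\<close>)
  have T_scaleR: "T (r *\<^sub>R v) = r *\<^sub>R T v" for r v
    using T_scaleC [of "of_real r" v] by (simp add: scaleC_of_real)
  have bl: "bounded_linear T"
    by (rule bounded_linear_intro [OF T_add T_scaleR T_norm])
  show ?thesis
    by (rule that [of "Blinfun T"])
       (auto simp: bounded_linear_Blinfun_apply [OF bl] bounded_ops_def T T_scaleC)
qed

section \<open>Adjoints and commutants\<close>

lemma bounded_ops_scaleC: "T \<in> bounded_ops \<Longrightarrow> T (c *\<^sub>C x) = c *\<^sub>C T x"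
  by (simp add: bounded_ops_def)

lemma scaleC_op_apply [simp]: "scaleC_op c T x = c *\<^sub>C T x"
  by transfer simp

lemma bounded_ops_id [simp]: "id_blinfun \<in> bounded_ops"
  and bounded_ops_zero [simp]: "0 \<in> bounded_ops"
  and bounded_ops_add: "S \<in> bounded_ops \<Longrightarrow> T \<in> bounded_ops \<Longrightarrow> S + T \<in> bounded_ops"
  and bounded_ops_diff: "S \<in> bounded_ops \<Longrightarrow> T \<in> bounded_ops \<Longrightarrow> S - T \<in> bounded_ops"
  and bounded_ops_compose: "S \<in> bounded_ops \<Longrightarrow> T \<in> bounded_ops \<Longrightarrow> S o\<^sub>L T \<in> bounded_ops"
  and bounded_ops_scaleC_op: "T \<in> bounded_ops \<Longrightarrow> scaleC_op c T \<in> bounded_ops"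
  by (auto simp: bounded_ops_def blinfun.add_left blinfun.diff_left scaleC_add_right
      scaleC_diff_right scaleC_scaleC mult.commute)

lemma adjoint_exists:
  assumes T: "T \<in> bounded_ops"
  obtains S where "S \<in> bounded_ops" and "\<And>x y. cinner (T x) y = cinner x (S y)"
proof -
  have bound: "cmod (cinner (T x) v) \<le> norm T * norm v * norm x" for x v
  proof -
    have "cmod (cinner (T x) v) \<le> norm (T x) * norm v"
      by (rule cmod_cinner_le)
    also have "\<dots> \<le> (norm T * norm x) * norm v"
      by (intro mult_right_mono norm_blinfun) simp
    finally show ?thesis
      by (simp add: mult_ac)
  qed
  show ?thesis
    by (rule operator_of_form [OF csubspace_UNIV, of "\<lambda>v x. cinner (T x) v" "norm T"])
       (use bound that bounded_ops_scaleC [OF T] in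
         \<open>auto simp: cinner_simps blinfun.add_right\<close>)
qed

lemma adj_eqI:
  fixes S T :: "'a :: complex_hilbert_space op"
  assumes "\<And>x y. cinner (T x) y = cinner x (S y)"
  shows "adj T = S"
  unfolding adj_def
proof (rule the_equality)
  show "\<forall>x y. cinner (T x) y = cinner x (S y)"
    using assms by blast
  show "R = S" if "\<forall>x y. cinner (T x) y = cinner x (R y)" for R :: "'a op"
    by (rule blinfun_eqI, rule cinner_ext_right) (metis that assms)
qed

lemma adj_bounded_ops [simp]: "T \<in> bounded_ops \<Longrightarrow> adj T \<in> bounded_ops"
  by (metis adjoint_exists adj_eqI)

lemma cinner_adj_right: "T \<in> bounded_ops \<Longrightarrow> cinner x (adj T y) = cinner (T x) y"
  by (metis adjoint_exists adj_eqI)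

lemma cinner_adj_left: "T \<in> bounded_ops \<Longrightarrow> cinner (adj T x) y = cinner x (T y)"
  by (metis cinner_adj_right cinner_commute)

lemma adj_adj [simp]: "T \<in> bounded_ops \<Longrightarrow> adj (adj T) = T"
  by (rule adj_eqI) (simp add: cinner_adj_left)

lemma adj_compose: "S \<in> bounded_ops \<Longrightarrow> T \<in> bounded_ops \<Longrightarrow> adj (S o\<^sub>L T) = adj T o\<^sub>L adj S"
  by (rule adj_eqI) (simp add: cinner_adj_right)

lemma adj_add: "S \<in> bounded_ops \<Longrightarrow> T \<in> bounded_ops \<Longrightarrow> adj (S + T) = adj S + adj T"
  by (rule adj_eqI) (simp add: cinner_adj_right cinner_simps blinfun.add_left)

lemma adj_diff: "S \<in> bounded_ops \<Longrightarrow> T \<in> bounded_ops \<Longrightarrow> adj (S - T) = adj S - adj T"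
  by (rule adj_eqI) (simp add: cinner_adj_right cinner_simps blinfun.diff_left)

lemma adj_scaleC_op: "T \<in> bounded_ops \<Longrightarrow> adj (scaleC_op c T) = scaleC_op (cnj c) (adj T)"
  by (rule adj_eqI) (simp add: cinner_adj_right cinner_simps)

lemma adj_id [simp]: "adj id_blinfun = id_blinfun"
  by (rule adj_eqI) simp

lemma op_eqI_total:
  assumes "S \<in> bounded_ops" "T \<in> bounded_ops" "total_set X" "\<And>x. x \<in> X \<Longrightarrow> S x = T x"
  shows "S = T"
proof (rule blinfun_eqI)
  fix x
  have "x \<in> {x. S x = T x}"
  proof (rule total_set_induct [OF assms(3)])
    show "csubspace {x. S x = T x}"
      using assms(1,2) by (auto intro!: csubspaceI simp: bounded_ops_scaleC blinfun.add_right)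
    show "closed {x. S x = T x}"
      by (intro closed_Collect_eq continuous_intros)
  qed (use assms(4) in auto)
  then show "S x = T x"
    by simp
qed

lemma commutant_bounded_ops: "T \<in> commutant S \<Longrightarrow> T \<in> bounded_ops"
  by (simp add: commutant_def)

lemma commutantD: "T \<in> commutant S \<Longrightarrow> X \<in> S \<Longrightarrow> T (X x) = X (T x)"
  by (metis (mono_tags, lifting) blinfun_apply_blinfun_compose commutant_def mem_Collect_eq)

lemma commutantI:
  "T \<in> bounded_ops \<Longrightarrow> (\<And>X x. X \<in> S \<Longrightarrow> T (X x) = X (T x)) \<Longrightarrow> T \<in> commutant S"
  for S :: "'a :: complex_hilbert_space op set"
  by (auto simp: commutant_def intro: blinfun_eqI)

lemma commutant_antimono: "S \<subseteq> S' \<Longrightarrow> commutant S' \<subseteq> commutant S"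
  by (auto simp: commutant_def)

lemma subset_double_commutant: "S \<subseteq> bounded_ops \<Longrightarrow> S \<subseteq> commutant (commutant S)"
  by (auto simp: commutant_def)

lemma triple_commutant:
  assumes "S \<subseteq> bounded_ops"
  shows "commutant (commutant (commutant S)) = commutant S"
proof
  show "commutant (commutant (commutant S)) \<subseteq> commutant S"
    by (rule commutant_antimono [OF subset_double_commutant [OF assms]])
  show "commutant S \<subseteq> commutant (commutant (commutant S))"
    by (rule subset_double_commutant) (auto simp: commutant_def)
qed

lemma adj_commutant:
  assumes "S \<subseteq> bounded_ops" "adj ` S \<subseteq> S" "T \<in> commutant S"
  shows "adj T \<in> commutant S"
proof (rule commutantI)
  have T: "T \<in> bounded_ops"
    using assms(3) by (rule commutant_bounded_ops)
  then show "adj T \<in> bounded_ops"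
    by simp
  fix X x assume X: "X \<in> S"
  have "X \<in> bounded_ops"
    using X assms(1) by blast
  have "cinner z (adj T (X x)) = cinner z (X (adj T x))" for z
  proof -
    have "cinner z (adj T (X x)) = cinner (adj X (T z)) x"
      using T \<open>X \<in> bounded_ops\<close> by (simp only: cinner_adj_right cinner_adj_left)
    also have "adj X (T z) = T (adj X z)"
      using commutantD [OF assms(3), of "adj X"] assms(2) X by auto
    also have "cinner (T (adj X z)) x = cinner z (X (adj T x))"
      using T \<open>X \<in> bounded_ops\<close> by (simp only: cinner_adj_right [symmetric] cinner_adj_left)
    finally show ?thesis .
  qed
  then show "adj T (X x) = X (adj T x)"
    by (rule cinner_ext_right)
qed

text \<open>As von Neumann algebras are double commutants by definition, order reversal of
  \<open>commutant\<close> and \<open>triple_commutant\<close> suffice: the right-hand side is such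
  an algebra and lies in every other one that contains \<open>S\<close>.\<close>

lemma vn_generated_eq:
  assumes S: "S \<subseteq> bounded_ops"
  shows "vn_generated S = commutant (commutant (S \<union> adj ` S))"
proof
  let ?G = "S \<union> adj ` S"
  have G: "?G \<subseteq> bounded_ops" "adj ` ?G \<subseteq> ?G"
    using S by auto
  have G': "commutant ?G \<subseteq> bounded_ops"
    by (auto dest: commutant_bounded_ops)
  have "adj ` commutant ?G \<subseteq> commutant ?G"
    using adj_commutant [OF G] by blast
  then have "adj T \<in> commutant (commutant ?G)" if "T \<in> commutant (commutant ?G)" for T
    using adj_commutant [OF G'] that by blast
  then have "von_neumann_algebra (commutant (commutant ?G))"
    unfolding von_neumann_algebra_def
    using triple_commutant [OF G'] commutant_bounded_ops by blast
  moreover have "S \<subseteq> commutant (commutant ?G)"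
    using subset_double_commutant [OF G(1)] by blast
  ultimately show "vn_generated S \<subseteq> commutant (commutant ?G)"
    unfolding vn_generated_def by blast
  show "commutant (commutant ?G) \<subseteq> vn_generated S"
    unfolding vn_generated_def
  proof (rule Inter_greatest)
    fix M assume "M \<in> {M. von_neumann_algebra M \<and> S \<subseteq> M}"
    then have M: "commutant (commutant M) = M" and "?G \<subseteq> M"
      by (auto simp: von_neumann_algebra_def)
    then show "commutant (commutant ?G) \<subseteq> M"
      using commutant_antimono [OF commutant_antimono [of ?G M]] by simp
  qed
qed

lemma commutant_compose: "X \<in> commutant S \<Longrightarrow> Y \<in> commutant S \<Longrightarrow> X o\<^sub>L Y \<in> commutant S"
  by (rule commutantI) (auto simp: commutantD bounded_ops_compose commutant_bounded_ops)

lemma commutant_add: "X \<in> commutant S \<Longrightarrow> Y \<in> commutant S \<Longrightarrow> S \<subseteq> bounded_ops \<Longrightarrow> X + Y \<in> commutant S"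
  by (rule commutantI)
     (auto simp: commutantD bounded_ops_add commutant_bounded_ops blinfun.add_left blinfun.add_right)

lemma commutant_diff: "X \<in> commutant S \<Longrightarrow> Y \<in> commutant S \<Longrightarrow> S \<subseteq> bounded_ops \<Longrightarrow> X - Y \<in> commutant S"
  by (rule commutantI)
     (auto simp: commutantD bounded_ops_diff commutant_bounded_ops blinfun.diff_left blinfun.diff_right)

lemma commutant_scaleC_op: "X \<in> commutant S \<Longrightarrow> S \<subseteq> bounded_ops \<Longrightarrow> scaleC_op c X \<in> commutant S"
  by (rule commutantI)
     (auto simp: commutantD bounded_ops_scaleC_op commutant_bounded_ops bounded_ops_scaleC subsetD)

lemma commutant_id: "id_blinfun \<in> commutant S"
  by (rule commutantI) auto

text \<open>The orthogonal projection onto the closure of \<open>W\<close>, obtained by taking the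
  inner product itself as the form.\<close>

lemma projection_exists:
  assumes W: "csubspace W"
  shows "\<exists>P\<in>bounded_ops. (\<forall>v. P v \<in> closure W) \<and> (\<forall>v. \<forall>x\<in>W. cinner x (P v) = cinner x v)"
proof (rule operator_of_form [OF W, of "\<lambda>v x. cinner x v" 1])
  fix T :: "'a op"
  assume T: "T \<in> bounded_ops" "\<And>v. T v \<in> closure W"
    and form: "\<And>v x. x \<in> W \<Longrightarrow> cinner x v = cinner x (T v)"
  show ?thesis
    using T form by (intro bexI [of _ T] conjI allI ballI) (simp_all flip: form)
next
  show "cmod (cinner x v) \<le> 1 * norm v * norm x" for v x :: 'a
    using cmod_cinner_le [of x v] by (simp add: mult.commute)
qed (simp_all add: cinner_simps)

section \<open>Positive sesquilinear forms\<close>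

lemma nonneg_Reals_iff_Re: "z \<in> \<real>\<^sub>\<ge>\<^sub>0 \<longleftrightarrow> Im z = 0 \<and> 0 \<le> Re z"
  by (auto simp: complex_nonneg_Reals_iff)

lemma sum_nonneg_Reals: "(\<And>i. i \<in> A \<Longrightarrow> f i \<in> \<real>\<^sub>\<ge>\<^sub>0) \<Longrightarrow> sum f A \<in> \<real>\<^sub>\<ge>\<^sub>0"
  for f :: "'i \<Rightarrow> complex"
  by (simp add: nonneg_Reals_iff_Re sum_nonneg)

lemma nonneg_Reals_of_real_mult_iff: "K > 0 \<Longrightarrow> of_real K * z \<in> \<real>\<^sub>\<ge>\<^sub>0 \<longleftrightarrow> z \<in> \<real>\<^sub>\<ge>\<^sub>0"
  for z :: complex
  by (simp add: nonneg_Reals_iff_Re zero_le_mult_iff)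

lemma sum_rotate:
  "(\<Sum>j\<in>A. \<Sum>q\<in>B. \<Sum>i\<in>C. g j q i) = (\<Sum>q\<in>B. \<Sum>i\<in>C. \<Sum>j\<in>A. g j q i)"
proof -
  have "(\<Sum>j\<in>A. \<Sum>q\<in>B. \<Sum>i\<in>C. g j q i) = (\<Sum>q\<in>B. \<Sum>j\<in>A. \<Sum>i\<in>C. g j q i)"
    by (rule sum.swap)
  also have "\<dots> = (\<Sum>q\<in>B. \<Sum>i\<in>C. \<Sum>j\<in>A. g j q i)"
    by (rule sum.cong [OF refl]) (rule sum.swap)
  finally show ?thesis .
qed

text \<open>Polarisation at \<open>x + y\<close> and at \<open>x + \<i> y\<close>. Addition and
  scaling are parameters because the vectors may be families indexed by naturals, a type without
  complex scaling of its own.\<close>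

lemma hermitian_of_real_diagonal:
  fixes Q :: "'v \<Rightarrow> 'v \<Rightarrow> complex" and add :: "'v \<Rightarrow> 'v \<Rightarrow> 'v" and scale :: "complex \<Rightarrow> 'v \<Rightarrow> 'v"
  assumes closed: "x \<in> W" "y \<in> W" "add x y \<in> W" "scale \<i> y \<in> W" "add x (scale \<i> y) \<in> W"
    and add: "\<And>u v w. u \<in> W \<Longrightarrow> v \<in> W \<Longrightarrow> w \<in> W \<Longrightarrow> Q (add u v) w = Q u w + Q v w"
      "\<And>u v w. u \<in> W \<Longrightarrow> v \<in> W \<Longrightarrow> w \<in> W \<Longrightarrow> Q w (add u v) = Q w u + Q w v"
    and scale: "\<And>u w. u \<in> W \<Longrightarrow> w \<in> W \<Longrightarrow> Q (scale \<i> u) w = \<i> * Q u w"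
      "\<And>u w. u \<in> W \<Longrightarrow> w \<in> W \<Longrightarrow> Q w (scale \<i> u) = - \<i> * Q w u"
    and real: "\<And>u. u \<in> W \<Longrightarrow> Im (Q u u) = 0"
  shows "Q x y = cnj (Q y x)"
proof -
  have "Q (add x y) (add x y) = Q x x + Q x y + Q y x + Q y y"
    using closed by (simp add: add)
  then have Im: "Im (Q x y) + Im (Q y x) = 0"
    using closed real [of "add x y"] by (simp add: real)
  have "Q (add x (scale \<i> y)) (add x (scale \<i> y)) = Q x x - \<i> * Q x y + \<i> * Q y x + Q y y"
    using closed by (simp add: add scale algebra_simps)
  then have "Re (Q y x) - Re (Q x y) = 0"
    using closed real [of "add x (scale \<i> y)"] by (simp add: real)
  with Im show ?thesis
    by (simp add: complex_eq_iff)
qed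

text \<open>Normalise \<open>x\<close> and \<open>y\<close> to unit vectors \<open>u\<close> and
  \<open>v\<close>, with a phase that makes \<open>q u v\<close> real and nonnegative. Positivity of
  \<open>q\<close> at \<open>u - v\<close> then bounds \<open>q u v\<close> by the mean of the two
  diagonal values, each at most \<open>K\<close>.\<close>

lemma positive_form_bound:
  fixes W :: "'a :: complex_hilbert_space set" and q :: "'a \<Rightarrow> 'a \<Rightarrow> complex"
  assumes W: "csubspace W"
    and add_left: "\<And>u v w. u \<in> W \<Longrightarrow> v \<in> W \<Longrightarrow> w \<in> W \<Longrightarrow> q (u + v) w = q u w + q v w"
    and add_right: "\<And>u v w. u \<in> W \<Longrightarrow> v \<in> W \<Longrightarrow> w \<in> W \<Longrightarrow> q w (u + v) = q w u + q w v"
    and scale_left: "\<And>c u w. u \<in> W \<Longrightarrow> w \<in> W \<Longrightarrow> q (c *\<^sub>C u) w = c * q u w"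
    and scale_right: "\<And>c u w. u \<in> W \<Longrightarrow> w \<in> W \<Longrightarrow> q w (c *\<^sub>C u) = cnj c * q w u"
    and nonneg: "\<And>u. u \<in> W \<Longrightarrow> q u u \<in> \<real>\<^sub>\<ge>\<^sub>0"
    and bound: "\<And>u. u \<in> W \<Longrightarrow> Re (q u u) \<le> K * (norm u)\<^sup>2"
    and x: "x \<in> W" and y: "y \<in> W"
  shows "cmod (q x y) \<le> K * norm x * norm y"
proof (cases "x = 0 \<or> y = 0")
  case True
  have "q 0 y = 0" "q x 0 = 0"
    using scale_left [OF x y, of 0] scale_right [OF y x, of 0] by simp_all
  then show ?thesis
    using True by auto
next
  case False
  define a where "a = norm x"
  define b where "b = norm y"
  have a: "a > 0" and b: "b > 0"
    using False by (auto simp: a_def b_def)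
  obtain c where c: "cmod c = 1" "c * q x y = of_real (cmod (q x y))"
  proof (cases "q x y = 0")
    case True
    then show ?thesis
      using that [of 1] by simp
  next
    case False
    then show ?thesis
      using complex_norm_square [of "q x y"]
      by (intro that [of "cnj (sgn (q x y))"])
         (simp_all add: norm_divide sgn_eq power2_eq_square field_simps)
  qed
  define u where "u = (c / of_real a) *\<^sub>C x"
  define v where "v = (1 / of_real b) *\<^sub>C y"
  have u: "u \<in> W" "norm u = 1" and v: "v \<in> W" "norm v = 1"
    using W x y a b c False
    by (auto simp: u_def v_def csubspace_scaleC norm_scaleC norm_divide a_def b_def)
  \<comment> \<open>Writing the negative as a complex multiple keeps the expansion within the
    hypotheses on \<open>q\<close>, which speak of sums and multiples only.\<close>
  have m: "(- 1) *\<^sub>C v \<in> W"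
    using W v by (simp add: csubspace_scaleC)
  have herm: "q u v = cnj (q v u)"
    by (rule hermitian_of_real_diagonal [where W = W and add = "(+)" and scale = "(*\<^sub>C)"])
       (use W u v nonneg in \<open>auto simp: csubspace_add csubspace_scaleC add_left add_right scale_left
          scale_right nonneg_Reals_iff_Re\<close>)
  have "q (u + (- 1) *\<^sub>C v) (u + (- 1) *\<^sub>C v) = q u u - q u v - q v u + q v v"
    using u v m W by (simp add: add_left add_right scale_left scale_right csubspace_add)
  moreover have "0 \<le> Re (q (u + (- 1) *\<^sub>C v) (u + (- 1) *\<^sub>C v))"
    using nonneg [of "u + (- 1) *\<^sub>C v"] W u m by (simp add: csubspace_add nonneg_Reals_iff_Re)
  ultimately have "2 * Re (q u v) \<le> Re (q u u) + Re (q v v)"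
    using herm by (simp add: complex_eq_iff)
  then have "Re (q u v) \<le> K"
    using bound [OF u(1)] bound [OF v(1)] u v by simp
  moreover have "q u v = of_real (cmod (q x y) / (a * b))"
  proof -
    have "q u v = (c * q x y) / of_real (a * b)"
      using W x y by (simp add: u_def v_def scale_left scale_right csubspace_scaleC)
    then show ?thesis
      by (simp add: c)
  qed
  ultimately show ?thesis
    using a b by (simp add: a_def [symmetric] b_def [symmetric] field_simps)
qed

lemma positive_op_hermitian:
  assumes T: "T \<in> bounded_ops" and "positive_op T"
  shows "adj T = T"
proof (rule adj_eqI)
  fix x y
  have "cinner (T x) y = cnj (cinner (T y) x)"
    by (rule hermitian_of_real_diagonal [where W = UNIV and add = "(+)" and scale = "(*\<^sub>C)"])
       (use assms in \<open>auto simp: cinner_simps blinfun.add_right bounded_ops_scaleC positive_op_def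
          nonneg_Reals_iff_Re\<close>)
  then show "cinner (T x) y = cinner x (T y)"
    by (metis cinner_commute)
qed

text \<open>The form of \<open>T\<close> at \<open>x - t *\<^sub>R T x\<close> is a nonnegative
  quadratic in \<open>t\<close> without constant term, so its linear coefficient, a multiple of the
  squared norm of \<open>T x\<close>, must vanish.\<close>

lemma positive_op_eq_zero:
  assumes T: "T \<in> bounded_ops" and pos: "positive_op T" and x: "cinner (T x) x = 0"
  shows "T x = 0"
proof -
  define d where "d = (norm (T x))\<^sup>2"
  define k where "k = Re (cinner (T (T x)) (T x))"
  have sym: "cinner (T u) v = cinner u (T v)" for u v
    by (metis T cinner_adj_right pos positive_op_hermitian)
  have "0 \<le> - 2 * t * d + t\<^sup>2 * k" for t
  proof -
    have "cinner (T (x - t *\<^sub>R T x)) (x - t *\<^sub>R T x)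
        = cinner (T x) x - 2 * of_real t * cinner (T x) (T x) + of_real (t\<^sup>2) * cinner (T (T x)) (T x)"
      by (simp add: cinner.diff_left cinner.diff_right blinfun.diff_right blinfun.scaleR_right
          cinner.scaleR_left cinner.scaleR_right sym scaleR_conv_of_real power2_eq_square algebra_simps)
    moreover have "0 \<le> Re (cinner (T (x - t *\<^sub>R T x)) (x - t *\<^sub>R T x))"
      using pos by (simp add: positive_op_def nonneg_Reals_iff_Re)
    ultimately show ?thesis
      using x by (simp add: cinner_same d_def k_def)
  qed
  note le = this
  have "k \<ge> 0"
    using pos by (simp add: positive_op_def nonneg_Reals_iff_Re k_def)
  \<comment> \<open>Passing to \<open>m = k + 1\<close> keeps the denominator of the test value
    \<open>t = d / m\<close> positive even for \<open>k = 0\<close>.\<close>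
  then obtain m where m: "k = m - 1" "m \<ge> 1"
    by (metis add_diff_cancel_right' le_add_same_cancel2)
  have "0 \<le> (- 2 * (d / m) * d + (d / m)\<^sup>2 * k) * m\<^sup>2"
    using le [of "d / m"] by (intro mult_nonneg_nonneg) auto
  also have "\<dots> = - (d\<^sup>2 * (m + 1))"
    unfolding m(1) using m(2) by (simp add: field_simps power2_eq_square)
  finally have "d\<^sup>2 * (m + 1) \<le> 0"
    by simp
  then have "d = 0"
    using m(2) by (auto simp: mult_le_0_iff)
  then show ?thesis
    by (simp add: d_def)
qed

section \<open>Products of commuting positive matrices\<close>

definition vip :: "nat \<Rightarrow> (nat \<Rightarrow> 'a :: complex_hilbert_space) \<Rightarrow> (nat \<Rightarrow> 'a) \<Rightarrow> complex" where
  "vip n u v = (\<Sum>i<n. cinner (u i) (v i))"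

text \<open>A symmetric operator with \<open>0 \<le> h \<le> 1\<close> on the \<open>n\<close>-fold
  direct sum, kept as a plain function on families. Of linearity it records compatibility with
  differences, the operation from which the iteration below is built.\<close>

definition positive_contraction ::
  "nat \<Rightarrow> ((nat \<Rightarrow> 'a :: complex_hilbert_space) \<Rightarrow> nat \<Rightarrow> 'a) \<Rightarrow> bool" where
  "positive_contraction n h \<longleftrightarrow>
     (\<forall>u v. h (\<lambda>i. u i - v i) = (\<lambda>i. h u i - h v i)) \<and>
     (\<forall>u v. vip n (h u) v = vip n u (h v)) \<and>
     (\<forall>v. 0 \<le> Re (vip n (h v) v) \<and> Re (vip n (h v) v) \<le> Re (vip n v v))"

lemma positive_contraction_sym: "positive_contraction n h \<Longrightarrow> vip n (h u) v = vip n u (h v)"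
  and positive_contraction_nonneg: "positive_contraction n h \<Longrightarrow> 0 \<le> Re (vip n (h v) v)"
  unfolding positive_contraction_def by blast+

lemma vip_diff: "vip n (\<lambda>i. u i - u' i) v = vip n u v - vip n u' v"
    "vip n v (\<lambda>i. u i - u' i) = vip n v u - vip n v u'"
  by (simp_all add: vip_def cinner_simps sum_subtractf)

lemma vip_same: "Re (vip n v v) = (\<Sum>i<n. (norm (v i))\<^sup>2)"
  by (simp add: vip_def cinner_same)

text \<open>This is \<open>h - h\<^sup>2\<close>. The squares of the iterates telescope, so their
  series sums to \<open>h\<close>.\<close>

definition riesz_nagy_step ::
  "((nat \<Rightarrow> 'a :: complex_hilbert_space) \<Rightarrow> nat \<Rightarrow> 'a) \<Rightarrow> (nat \<Rightarrow> 'a) \<Rightarrow> nat \<Rightarrow> 'a" where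
  "riesz_nagy_step h v = (\<lambda>i. h v i - h (h v) i)"

text \<open>The lower bound rests on \<open>h - h\<^sup>2 = h (1 - h) h + (1 - h) h (1 - h)\<close>.\<close>

lemma positive_contraction_riesz_nagy_step:
  assumes "positive_contraction n h"
  shows "positive_contraction n (riesz_nagy_step h)"
proof -
  have diff: "h (\<lambda>i. u i - v i) = (\<lambda>i. h u i - h v i)"
    and sym: "vip n (h u) v = vip n u (h v)"
    and nonneg: "0 \<le> Re (vip n (h v) v)" and le: "Re (vip n (h v) v) \<le> Re (vip n v v)" for u v
    using assms unfolding positive_contraction_def by blast+
  have diff': "h (riesz_nagy_step h v) = (\<lambda>i. h (h v) i - h (h (h v)) i)" for v
    by (simp add: riesz_nagy_step_def diff)
  show ?thesis
    unfolding positive_contraction_def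
  proof (intro conjI allI)
    fix u v
    show "riesz_nagy_step h (\<lambda>i. u i - v i) = (\<lambda>i. riesz_nagy_step h u i - riesz_nagy_step h v i)"
      by (simp add: riesz_nagy_step_def diff fun_eq_iff)
    show "vip n (riesz_nagy_step h u) v = vip n u (riesz_nagy_step h v)"
      by (simp add: riesz_nagy_step_def vip_diff sym)
    have "0 \<le> Re (vip n (h (\<lambda>i. v i - h v i)) (\<lambda>i. v i - h v i))"
      by (rule nonneg)
    then have "0 \<le> Re (vip n (h v) v) - Re (vip n (h v) (h v)) - Re (vip n (h (h v)) v)
        + Re (vip n (h (h v)) (h v))"
      by (simp add: diff vip_diff)
    moreover have "Re (vip n (h (h v)) (h v)) \<le> Re (vip n (h v) (h v))"
      by (rule le)
    ultimately show "0 \<le> Re (vip n (riesz_nagy_step h v) v)"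
      by (simp add: riesz_nagy_step_def vip_diff)
    have "0 \<le> Re (vip n (h v) (h v))"
      by (simp add: vip_same sum_nonneg)
    then show "Re (vip n (riesz_nagy_step h v) v) \<le> Re (vip n v v)"
      using le [of v] by (simp add: riesz_nagy_step_def vip_diff sym)
  qed
qed

lemma positive_contraction_riesz_nagy_iterate:
  "positive_contraction n h \<Longrightarrow> positive_contraction n ((riesz_nagy_step ^^ k) h)"
  by (induction k) (auto intro: positive_contraction_riesz_nagy_step)

text \<open>The partial sums fall short of \<open>h\<close> by exactly \<open>H m\<close>. For
  \<open>y = u\<close> the terms are squared norms with partial sums at most
  \<open>vip n (h u) u\<close>, so \<open>H m u\<close> tends to 0 and the remainder disappears for
  every \<open>y\<close>.\<close>

lemma riesz_nagy_series:
  assumes h: "positive_contraction n h"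
  defines "H \<equiv> \<lambda>k. (riesz_nagy_step ^^ k) h"
  shows "(\<lambda>m. \<Sum>k<m. vip n (H k u) (H k y)) \<longlonglongrightarrow> vip n (h u) y"
proof -
  have sym: "vip n (H k u) v = vip n u (H k v)" for k u v
    unfolding H_def by (rule positive_contraction_sym [OF positive_contraction_riesz_nagy_iterate [OF h]])
  have partial: "(\<Sum>k<m. vip n (H k u) (H k y)) = vip n (h u) y - vip n (H m u) y" for m u y
  proof (induction m)
    case (Suc m)
    have "H (Suc m) u = (\<lambda>i. H m u i - H m (H m u) i)"
      by (simp add: H_def riesz_nagy_step_def)
    then have "vip n (H (Suc m) u) y = vip n (H m u) y - vip n (H m u) (H m y)"
      by (simp only: vip_diff sym [of m "H m u"])
    then show ?case
      using Suc by simp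
  qed (simp add: H_def)
  have "summable (\<lambda>k. Re (vip n (H k u) (H k u)))"
  proof (rule bounded_imp_summable [where B = "Re (vip n (h u) u)"])
    show "0 \<le> Re (vip n (H k u) (H k u))" for k
      by (simp add: vip_same sum_nonneg)
    show "(\<Sum>k\<le>m. Re (vip n (H k u) (H k u))) \<le> Re (vip n (h u) u)" for m
    proof -
      have "0 \<le> Re (vip n (H (Suc m) u) u)"
        unfolding H_def
        by (rule positive_contraction_nonneg [OF positive_contraction_riesz_nagy_iterate [OF h]])
      moreover have "(\<Sum>k\<le>m. Re (vip n (H k u) (H k u)))
          = Re (vip n (h u) u) - Re (vip n (H (Suc m) u) u)"
        using partial [of u u "Suc m"]
        by (simp only: lessThan_Suc_atMost minus_complex.sel(1) flip: Re_sum)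
      ultimately show ?thesis
        by simp
    qed
  qed
  then have lim0: "(\<lambda>k. Re (vip n (H k u) (H k u))) \<longlonglongrightarrow> 0"
    by (rule summable_LIMSEQ_zero)
  have "(\<lambda>k. H k u i) \<longlonglongrightarrow> 0" if i: "i < n" for i
  proof -
    have "(norm (H k u i))\<^sup>2 \<le> Re (vip n (H k u) (H k u))" for k
      unfolding vip_same using i
      by (intro member_le_sum [of i "{..<n}" "\<lambda>i. (norm (H k u i))\<^sup>2"]) auto
    then have "(\<lambda>k. (norm (H k u i))\<^sup>2) \<longlonglongrightarrow> 0"
      by (intro tendsto_sandwich [OF _ _ tendsto_const lim0]) auto
    then have "(\<lambda>k. sqrt ((norm (H k u i))\<^sup>2)) \<longlonglongrightarrow> sqrt 0"
      by (rule tendsto_real_sqrt)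
    then show ?thesis
      by (simp add: tendsto_norm_zero_iff)
  qed
  then have "(\<lambda>k. vip n (H k u) y) \<longlonglongrightarrow> (\<Sum>i<n. cinner 0 (y i))"
    unfolding vip_def by (intro tendsto_sum cinner.tendsto tendsto_const) auto
  then have "(\<lambda>m. vip n (h u) y - vip n (H m u) y) \<longlonglongrightarrow> vip n (h u) y - 0"
    by (intro tendsto_diff tendsto_const) (simp add: cinner_simps)
  then show ?thesis
    by (simp add: partial)
qed

lemma positive_matrixD:
  "positive_matrix n b \<Longrightarrow> (\<Sum>i<n. \<Sum>j<n. cinner (b i j (v j)) (v i)) \<in> \<real>\<^sub>\<ge>\<^sub>0"
  unfolding positive_matrix_def by blast

lemma positive_matrix_hermitian:
  assumes b: "\<And>i j. i < n \<Longrightarrow> j < n \<Longrightarrow> b i j \<in> bounded_ops" and pos: "positive_matrix n b"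
  shows "(\<Sum>i<n. \<Sum>j<n. cinner (b i j (u j)) (v i)) = cnj (\<Sum>i<n. \<Sum>j<n. cinner (b i j (v j)) (u i))"
proof -
  define Q where "Q u v = (\<Sum>i<n. \<Sum>j<n. cinner (b i j (u j)) (v i))" for u v
  have "Q u v = cnj (Q v u)"
  proof (rule hermitian_of_real_diagonal [of u UNIV v "\<lambda>u v i. u i + v i"
        "\<lambda>c u i. c *\<^sub>C u i" Q])
    show "Q (\<lambda>i. u i + v i) w = Q u w + Q v w" "Q w (\<lambda>i. u i + v i) = Q w u + Q w v" for u v w
      by (simp_all add: Q_def blinfun.add_right cinner_simps sum.distrib)
    show "Q (\<lambda>i. \<i> *\<^sub>C u i) w = \<i> * Q u w" for u w
      unfolding Q_def sum_distrib_left
      by (intro sum.cong refl) (simp add: b bounded_ops_scaleC cinner_simps)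
    show "Q w (\<lambda>i. \<i> *\<^sub>C u i) = - \<i> * Q w u" for u w
      unfolding Q_def sum_distrib_left by (intro sum.cong refl) (simp add: cinner_simps)
    show "Im (Q u u) = 0" for u
      using positive_matrixD [OF pos, of u] by (simp only: Q_def nonneg_Reals_iff_Re)
  qed simp_all
  then show ?thesis
    by (simp only: Q_def)
qed

text \<open>By \<open>riesz_nagy_series\<close>, a multiple of \<open>b\<close> is a sum of squares of Hermitian matrices commuting
  with the entries of \<open>X\<close>.\<close>

lemma commuting_positive_matrices:
  fixes X b :: "nat \<Rightarrow> nat \<Rightarrow> 'a :: complex_hilbert_space op"
  assumes b: "\<And>i j. i < n \<Longrightarrow> j < n \<Longrightarrow> b i j \<in> bounded_ops"
    and comm: "\<And>i j k l x. i < n \<Longrightarrow> j < n \<Longrightarrow> k < n \<Longrightarrow> l < n \<Longrightarrow>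
      b i j (X k l x) = X k l (b i j x)"
    and pos_b: "positive_matrix n b" and pos_X: "positive_matrix n X"
  shows "(\<Sum>i<n. \<Sum>j<n. cinner (X i j (b i j \<zeta>)) \<zeta>) \<in> \<real>\<^sub>\<ge>\<^sub>0"
proof -
  \<comment> \<open>The entry norms sum to a bound for the matrix \<open>b\<close>, so division by
    \<open>K\<close> gives a contraction; the summand 1 keeps \<open>K\<close> positive.\<close>
  define K where "K = 1 + (\<Sum>i<n. \<Sum>j<n. norm (b i j))"
  have K: "K > 0"
    by (simp add: K_def add_pos_nonneg sum_nonneg)
  \<comment> \<open>The cut-off at \<open>n\<close> lets \<open>h\<close> commute with the entries
    of \<open>X\<close> in every component, as commutation with \<open>b i j\<close> is assumed for
    indices below \<open>n\<close> only.\<close>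
  define h where "h v i = (if i < n then (1 / K) *\<^sub>R (\<Sum>j<n. b i j (v j)) else 0)"
    for v :: "nat \<Rightarrow> 'a" and i
  have vip_h: "vip n (h u) v = of_real (1 / K) * (\<Sum>i<n. \<Sum>j<n. cinner (b i j (u j)) (v i))" for u v
    unfolding vip_def sum_distrib_left
    by (intro sum.cong refl)
       (simp add: h_def cinner.scaleR_left cinner.sum_left scaleR_conv_of_real sum_distrib_left)
  have vip_commute: "vip n u v = cnj (vip n v u)" for u v
    by (auto simp: vip_def intro: sum.cong cinner_commute)
  have contr: "positive_contraction n h"
    unfolding positive_contraction_def
  proof (intro conjI allI)
    fix u v
    show "h (\<lambda>i. u i - v i) = (\<lambda>i. h u i - h v i)"
      by (simp add: h_def fun_eq_iff blinfun.diff_right sum_subtractf scaleR_diff_right)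
    have "vip n u (h v) = cnj (vip n (h v) u)"
      by (rule vip_commute)
    also have "\<dots> = vip n (h u) v"
      unfolding vip_h using positive_matrix_hermitian [OF b pos_b, of u v] by simp
    finally show "vip n (h u) v = vip n u (h v)"
      by simp
    show "0 \<le> Re (vip n (h v) v)"
      unfolding vip_h using positive_matrixD [OF pos_b, of v] K
      by (simp add: nonneg_Reals_iff_Re del: Re_sum Im_sum)
    define N where "N = Re (vip n v v)"
    have "0 \<le> N"
      by (simp add: N_def vip_same sum_nonneg)
    have *: "cmod (cinner (b i j (v j)) (v i)) \<le> norm (b i j) * N" if "i < n" "j < n" for i j
    proof -
      have "norm (v k) \<le> sqrt N" if "k < n" for k
        unfolding N_def vip_same
        using that by (intro real_le_rsqrt member_le_sum [of k "{..<n}" "\<lambda>i. (norm (v i))\<^sup>2"]) auto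
      with that have "norm (v j) * norm (v i) \<le> sqrt N * sqrt N"
        by (intro mult_mono) (auto simp: \<open>0 \<le> N\<close>)
      then have N: "norm (v j) * norm (v i) \<le> N"
        using \<open>0 \<le> N\<close> by simp
      have "cmod (cinner (b i j (v j)) (v i)) \<le> norm (b i j (v j)) * norm (v i)"
        by (rule cmod_cinner_le)
      also have "\<dots> \<le> norm (b i j) * norm (v j) * norm (v i)"
        by (intro mult_right_mono norm_blinfun) simp
      also have "\<dots> \<le> norm (b i j) * N"
        using N by (simp add: mult_left_mono mult.assoc)
      finally show ?thesis .
    qed
    have "Re (\<Sum>i<n. \<Sum>j<n. cinner (b i j (v j)) (v i))
        \<le> cmod (\<Sum>i<n. \<Sum>j<n. cinner (b i j (v j)) (v i))"
      by (rule complex_Re_le_cmod)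
    also have "\<dots> \<le> (\<Sum>i<n. \<Sum>j<n. norm (b i j) * N)"
      by (intro sum_norm_le *) auto
    also have "\<dots> \<le> K * N"
      using \<open>0 \<le> N\<close> by (simp add: K_def sum_distrib_right distrib_right)
    finally show "Re (vip n (h v) v) \<le> Re (vip n v v)"
      unfolding vip_h N_def [symmetric] using K by (simp add: field_simps)
  qed
  define H where "H k = (riesz_nagy_step ^^ k) h" for k
  have H_comm: "H q (\<lambda>i. X k l (v i)) = (\<lambda>i. X k l (H q v i))" if "k < n" "l < n" for q k l v
  proof (induction q arbitrary: v)
    case 0
    show ?case
      using that comm
      by (auto simp: H_def h_def fun_eq_iff blinfun.scaleR_right blinfun.sum_right)
  next
    case (Suc q)
    then have "(riesz_nagy_step ^^ q) h (\<lambda>i. X k l (v i)) = (\<lambda>i. X k l ((riesz_nagy_step ^^ q) h v i))" for v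
      by (simp add: H_def)
    then show ?case
      by (simp add: H_def riesz_nagy_step_def blinfun.diff_right)
  qed
  \<comment> \<open>With \<open>\<zeta>\<close> placed in slot \<open>j\<close>, component
    \<open>k\<close> of \<open>h (u j)\<close> is \<open>b k j \<zeta>\<close> divided by
    \<open>K\<close>, so the required sum is read off from \<open>h\<close>.\<close>
  define u where "u j i = (if i = j then \<zeta> else 0)" for i j :: nat
  define S where "S m = (\<Sum>k<n. \<Sum>j<n. \<Sum>q<m. vip n (H q (\<lambda>i. X k j (u j i))) (H q (u k)))" for m
  have "S \<longlonglongrightarrow> (\<Sum>k<n. \<Sum>j<n. vip n (h (\<lambda>i. X k j (u j i))) (u k))"
    unfolding S_def H_def by (intro tendsto_sum riesz_nagy_series contr)
  also have "(\<Sum>k<n. \<Sum>j<n. vip n (h (\<lambda>i. X k j (u j i))) (u k))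
      = of_real (1 / K) * (\<Sum>k<n. \<Sum>j<n. cinner (X k j (b k j \<zeta>)) \<zeta>)"
  proof -
    have "vip n (h (\<lambda>i. X k j (u j i))) (u k) = of_real (1 / K) * cinner (X k j (b k j \<zeta>)) \<zeta>"
      if "k < n" "j < n" for k j
    proof -
      have "vip n (h (\<lambda>i. X k j (u j i))) (u k) = vip n (\<lambda>i. X k j (h (u j) i)) (u k)"
        using H_comm [OF that, of 0] by (simp add: H_def)
      also have "\<dots> = (\<Sum>i<n. if i = k then cinner (X k j (h (u j) i)) \<zeta> else 0)"
        unfolding vip_def by (intro sum.cong refl) (simp add: u_def cinner_simps)
      also have "\<dots> = cinner (X k j (h (u j) k)) \<zeta>"
        using that by simp
      also have "h (u j) k = (1 / K) *\<^sub>R (\<Sum>i<n. b k i (u j i))"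
        using that by (simp add: h_def)
      also have "(\<Sum>i<n. b k i (u j i)) = (\<Sum>i<n. if i = j then b k i \<zeta> else 0)"
        by (intro sum.cong) (auto simp: u_def)
      also have "\<dots> = b k j \<zeta>"
        using that by simp
      finally show ?thesis
        by (simp add: blinfun.scaleR_right cinner.scaleR_left scaleR_conv_of_real)
    qed
    then show ?thesis
      by (simp add: sum_distrib_left)
  qed
  finally have lim: "S \<longlonglongrightarrow> of_real (1 / K) * (\<Sum>k<n. \<Sum>j<n. cinner (X k j (b k j \<zeta>)) \<zeta>)" .
  \<comment> \<open>For fixed \<open>q\<close> and \<open>i\<close> the sum over \<open>k\<close>
    and \<open>j\<close> is the quadratic form of \<open>X\<close> at the family
    \<open>H q (u j) i\<close>, hence nonnegative.\<close>
  have "S m \<in> \<real>\<^sub>\<ge>\<^sub>0" for m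
  proof -
    have "S m = (\<Sum>k<n. \<Sum>j<n. \<Sum>q<m. \<Sum>i<n. cinner (X k j (H q (u j) i)) (H q (u k) i))"
      unfolding S_def vip_def by (intro sum.cong refl) (simp add: H_comm)
    also have "\<dots> = (\<Sum>k<n. \<Sum>q<m. \<Sum>i<n. \<Sum>j<n. cinner (X k j (H q (u j) i)) (H q (u k) i))"
      by (rule sum.cong [OF refl]) (rule sum_rotate)
    also have "\<dots> = (\<Sum>q<m. \<Sum>i<n. \<Sum>k<n. \<Sum>j<n. cinner (X k j (H q (u j) i)) (H q (u k) i))"
      by (rule sum_rotate)
    also have "\<dots> \<in> \<real>\<^sub>\<ge>\<^sub>0"
      by (intro sum_nonneg_Reals positive_matrixD [OF pos_X, of "\<lambda>j. H _ (u j) _"])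
    finally show ?thesis .
  qed
  then have "of_real (1 / K) * (\<Sum>k<n. \<Sum>j<n. cinner (X k j (b k j \<zeta>)) \<zeta>) \<in> \<real>\<^sub>\<ge>\<^sub>0"
    by (intro closed_sequentially [OF closed_nonneg_Reals_complex _ lim]) auto
  then show ?thesis
    by (subst (asm) nonneg_Reals_of_real_mult_iff) (use K in simp_all)
qed

section \<open>Orthogonal series\<close>

lemma norm_sum_orthogonal:
  fixes f :: "'i \<Rightarrow> 'a :: real_inner"
  assumes "finite F" and "\<And>i j. i \<in> F \<Longrightarrow> j \<in> F \<Longrightarrow> i \<noteq> j \<Longrightarrow> inner (f i) (f j) = 0"
  shows "(norm (sum f F))\<^sup>2 = (\<Sum>i\<in>F. (norm (f i))\<^sup>2)"
  using assms
proof (induction F rule: finite_induct)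
  case (insert x F)
  have "inner (f x) (sum f F) = 0"
    unfolding inner_sum_right
  proof (rule sum.neutral, rule ballI)
    show "inner (f x) (f i) = 0" if "i \<in> F" for i
      by (rule insert.prems) (use that insert.hyps in auto)
  qed
  then have "(norm (f x + sum f F))\<^sup>2 = (norm (f x))\<^sup>2 + (norm (sum f F))\<^sup>2"
    by (simp add: power2_norm_eq_inner inner_add_left inner_add_right inner_commute)
  moreover have "(norm (sum f F))\<^sup>2 = (\<Sum>i\<in>F. (norm (f i))\<^sup>2)"
    by (rule insert.IH) (rule insert.prems, auto)
  ultimately show ?case
    using insert.hyps by simp
qed simp

text \<open>Pythagoras turns the Cauchy property of the finite sums of squared norms into that of
  the finite sums of vectors.\<close>

lemma summable_on_orthogonal:
  fixes f :: "'i \<Rightarrow> 'a :: {real_inner, banach}"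
  assumes orth: "\<And>i j. i \<in> A \<Longrightarrow> j \<in> A \<Longrightarrow> i \<noteq> j \<Longrightarrow> inner (f i) (f j) = 0"
    and summable: "(\<lambda>i. (norm (f i))\<^sup>2) summable_on A"
  shows "f summable_on A"
proof -
  define g where "g i = (norm (f i))\<^sup>2" for i
  obtain l where l: "(sum g \<longlongrightarrow> l) (finite_subsets_at_top A)"
    using summable unfolding g_def [symmetric] summable_on_def has_sum_def by blast
  have "\<exists>P. eventually P (finite_subsets_at_top A) \<and>
      (\<forall>F F'. P F \<and> P F' \<longrightarrow> dist (sum f F) (sum f F') < \<epsilon>)" if \<epsilon>: "\<epsilon> > 0" for \<epsilon>
  proof -
    \<comment> \<open>Two sums of squares within \<open>d\<close> of \<open>l\<close> differ by less
      than \<open>2 * d\<close>, the square of \<open>\<epsilon> / 2\<close>. The half appears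
      because \<open>F1\<close> and \<open>F2\<close> are compared through a common
      superset.\<close>
    define d where "d = (\<epsilon> / 2)\<^sup>2 / 2"
    define P where "P F \<longleftrightarrow> finite F \<and> F \<subseteq> A \<and> dist (sum g F) l < d" for F
    have "d > 0"
      using \<epsilon> by (simp add: d_def)
    then have ev_P: "eventually P (finite_subsets_at_top A)"
      using l unfolding P_def [abs_def]
      by (auto simp: eventually_conj_iff eventually_finite_subsets_at_top_weakI tendsto_iff)
    then obtain F0 where F0: "finite F0" "F0 \<subseteq> A" "\<forall>F. finite F \<and> F0 \<subseteq> F \<and> F \<subseteq> A \<longrightarrow> P F"
      by (auto simp: eventually_finite_subsets_at_top)
    have "dist (sum f F1) (sum f F2) < \<epsilon>" if "P F1" "P F2" for F1 F2
    proof -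
      define F where "F = F0 \<union> F1 \<union> F2"
      have F: "finite F" "F \<subseteq> A"
        using that F0(1,2) by (auto simp: F_def P_def)
      have "F0 \<subseteq> F"
        by (auto simp: F_def)
      then have PF: "P F"
        using F F0(3) by blast
      have near: "dist (sum f F) (sum f F') < \<epsilon> / 2" if "F' \<subseteq> F" "P F'" for F'
      proof -
        have "(dist (sum f F) (sum f F'))\<^sup>2 = (norm (sum f (F - F')))\<^sup>2"
          using F(1) that(1) by (simp add: dist_norm sum_diff)
        also have "\<dots> = sum g (F - F')"
          unfolding g_def using F by (intro norm_sum_orthogonal orth) auto
        also have "\<dots> = sum g F - sum g F'"
          using F(1) that(1) by (simp add: sum_diff)
        also have "\<dots> < 2 * d"
          using PF that(2) unfolding P_def dist_norm real_norm_def by linarith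
        finally have "(dist (sum f F) (sum f F'))\<^sup>2 < (\<epsilon> / 2)\<^sup>2"
          by (simp add: d_def)
        then show ?thesis
          by (rule power2_less_imp_less) (use \<epsilon> in simp)
      qed
      have "dist (sum f F1) (sum f F2) \<le> dist (sum f F) (sum f F1) + dist (sum f F) (sum f F2)"
        by (rule dist_triangle3)
      also have "\<dots> < \<epsilon> / 2 + \<epsilon> / 2"
        using that by (intro add_strict_mono near) (auto simp: F_def)
      finally show ?thesis
        by simp
    qed
    then show ?thesis
      using ev_P by blast
  qed
  then have "cauchy_filter (filtermap (sum f) (finite_subsets_at_top A))"
    by (simp add: cauchy_filter_metric_filtermap)
  moreover have "complete (UNIV :: 'a set)"
    by (meson Cauchy_convergent UNIV_I complete_def convergent_def)
  ultimately obtain x where "(sum f \<longlongrightarrow> x) (finite_subsets_at_top A)"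
    using complete_uniform [where S = UNIV] by (force simp: filterlim_def)
  then show ?thesis
    unfolding summable_on_def has_sum_def by blast
qed

section \<open>Gram determinants\<close>

lemma gram_det_Cons:
  "gram_det (x # xs) ys = (\<Sum>\<sigma> | \<sigma> permutes {..<Suc (length xs)}.
     of_int (sign \<sigma>) * (cinner x (ys ! \<sigma> 0) * (\<Prod>i<length xs. cinner (xs ! i) (ys ! \<sigma> (Suc i)))))"
  unfolding gram_det_def by (simp add: prod.lessThan_Suc_shift del: prod.lessThan_Suc)

lemma gram_det_add: "gram_det ((x + y) # xs) zs = gram_det (x # xs) zs + gram_det (y # xs) zs"
  by (simp add: gram_det_Cons cinner_simps sum.distrib algebra_simps)

lemma gram_det_scaleC: "gram_det ((c *\<^sub>C x) # xs) zs = c * gram_det (x # xs) zs"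
  by (simp add: gram_det_Cons cinner_simps sum_distrib_left mult_ac)

text \<open>Composing every permutation with the transposition of the first two positions permutes
  the summands and flips their signs.\<close>

lemma gram_det_swap: "gram_det (x # y # xs) zs = - gram_det (y # x # xs) zs"
proof -
  let ?n = "Suc (Suc (length xs))"
  let ?\<tau> = "Transposition.transpose 0 (1 :: nat)"
  have \<tau>: "?\<tau> permutes {..<?n}"
    by (rule permutes_swap_id) auto
  have "gram_det (y # x # xs) zs = (\<Sum>\<sigma> | \<sigma> permutes {..<?n}. of_int (sign (\<sigma> \<circ> ?\<tau>)) *
      (\<Prod>i<?n. cinner ((y # x # xs) ! i) (zs ! (\<sigma> \<circ> ?\<tau>) i)))"
    unfolding gram_det_def length_Cons by (rule sum_permutations_compose_right [OF \<tau>])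
  also have "\<dots> = (\<Sum>\<sigma> | \<sigma> permutes {..<?n}. - (of_int (sign \<sigma>) *
      (\<Prod>i<?n. cinner ((x # y # xs) ! i) (zs ! \<sigma> i))))"
  proof (rule sum.cong [OF refl])
    fix \<sigma> assume "\<sigma> \<in> {\<sigma>. \<sigma> permutes {..<?n}}"
    then have "permutation \<sigma>"
      by (auto intro: permutes_imp_permutation [of "{..<?n}"])
    moreover have "permutation ?\<tau>"
      by (rule permutation_swap_id)
    ultimately have sign: "sign (\<sigma> \<circ> ?\<tau>) = - sign \<sigma>"
      by (simp add: sign_compose sign_swap_id)
    have "(\<Prod>i<?n. cinner ((y # x # xs) ! i) (zs ! (\<sigma> \<circ> ?\<tau>) i))
        = (\<Prod>i<?n. cinner ((x # y # xs) ! i) (zs ! \<sigma> i))"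
      by (simp add: prod.lessThan_Suc_shift transpose_def mult_ac del: prod.lessThan_Suc)
    then show "of_int (sign (\<sigma> \<circ> ?\<tau>)) * (\<Prod>i<?n. cinner ((y # x # xs) ! i) (zs ! (\<sigma> \<circ> ?\<tau>) i))
        = - (of_int (sign \<sigma>) * (\<Prod>i<?n. cinner ((x # y # xs) ! i) (zs ! \<sigma> i)))"
      by (simp only: sign of_int_minus mult_minus_left)
  qed
  also have "\<dots> = - gram_det (x # y # xs) zs"
    by (simp add: gram_det_def sum_negf)
  finally show ?thesis
    by simp
qed

text \<open>Cauchy-Schwarz in each of the \<open>fact (length xs)\<close> summands. The constant is
  crude; only continuity of exterior products in one factor is drawn from it.\<close>

lemma cmod_gram_det_le:
  assumes "length xs = length ys"
  shows "cmod (gram_det xs ys)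
    \<le> fact (length xs) * ((\<Prod>i<length xs. norm (xs ! i)) * (\<Prod>i<length xs. norm (ys ! i)))"
proof -
  let ?n = "length xs"
  have "cmod (of_int (sign \<sigma>) * (\<Prod>i<?n. cinner (xs ! i) (ys ! \<sigma> i)))
      \<le> (\<Prod>i<?n. norm (xs ! i)) * (\<Prod>i<?n. norm (ys ! i))" if \<sigma>: "\<sigma> permutes {..<?n}" for \<sigma>
  proof -
    have "cmod (of_int (sign \<sigma>)) = 1"
      by (simp add: sign_def)
    then have "cmod (of_int (sign \<sigma>) * (\<Prod>i<?n. cinner (xs ! i) (ys ! \<sigma> i)))
        = (\<Prod>i<?n. cmod (cinner (xs ! i) (ys ! \<sigma> i)))"
      by (simp add: norm_mult prod_norm)
    also have "\<dots> \<le> (\<Prod>i<?n. norm (xs ! i) * norm (ys ! \<sigma> i))"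
      by (intro prod_mono) (simp add: cmod_cinner_le)
    also have "\<dots> = (\<Prod>i<?n. norm (xs ! i)) * (\<Prod>i<?n. norm (ys ! i))"
      using prod.permute [OF \<sigma>, of "\<lambda>i. norm (ys ! i)"] by (simp add: prod.distrib o_def)
    finally show ?thesis .
  qed
  then have "cmod (gram_det xs ys) \<le> of_nat (card {\<sigma>. \<sigma> permutes {..<?n}}) *
      ((\<Prod>i<?n. norm (xs ! i)) * (\<Prod>i<?n. norm (ys ! i)))"
    unfolding gram_det_def by (intro sum_norm_bound) auto
  then show ?thesis
    by (simp add: card_permutations [of "{..<?n}" ?n])
qed

section \<open>The anti-commutation relations\<close>

locale fock_space =
  fixes w :: "'h :: complex_hilbert_space list \<Rightarrow> 'f :: complex_hilbert_space"
    and cr :: "'h \<Rightarrow> 'f op"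
  assumes fock: "antisymmetric_fock_space w" and creation: "creation_operators w cr"
begin

lemma cinner_w: "cinner (w xs) (w ys) = (if length xs = length ys then gram_det xs ys else 0)"
  by (rule fock [unfolded antisymmetric_fock_space_def, THEN conjunct1, THEN spec, THEN spec])

lemma total_w: "total_set (range w)"
  by (rule fock [unfolded antisymmetric_fock_space_def, THEN conjunct2])

lemma cr_bounded [simp]: "cr x \<in> bounded_ops"
  and cr_w: "cr x (w xs) = w (x # xs)"
  using creation by (simp_all add: creation_operators_def)

text \<open>Testing against the total set of exterior products reduces multilinearity and
  antisymmetry of \<open>w\<close> to those of Gram determinants.\<close>

lemma w_eqI:
  assumes "\<And>zs. cinner u (w zs) = cinner v (w zs)"
  shows "u = v"
proof -
  have "u - v = 0"
  proof (rule eq_zero_of_orthogonal_total [OF total_w])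
    fix x assume "x \<in> range w"
    then obtain zs where "x = w zs"
      by blast
    then have "cinner (u - v) x = 0"
      using assms by (simp add: cinner_simps)
    then show "cinner x (u - v) = 0"
      by (subst cinner_commute) simp
  qed
  then show ?thesis
    by simp
qed

lemma w_add: "w ((x + y) # xs) = w (x # xs) + w (y # xs)"
  by (rule w_eqI) (simp add: cinner_simps cinner_w gram_det_add)

lemma w_scaleC: "w ((c *\<^sub>C x) # xs) = c *\<^sub>C w (x # xs)"
  by (rule w_eqI) (simp add: cinner_simps cinner_w gram_det_scaleC)

lemma w_swap: "w (x # y # xs) = - w (y # x # xs)"
  by (rule w_eqI) (simp add: cinner_simps cinner_w gram_det_swap [of x y])

text \<open>This continuity lets \<open>total_fvec\<close> pass from basis vectors in the first
  factor to arbitrary one-particle vectors.\<close>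

lemma bounded_linear_w: "bounded_linear (\<lambda>x. w (x # xs))"
proof (rule bounded_linear_intro)
  fix x y :: 'h and r :: real
  show "w ((x + y) # xs) = w (x # xs) + w (y # xs)"
    by (rule w_add)
  show "w ((r *\<^sub>R x) # xs) = r *\<^sub>R w (x # xs)"
    using w_scaleC [of "of_real r" x xs] by (simp add: scaleC_of_real)
  let ?n = "Suc (length xs)" and ?p = "\<Prod>i<length xs. norm (xs ! i)"
  have "complex_of_real ((norm (w (x # xs)))\<^sup>2) = gram_det (x # xs) (x # xs)"
    using cinner_w [of "x # xs" "x # xs"] by (simp only: cinner_same refl if_True)
  from arg_cong [OF this, of cmod] have "(norm (w (x # xs)))\<^sup>2 = cmod (gram_det (x # xs) (x # xs))"
    by (simp only: norm_of_real abs_power2)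
  also have "\<dots> \<le> fact ?n * ((norm x * ?p) * (norm x * ?p))"
    using cmod_gram_det_le [of "x # xs" "x # xs"]
    by (simp only: prod.lessThan_Suc_shift length_Cons nth_Cons_0 nth_Cons_Suc)
  also have "\<dots> = (sqrt (fact ?n) * (norm x * ?p))\<^sup>2"
    by (simp only: power_mult_distrib real_sqrt_pow2 fact_ge_zero) (simp only: power2_eq_square mult_ac)
  finally have "norm (w (x # xs)) \<le> sqrt (fact ?n) * (norm x * ?p)"
    by (rule power2_le_imp_le) (simp add: prod_nonneg)
  then show "norm (w (x # xs)) \<le> norm x * (sqrt (fact ?n) * ?p)"
    by (simp only: mult.left_commute)
qed

lemma cr_anticommute: "cr x (cr y v) = - cr y (cr x v)"
proof -
  have "(cr x o\<^sub>L cr y) = scaleC_op (- 1) (cr y o\<^sub>L cr x)"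
    by (rule op_eqI_total [OF _ _ total_w])
       (auto simp: bounded_ops_compose bounded_ops_scaleC_op cr_w scaleC_minus_left w_swap [of x y])
  then have "(cr x o\<^sub>L cr y) v = scaleC_op (- 1) (cr y o\<^sub>L cr x) v"
    by simp
  then show ?thesis
    by (simp add: scaleC_minus_left)
qed

end

section \<open>The Fock basis of the lattice and its ladder operators\<close>

lemma eq_zero_of_eq_minus: "x = - x \<Longrightarrow> x = 0"
  for x :: "'a :: real_vector"
  by (metis eq_neg_iff_add_eq_0 scaleR_2 scaleR_eq_0_iff zero_neq_numeral)

locale fock_lattice = fock_space w cr
  for w :: "'h :: complex_hilbert_space list \<Rightarrow> 'f :: complex_hilbert_space"
    and cr :: "'h \<Rightarrow> 'f op" +
  fixes L :: "'l set" and e :: "'l \<Rightarrow> 'h"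
  assumes basis: "orthonormal_basis L e"
begin

definition cre :: "'l \<Rightarrow> 'f op" where "cre l = cr (e l)"
definition ann :: "'l \<Rightarrow> 'f op" where "ann l = adj (cr (e l))"
text \<open>Defined on all lists rather than on chosen orderings: it vanishes when an entry repeats
  and changes at most by a sign under reordering, so any convenient order may be used.\<close>

definition fvec :: "'l list \<Rightarrow> 'f" where "fvec s = w (map e s)"

lemma cre_bounded [simp]: "cre l \<in> bounded_ops"
  and ann_bounded [simp]: "ann l \<in> bounded_ops"
  by (simp_all add: cre_def ann_def)

lemma adj_cre [simp]: "adj (cre l) = ann l"
  and adj_ann [simp]: "adj (ann l) = cre l"
  by (simp_all add: cre_def ann_def)

lemma cinner_cre_left: "cinner (cre l x) y = cinner x (ann l y)"
  and cinner_ann_left: "cinner (ann l x) y = cinner x (cre l y)"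
  by (simp_all add: cre_def ann_def cinner_adj_right cinner_adj_left)

lemma cre_fvec: "cre l (fvec s) = fvec (l # s)"
  by (simp add: cre_def fvec_def cr_w)

lemma cre_anticommute: "cre k (cre l v) = - cre l (cre k v)"
  unfolding cre_def by (rule cr_anticommute)

lemma ann_anticommute: "ann k (ann l v) = - ann l (ann k v)"
proof (rule cinner_ext_left)
  show "cinner (ann k (ann l v)) z = cinner (- ann l (ann k v)) z" for z
    by (simp add: cinner_ann_left cinner_simps cre_anticommute [of l k])
qed

lemma fvec_swap: "fvec (k # l # s) = - fvec (l # k # s)"
  using cre_anticommute [of k l "fvec s"] by (simp add: cre_fvec)

lemma e_orthonormal: "k \<in> L \<Longrightarrow> l \<in> L \<Longrightarrow> cinner (e k) (e l) = (if k = l then 1 else 0)"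
  using basis unfolding orthonormal_basis_def by blast

lemma total_e: "total_set (e ` L)"
  using basis unfolding orthonormal_basis_def by blast

text \<open>Each summand of the Gram determinant contains a factor pairing \<open>e l\<close> with a
  different basis vector.\<close>

lemma fvec_orthogonal:
  assumes s: "s \<in> lists L" and t: "t \<in> lists L" and l: "l \<in> set s" "l \<notin> set t"
  shows "cinner (fvec s) (fvec t) = 0"
proof (cases "length s = length t")
  case True
  obtain i where i: "i < length s" "s ! i = l"
    using l(1) by (metis in_set_conv_nth)
  have zero: "(\<Prod>j<length s. cinner (map e s ! j) (map e t ! \<sigma> j)) = 0"
    if "\<sigma> permutes {..<length s}" for \<sigma>
  proof (rule prod_zero)
    have "\<sigma> i < length t"
      using permutes_in_image [OF that, of i] i True by simp
    then have "t ! \<sigma> i \<in> set t"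
      by simp
    then have "t ! \<sigma> i \<noteq> l" "t ! \<sigma> i \<in> L" "l \<in> L"
      using l s t by auto
    then have "cinner (map e s ! i) (map e t ! \<sigma> i) = 0"
      using i \<open>\<sigma> i < length t\<close> by (simp add: e_orthonormal)
    then show "\<exists>j\<in>{..<length s}. cinner (map e s ! j) (map e t ! \<sigma> j) = 0"
      using i by blast
  qed simp
  have "gram_det (map e s) (map e t) = 0"
    unfolding gram_det_def length_map by (rule sum.neutral) (use zero in auto)
  then show ?thesis
    by (simp add: fvec_def cinner_w)
qed (simp add: fvec_def cinner_w)

text \<open>Only the identity permutation contributes to the Gram determinant.\<close>

lemma fvec_normalized:
  assumes s: "s \<in> lists L" "distinct s"
  shows "cinner (fvec s) (fvec s) = 1"
proof -
  let ?n = "length s"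
  have in_L: "s ! i \<in> L" if "i < ?n" for i
    using s that by (auto simp: lists_eq_set)
  have summand: "of_int (sign \<sigma>) * (\<Prod>j<?n. cinner (map e s ! j) (map e s ! \<sigma> j))
      = (if \<sigma> = id then 1 else 0)" if \<sigma>: "\<sigma> permutes {..<?n}" for \<sigma>
  proof (cases "\<sigma> = id")
    case True
    have "(\<Prod>j<?n. cinner (map e s ! j) (map e s ! j)) = 1"
      by (rule prod.neutral) (simp add: e_orthonormal in_L)
    then show ?thesis
      by (simp add: True)
  next
    case False
    then obtain i where "\<sigma> i \<noteq> i"
      by (auto simp: fun_eq_iff)
    then have i: "i < ?n"
      using permutes_not_in [OF \<sigma>, of i] by auto
    then have \<sigma>i: "\<sigma> i < ?n"
      using permutes_in_image [OF \<sigma>, of i] by simp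
    have "s ! i \<noteq> s ! \<sigma> i"
      using i \<sigma>i \<open>\<sigma> i \<noteq> i\<close> s(2) by (metis nth_eq_iff_index_eq)
    then have "cinner (map e s ! i) (map e s ! \<sigma> i) = 0"
      using i \<sigma>i in_L by (simp add: e_orthonormal)
    then have "(\<Prod>j<?n. cinner (map e s ! j) (map e s ! \<sigma> j)) = 0"
      using i by (intro prod_zero) auto
    then show ?thesis
      using False by simp
  qed
  have "gram_det (map e s) (map e s) = (\<Sum>\<sigma> | \<sigma> permutes {..<?n}. if \<sigma> = id then 1 else 0)"
    unfolding gram_det_def length_map by (rule sum.cong [OF refl]) (simp only: summand mem_Collect_eq)
  also have "\<dots> = 1"
    by (simp add: sum.delta finite_permutations permutes_id)
  finally show ?thesis
    by (simp add: fvec_def cinner_w)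
qed

text \<open>The sign is left open, since the facts derived from it hold for a vector exactly when
  they hold for its negative.\<close>

lemma fvec_move_to_front:
  assumes "l \<in> set s"
  shows "fvec s = fvec (l # remove1 l s) \<or> fvec s = - fvec (l # remove1 l s)"
  using assms
proof (induction s)
  case (Cons k s)
  show ?case
  proof (cases "k = l")
    case False
    then have IH: "fvec s = fvec (l # remove1 l s) \<or> fvec s = - fvec (l # remove1 l s)"
      using Cons by simp
    have "fvec (k # s) = cre k (fvec s)"
      by (simp add: cre_fvec)
    moreover have "cre k (fvec (l # remove1 l s)) = - fvec (l # k # remove1 l s)"
      by (simp add: cre_fvec fvec_swap [of k])
    moreover have "remove1 l (k # s) = k # remove1 l s"
      using False by simp
    ultimately show ?thesis
      using IH by (auto simp: blinfun.minus_right)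
  qed simp
qed simp

lemma fvec_perm:
  assumes "mset s = mset t"
  shows "fvec s = fvec t \<or> fvec s = - fvec t"
  using assms
proof (induction s arbitrary: t)
  case (Cons l s)
  then have l: "l \<in> set t"
    by (metis list.set_intros(1) set_mset_mset)
  have "mset s = mset (remove1 l t)"
    using Cons.prems by (metis add_mset_remove_trivial mset.simps(2) mset_remove1)
  then have "fvec s = fvec (remove1 l t) \<or> fvec s = - fvec (remove1 l t)"
    by (rule Cons.IH)
  then have "fvec (l # s) = fvec (l # remove1 l t) \<or> fvec (l # s) = - fvec (l # remove1 l t)"
    unfolding cre_fvec [symmetric] by (auto simp: blinfun.minus_right)
  then show ?case
    using fvec_move_to_front [OF l] by auto
qed simp

lemma fvec_perm_distinct:
  "distinct s \<Longrightarrow> distinct t \<Longrightarrow> set s = set t \<Longrightarrow> fvec s = fvec t \<or> fvec s = - fvec t"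
  by (intro fvec_perm) (simp add: set_eq_iff_mset_eq_distinct)

lemma fvec_Cons_mem: "l \<in> set s \<Longrightarrow> fvec (l # s) = 0"
proof -
  assume l: "l \<in> set s"
  have "cre l (cre l (fvec t)) = - cre l (cre l (fvec t))" for t
    by (rule cre_anticommute)
  then have "cre l (cre l (fvec t)) = 0" for t
    by (rule eq_zero_of_eq_minus)
  then have "fvec (l # l # remove1 l s) = 0"
    by (simp add: cre_fvec)
  moreover have "cre l (fvec s) = cre l (fvec (l # remove1 l s)) \<or> cre l (fvec s) = cre l (- fvec (l # remove1 l s))"
    using fvec_move_to_front [OF l] by auto
  ultimately show ?thesis
    by (auto simp: cre_fvec blinfun.minus_right)
qed

lemma fvec_not_distinct: "\<not> distinct s \<Longrightarrow> fvec s = 0"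
proof (induction s)
  case (Cons l s)
  show ?case
  proof (cases "l \<in> set s")
    case False
    then have "fvec s = 0"
      using Cons by simp
    then show ?thesis
      by (metis cre_fvec blinfun.zero_right)
  qed (rule fvec_Cons_mem)
qed simp

lemma total_fvec: "total_set (fvec ` {s \<in> lists L. distinct s})"
  unfolding total_set_iff
proof (intro allI impI)
  fix W :: "'f set"
  assume W: "csubspace W" "closed W" and sub: "fvec ` {s \<in> lists L. distinct s} \<subseteq> W"
  have fvec_W: "fvec s \<in> W" if "s \<in> lists L" for s
    using that sub csubspace_zero [OF W(1)] by (cases "distinct s") (auto simp: fvec_not_distinct)
  have c_W: "cre l v \<in> W'" if l: "l \<in> L" and v: "v \<in> W'"
    and W': "W' = \<Inter> {W. csubspace W \<and> closed W \<and> fvec ` lists L \<subseteq> W}" for W' v l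
  proof -
    have "cre l v \<in> U" if U: "csubspace U" "closed U" "fvec ` lists L \<subseteq> U" for U
    proof -
      have "csubspace (cre l -` U)"
        using U(1)
        by (auto intro!: csubspaceI simp: blinfun.add_right bounded_ops_scaleC csubspace_zero
            csubspace_add csubspace_scaleC)
      moreover have "closed (cre l -` U)"
        using U(2) by (rule closed_vimage) (intro continuous_intros)
      moreover have "fvec ` lists L \<subseteq> cre l -` U"
        using U(3) l by (auto simp: cre_fvec image_subset_iff)
      ultimately show ?thesis
        using v unfolding W' by blast
    qed
    then show ?thesis
      unfolding W' by blast
  qed
  \<comment> \<open>The given \<open>W\<close> need not be invariant under creation operators, but
    the smallest closed subspace containing all \<open>fvec s\<close> is; the induction over
    exterior products therefore runs in \<open>V\<close>.\<close>
  define V where "V = \<Inter> {W. csubspace W \<and> closed W \<and> fvec ` lists L \<subseteq> W}"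
  have V: "csubspace V" "closed V"
    by (auto simp: V_def intro!: csubspaceI intro: csubspace_zero csubspace_add csubspace_scaleC)
  have "w xs \<in> V" for xs
  proof (induction xs)
    case Nil
    have "fvec [] \<in> V"
      unfolding V_def by blast
    then show ?case
      by (simp add: fvec_def)
  next
    case (Cons x xs)
    \<comment> \<open>For a basis vector the new factor is a creation operator, which preserves
      \<open>V\<close>; the other \<open>x\<close> follow by linearity, continuity and
      totality.\<close>
    have "x \<in> (\<lambda>x. w (x # xs)) -` V"
    proof (rule total_set_induct [OF total_e])
      show "csubspace ((\<lambda>x. w (x # xs)) -` V)"
      proof (rule csubspaceI)
        show "0 \<in> (\<lambda>x. w (x # xs)) -` V"
          using csubspace_zero [OF V(1)] linear_0 [OF bounded_linear.linear [OF bounded_linear_w]]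
          by simp
      qed (auto simp: w_add w_scaleC intro: csubspace_add csubspace_scaleC V)
      show "closed ((\<lambda>x. w (x # xs)) -` V)"
        using V(2) by (rule closed_vimage) (intro linear_continuous_on bounded_linear_w)
      show "e ` L \<subseteq> (\<lambda>x. w (x # xs)) -` V"
        using c_W [OF _ Cons V_def] by (auto simp: cre_def cr_w)
    qed
    then show ?case
      by simp
  qed
  moreover have "V \<subseteq> W"
    unfolding V_def using W fvec_W by blast
  ultimately have "range w \<subseteq> W"
    by blast
  then show "W = UNIV"
    using total_set_induct [OF total_w W] by blast
qed

lemma ann_fvec_notin:
  assumes "s \<in> lists L" "l \<in> L" "l \<notin> set s"
  shows "ann l (fvec s) = 0"
proof (rule eq_zero_of_orthogonal_total [OF total_fvec])
  fix x assume "x \<in> fvec ` {s \<in> lists L. distinct s}"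
  then obtain t where t: "x = fvec t" "t \<in> lists L"
    by blast
  then show "cinner x (ann l (fvec s)) = 0"
    using assms by (simp add: cinner_cre_left [symmetric] cre_fvec fvec_orthogonal [of _ s l])
qed

text \<open>Tested against \<open>fvec t\<close>, the claim says that prepending \<open>l\<close>
  preserves the inner product with \<open>fvec s\<close>. If \<open>t\<close> and \<open>s\<close>
  have the same entries, the two vectors agree up to a sign shared by both sides; otherwise some
  index makes both sides vanish.\<close>

lemma ann_fvec_Cons:
  assumes s: "l # s \<in> lists L" and d: "distinct (l # s)"
  shows "ann l (fvec (l # s)) = fvec s"
proof -
  have "ann l (fvec (l # s)) - fvec s = 0"
  proof (rule eq_zero_of_orthogonal_total [OF total_fvec])
    fix x assume "x \<in> fvec ` {s \<in> lists L. distinct s}"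
    then obtain t where t: "x = fvec t" "t \<in> lists L" "distinct t"
      by blast
    have "cinner (fvec (l # t)) (fvec (l # s)) = cinner (fvec t) (fvec s)"
    proof (cases "set t = set s")
      case True
      then have "fvec t = fvec s \<or> fvec t = - fvec s"
        using t d by (intro fvec_perm_distinct) auto
      then have "fvec t = fvec s \<and> fvec (l # t) = fvec (l # s)
          \<or> fvec t = - fvec s \<and> fvec (l # t) = - fvec (l # s)"
        unfolding cre_fvec [symmetric] by (auto simp: blinfun.minus_right)
      moreover have "cinner (fvec s) (fvec s) = 1" "cinner (fvec (l # s)) (fvec (l # s)) = 1"
        using s d by (auto intro!: fvec_normalized)
      ultimately show ?thesis
        by (auto simp: cinner_simps)
    next
      case False
      show ?thesis
      proof (cases "l \<in> set t")
        case True
        then have "fvec (l # t) = 0"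
          by (rule fvec_Cons_mem)
        moreover have "cinner (fvec t) (fvec s) = 0"
          using t s d True by (intro fvec_orthogonal [of t s l]) auto
        ultimately show ?thesis
          by (simp add: cinner_simps)
      next
        case l: False
        consider k where "k \<in> set t" "k \<notin> set s" | k where "k \<in> set s" "k \<notin> set t"
          using False by blast
        then show ?thesis
        proof cases
          case 1
          then show ?thesis
            using t s l fvec_orthogonal [of t s k] fvec_orthogonal [of "l # t" "l # s" k] by auto
        next
          case 2
          then have "cinner (fvec s) (fvec t) = 0" "cinner (fvec (l # s)) (fvec (l # t)) = 0"
            using t s d fvec_orthogonal [of s t k] fvec_orthogonal [of "l # s" "l # t" k] by auto
          then show ?thesis
            by (metis cinner_commute complex_cnj_zero)
        qed
      qed
    qed
    then show "cinner x (ann l (fvec (l # s)) - fvec s) = 0"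
      by (simp add: t cinner_simps cinner_cre_left [symmetric] cre_fvec)
  qed
  then show ?thesis
    by simp
qed

lemma op_eqI_fvec:
  assumes "S \<in> bounded_ops" "T \<in> bounded_ops"
    and "\<And>s. s \<in> lists L \<Longrightarrow> distinct s \<Longrightarrow> S (fvec s) = T (fvec s)"
  shows "S = T"
  by (rule op_eqI_total [OF assms(1,2) total_fvec]) (use assms(3) in auto)

text \<open>Checked on basis vectors. If site \<open>k\<close> is occupied, it is brought to the
  front, where \<open>ann_fvec_Cons\<close> removes it.\<close>

lemma canonical_anticommutation:
  assumes k: "k \<in> L" and l: "l \<in> L"
  shows "ann k (cre l v) + cre l (ann k v) = (if k = l then v else 0)"
proof -
  have "(ann k o\<^sub>L cre l) + (cre l o\<^sub>L ann k) = (if k = l then id_blinfun else 0)"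
  proof (rule op_eqI_fvec)
    fix s assume s: "s \<in> lists L" "distinct s"
    have "ann k (fvec (l # s)) + cre l (ann k (fvec s)) = (if k = l then fvec s else 0)"
    proof (cases "k \<in> set s")
      case False
      then have "ann k (fvec s) = 0"
        using s k by (simp add: ann_fvec_notin)
      moreover have "ann k (fvec (l # s)) = (if k = l then fvec s else 0)"
        using s k l False ann_fvec_Cons [of l s] ann_fvec_notin [of "l # s" k] by auto
      ultimately show ?thesis
        by simp
    next
      case True
      define t where "t = remove1 k s"
      have t: "k # t \<in> lists L" "distinct (k # t)" "t \<in> lists L"
        using s k True by (auto simp: t_def dest: notin_set_remove1)
      have "ann k (fvec (k # t)) = fvec t"
        using t by (intro ann_fvec_Cons) auto
      moreover have "ann k (fvec (l # k # t)) = (if k = l then 0 else - fvec (l # t))"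
      proof (cases "k = l \<or> l \<in> set t")
        case True
        then have "fvec (l # k # t) = 0" "k = l \<or> fvec (l # t) = 0"
          by (auto intro: fvec_Cons_mem)
        then show ?thesis
          by auto
      next
        case False
        then have "ann k (fvec (k # l # t)) = fvec (l # t)"
          using t l by (intro ann_fvec_Cons) auto
        then show ?thesis
          using False by (simp add: fvec_swap [of l k] blinfun.minus_right)
      qed
      ultimately have *: "ann k (fvec (l # k # t)) + cre l (ann k (fvec (k # t)))
          = (if k = l then fvec (k # t) else 0)"
        by (simp add: cre_fvec)
      \<comment> \<open>Moving \<open>k\<close> to the front costs the same sign in both terms, so
        the identity for \<open>k # t\<close> carries over to \<open>s\<close>.\<close>
      have "fvec s = fvec (k # t) \<and> fvec (l # s) = fvec (l # k # t)
          \<or> fvec s = - fvec (k # t) \<and> fvec (l # s) = - fvec (l # k # t)"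
        using fvec_move_to_front [OF True] unfolding cre_fvec [of l, symmetric] t_def
        by (auto simp: blinfun.minus_right)
      then show ?thesis
      proof
        assume eq: "fvec s = - fvec (k # t) \<and> fvec (l # s) = - fvec (l # k # t)"
        then have "ann k (fvec (l # s)) + cre l (ann k (fvec s))
            = - (ann k (fvec (l # k # t)) + cre l (ann k (fvec (k # t))))"
          by (simp add: blinfun.minus_right)
        then show ?thesis
          unfolding * using eq by auto
      qed (use * in auto)
    qed
    then show "((ann k o\<^sub>L cre l) + (cre l o\<^sub>L ann k)) (fvec s) = (if k = l then id_blinfun else 0) (fvec s)"
      by (simp add: blinfun.add_left cre_fvec)
  qed (simp_all add: bounded_ops_add bounded_ops_compose)
  then have "((ann k o\<^sub>L cre l) + (cre l o\<^sub>L ann k)) v = (if k = l then id_blinfun else 0) v"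
    by simp
  then show ?thesis
    by (auto simp: blinfun.add_left split: if_splits)
qed

end

section \<open>Twisted duality\<close>

text \<open>All matrix elements of \<open>b X\<close> and of \<open>X b\<close> between vectors \<open>C D \<Omega>\<close> factorise over \<open>\<Omega>\<close>.\<close>

lemma commuting_of_product_vacuum:
  fixes \<Omega> :: "'a :: complex_hilbert_space" and \<C> \<D> :: "'a op set"
  assumes C: "\<C> \<subseteq> bounded_ops" "adj ` \<C> \<subseteq> \<C>"
    and D: "\<D> \<subseteq> bounded_ops" "adj ` \<D> \<subseteq> \<D>"
    and CD: "\<And>(C :: 'a op) (D :: 'a op) x. C \<in> \<C> \<Longrightarrow> D \<in> \<D> \<Longrightarrow> C (D x) = D (C x)"
    and X: "X \<in> commutant \<C>" and b: "b \<in> commutant \<D>"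
    and total: "total_set {x. \<exists>C\<in>\<C>. \<exists>D\<in>\<D>. x = C (D \<Omega>)}"
    and factor: "\<And>(C :: 'a op) (C' :: 'a op) (D :: 'a op) (D' :: 'a op) (X :: 'a op) (b :: 'a op). C \<in> \<C> \<Longrightarrow> C' \<in> \<C> \<Longrightarrow> D \<in> \<D> \<Longrightarrow> D' \<in> \<D> \<Longrightarrow>
      X \<in> commutant \<C> \<Longrightarrow> b \<in> commutant \<D> \<Longrightarrow>
      cinner (D' (X (D \<Omega>))) (C' (b (C \<Omega>))) = cinner (D' (X (D \<Omega>))) \<Omega> * cinner \<Omega> (C' (b (C \<Omega>)))"
  shows "b o\<^sub>L X = X o\<^sub>L b"
proof -
  note bounded = commutant_bounded_ops [OF X] commutant_bounded_ops [OF b]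
  have aX: "adj X \<in> commutant \<C>" and ab: "adj b \<in> commutant \<D>"
    by (rule adj_commutant [OF C X], rule adj_commutant [OF D b])
  have aC: "adj T \<in> \<C>" if "T \<in> \<C>" for T
    using C(2) that by blast
  have aD: "adj T \<in> \<D>" if "T \<in> \<D>" for T
    using D(2) that by blast
  show ?thesis
  proof (rule op_eqI_total [OF _ _ total])
    fix y assume "y \<in> {x. \<exists>C\<in>\<C>. \<exists>D\<in>\<D>. x = C (D \<Omega>)}"
    then obtain C0 D0 where C0: "C0 \<in> \<C>" and D0: "D0 \<in> \<D>" and y: "y = C0 (D0 \<Omega>)"
      by blast
    have "cinner z (b (X y) - X (b y)) = 0"
      if "z \<in> {x. \<exists>C\<in>\<C>. \<exists>D\<in>\<D>. x = C (D \<Omega>)}" for z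
    proof -
      obtain C1 D1 where C1: "C1 \<in> \<C>" and D1: "D1 \<in> \<D>" and z: "z = C1 (D1 \<Omega>)"
        using \<open>z \<in> _\<close> by blast
      have bd: "C0 \<in> bounded_ops" "D0 \<in> bounded_ops" "C1 \<in> bounded_ops" "D1 \<in> bounded_ops"
        using C0 D0 C1 D1 C(1) D(1) by auto
      \<comment> \<open>\<open>X\<close> moves past \<open>C0\<close> and \<open>b\<close> past
        \<open>D0\<close>, so that \<open>X\<close> meets only vectors \<open>D \<Omega>\<close> and
        \<open>b\<close> only vectors \<open>C \<Omega>\<close>.\<close>
      have Xy: "X y = C0 (X (D0 \<Omega>))"
        unfolding y by (rule commutantD [OF X C0])
      have bz: "adj b z = D1 (adj b (C1 \<Omega>))"
        unfolding z CD [OF C1 D1] by (rule commutantD [OF ab D1])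
      have aXz: "adj X z = C1 (adj X (D1 \<Omega>))"
        unfolding z by (rule commutantD [OF aX C1])
      have b_y: "b y = D0 (b (C0 \<Omega>))"
        unfolding y CD [OF C0 D0] by (rule commutantD [OF b D0])
      have "cinner (b (X y)) z = cinner (C0 (X (D0 \<Omega>))) (D1 (adj b (C1 \<Omega>)))"
        using bounded by (simp add: cinner_adj_right flip: Xy bz)
      also have "cinner (C0 (X (D0 \<Omega>))) (D1 (adj b (C1 \<Omega>)))
          = cinner (adj D1 (C0 (X (D0 \<Omega>)))) (adj b (C1 \<Omega>))"
        using bd by (simp add: cinner_adj_left)
      also have "adj D1 (C0 (X (D0 \<Omega>))) = C0 (adj D1 (X (D0 \<Omega>)))"
        using CD [OF C0 aD [OF D1]] by simp
      also have "cinner (C0 (adj D1 (X (D0 \<Omega>)))) (adj b (C1 \<Omega>))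
          = cinner (adj D1 (X (D0 \<Omega>))) (adj C0 (adj b (C1 \<Omega>)))"
        using bd by (simp add: cinner_adj_right)
      also have "\<dots> = cinner (adj D1 (X (D0 \<Omega>))) \<Omega> * cinner \<Omega> (adj C0 (adj b (C1 \<Omega>)))"
        by (rule factor) (intro C0 C1 D0 D1 aC aD X ab)+
      also have "cinner (adj D1 (X (D0 \<Omega>))) \<Omega> = cinner (X (D0 \<Omega>)) (D1 \<Omega>)"
        using bd by (simp add: cinner_adj_left)
      also have "cinner \<Omega> (adj C0 (adj b (C1 \<Omega>))) = cinner (b (C0 \<Omega>)) (C1 \<Omega>)"
        using bd bounded by (simp add: cinner_adj_right)
      finally have 1: "cinner (b (X y)) z = cinner (X (D0 \<Omega>)) (D1 \<Omega>) * cinner (b (C0 \<Omega>)) (C1 \<Omega>)" .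
      \<comment> \<open>For the product in the other order, taken with the arguments exchanged, the
        same factorisation yields the conjugates of the two factors in \<open>1\<close>.\<close>
      have "cinner z (X (b y)) = cinner (C1 (adj X (D1 \<Omega>))) (D0 (b (C0 \<Omega>)))"
        using bounded by (simp add: cinner_adj_left flip: aXz b_y)
      also have "cinner (C1 (adj X (D1 \<Omega>))) (D0 (b (C0 \<Omega>)))
          = cinner (adj D0 (C1 (adj X (D1 \<Omega>)))) (b (C0 \<Omega>))"
        using bd by (simp add: cinner_adj_left)
      also have "adj D0 (C1 (adj X (D1 \<Omega>))) = C1 (adj D0 (adj X (D1 \<Omega>)))"
        using CD [OF C1 aD [OF D0]] by simp
      also have "cinner (C1 (adj D0 (adj X (D1 \<Omega>)))) (b (C0 \<Omega>))
          = cinner (adj D0 (adj X (D1 \<Omega>))) (adj C1 (b (C0 \<Omega>)))"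
        using bd by (simp add: cinner_adj_right)
      also have "\<dots> = cinner (adj D0 (adj X (D1 \<Omega>))) \<Omega> * cinner \<Omega> (adj C1 (b (C0 \<Omega>)))"
        by (rule factor) (intro C0 C1 D0 D1 aC aD b aX)+
      also have "cinner (adj D0 (adj X (D1 \<Omega>))) \<Omega> = cinner (D1 \<Omega>) (X (D0 \<Omega>))"
        using bd bounded by (simp add: cinner_adj_left)
      also have "cinner \<Omega> (adj C1 (b (C0 \<Omega>))) = cinner (C1 \<Omega>) (b (C0 \<Omega>))"
        using bd by (simp add: cinner_adj_right)
      finally have "cinner z (X (b y)) = cinner (D1 \<Omega>) (X (D0 \<Omega>)) * cinner (C1 \<Omega>) (b (C0 \<Omega>))" .
      also have "\<dots> = cnj (cinner (X (D0 \<Omega>)) (D1 \<Omega>) * cinner (b (C0 \<Omega>)) (C1 \<Omega>))"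
        by (simp add: cinner_commute [of "D1 \<Omega>"] cinner_commute [of "C1 \<Omega>"])
      also have "\<dots> = cinner z (b (X y))"
        unfolding 1 [symmetric] by (rule cinner_commute [symmetric])
      finally show ?thesis
        by (simp add: cinner_simps)
    qed
    then have "b (X y) - X (b y) = 0"
      by (rule eq_zero_of_orthogonal_total [OF total])
    then show "(b o\<^sub>L X) y = (X o\<^sub>L b) y"
      by simp
  qed (simp_all add: bounded_ops_compose bounded)
qed

section \<open>Cyclic and separating vectors\<close>

definition orbit :: "'a :: complex_hilbert_space op set \<Rightarrow> 'a \<Rightarrow> 'a set" where
  "orbit M \<zeta> = {x. \<exists>a\<in>M. x = a \<zeta>}"

lemma orbitI: "a \<in> M \<Longrightarrow> a \<zeta> \<in> orbit M \<zeta>"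
  for M :: "'a :: complex_hilbert_space op set"
  by (auto simp: orbit_def)

lemma orbitE:
  fixes M :: "'a :: complex_hilbert_space op set"
  assumes "x \<in> orbit M \<zeta>"
  obtains a where "a \<in> M" "x = a \<zeta>"
  using assms by (auto simp: orbit_def)

lemma csubspace_orbit:
  assumes C: "C \<subseteq> bounded_ops"
  shows "csubspace (orbit (commutant C) \<zeta>)"
proof (rule csubspaceI)
  show "0 \<in> orbit (commutant C) \<zeta>"
    using orbitI [OF commutant_scaleC_op [OF commutant_id C], of 0 \<zeta>] by simp
  show "x + y \<in> orbit (commutant C) \<zeta>"
    if xy: "x \<in> orbit (commutant C) \<zeta>" "y \<in> orbit (commutant C) \<zeta>" for x y
  proof -
    obtain a b where ab: "a \<in> commutant C" "b \<in> commutant C" "x = a \<zeta>" "y = b \<zeta>"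
      using xy by (auto elim!: orbitE)
    then show ?thesis
      using orbitI [OF commutant_add [OF ab(1,2) C], of \<zeta>] by (simp add: blinfun.add_left)
  qed
  show "k *\<^sub>C x \<in> orbit (commutant C) \<zeta>" if "x \<in> orbit (commutant C) \<zeta>" for k x
    using that
  proof (rule orbitE)
    fix a assume "a \<in> commutant C" "x = a \<zeta>"
    then show ?thesis
      using orbitI [OF commutant_scaleC_op [OF _ C], of a k \<zeta>] by simp
  qed
qed

text \<open>The projection onto the closed orbit commutes with the algebra, because the orbit is
  invariant under it and its adjoints. Its complement kills \<open>\<zeta>\<close> and lies in the
  commutant, so it is 0.\<close>

lemma cyclic_of_separating:
  fixes C :: "'a :: complex_hilbert_space op set"
  assumes C: "C \<subseteq> bounded_ops" "adj ` C \<subseteq> C"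
    and sep: "\<And>T. T \<in> commutant (commutant C) \<Longrightarrow> T \<zeta> = 0 \<Longrightarrow> T = 0"
  shows "closure (orbit (commutant C) \<zeta>) = UNIV"
proof -
  let ?W = "orbit (commutant C) \<zeta>"
  note W = csubspace_orbit [OF C(1), of \<zeta>]
  obtain P where P: "P \<in> bounded_ops" "\<And>v. P v \<in> closure ?W"
    "\<And>v x. x \<in> ?W \<Longrightarrow> cinner x (P v) = cinner x v"
    using projection_exists [OF W] by blast
  note eqI = eq_of_cinner_eq_on_closure [OF W]
  have P_comm: "P (a v) = a (P v)" if a: "a \<in> commutant C" for a v
  proof (rule eqI)
    have a_b: "a \<in> bounded_ops"
      using a by (rule commutant_bounded_ops)
    show "P (a v) \<in> closure ?W"
      by (rule P(2))
    have "a ` closure ?W \<subseteq> closure (a ` ?W)"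
      by (rule image_closure_subset) (auto intro: continuous_intros closure_subset [THEN subsetD])
    also have "a ` ?W \<subseteq> ?W"
      using orbitI [OF commutant_compose [OF a], of _ \<zeta>] by (auto elim!: orbitE)
    finally show "a (P v) \<in> closure ?W"
      using P(2) closure_mono by blast
    show "cinner x (P (a v)) = cinner x (a (P v))" if x: "x \<in> ?W" for x
    proof -
      obtain b where b: "b \<in> commutant C" "x = b \<zeta>"
        using x by (rule orbitE)
      then have ax: "adj a x \<in> ?W"
        using orbitI [OF commutant_compose [OF adj_commutant [OF C a] b(1)], of \<zeta>] by simp
      have "cinner x (P (a v)) = cinner x (a v)"
        by (rule P(3) [OF x])
      also have "\<dots> = cinner (adj a x) v"
        using a_b by (simp add: cinner_adj_left)
      also have "\<dots> = cinner (adj a x) (P v)"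
        by (rule P(3) [OF ax, symmetric])
      also have "\<dots> = cinner x (a (P v))"
        using a_b by (simp add: cinner_adj_left)
      finally show ?thesis .
    qed
  qed
  have "\<zeta> \<in> ?W"
    using orbitI [OF commutant_id, where \<zeta> = \<zeta>] by simp
  then have "P \<zeta> = \<zeta>"
    by (intro eqI P(2,3)) (simp_all add: closure_subset [THEN subsetD])
  moreover have "id_blinfun - P \<in> commutant (commutant C)"
    by (rule commutantI)
       (auto simp: P bounded_ops_diff blinfun.diff_left blinfun.diff_right P_comm)
  ultimately have "id_blinfun - P = 0"
    by (intro sep) (simp_all add: blinfun.diff_left)
  then have "P v = v" for v
    by (metis blinfun_apply_id_blinfun eq_iff_diff_eq_0 id_apply)
  then show ?thesis
    using P(2) by (metis UNIV_eq_I)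
qed

section \<open>Local algebras and their commutants\<close>

context fock_lattice
begin

text \<open>The commutant of the algebra of \<open>J\<close>, described through generators so that
  membership can be checked site by site. The algebra is recovered as
  \<open>commutant (com J)\<close>.\<close>

definition com :: "'l set \<Rightarrow> 'f op set" where
  "com J = commutant (ann ` J \<union> cre ` J)"

lemma gens_bounded: "ann ` J \<union> cre ` J \<subseteq> bounded_ops"
  and gens_adj: "adj ` (ann ` J \<union> cre ` J) \<subseteq> ann ` J \<union> cre ` J"
  by auto

lemma com_bounded: "com J \<subseteq> bounded_ops"
  by (auto simp: com_def commutant_bounded_ops)

lemma com_adj: "adj ` com J \<subseteq> com J"
  unfolding com_def using adj_commutant [OF gens_bounded gens_adj] by blast

lemma lattice_algebra_eq: "lattice_algebra cr e J = commutant (com J)"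
proof -
  have "adj ` (\<lambda>l. adj (cr (e l))) ` J = cre ` J"
    by (simp add: image_image cre_def)
  moreover have "(\<lambda>l. adj (cr (e l))) ` J \<subseteq> bounded_ops"
    by auto
  ultimately show ?thesis
    unfolding lattice_algebra_def com_def by (simp add: vn_generated_eq ann_def [abs_def])
qed

lemma commutant_lattice_algebra: "commutant (lattice_algebra cr e J) = com J"
  unfolding lattice_algebra_eq com_def by (rule triple_commutant [OF gens_bounded])

lemma gens_in_algebra:
  "l \<in> J \<Longrightarrow> ann l \<in> lattice_algebra cr e J" "l \<in> J \<Longrightarrow> cre l \<in> lattice_algebra cr e J"
  unfolding lattice_algebra_eq com_def using subset_double_commutant [OF gens_bounded, of J] by auto

lemma comD: "T \<in> com J \<Longrightarrow> l \<in> J \<Longrightarrow> T (ann l x) = ann l (T x)"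
    "T \<in> com J \<Longrightarrow> l \<in> J \<Longrightarrow> T (cre l x) = cre l (T x)"
  unfolding com_def by (auto intro: commutantD)

lemma comI:
  "T \<in> bounded_ops \<Longrightarrow> (\<And>l x. l \<in> J \<Longrightarrow> T (ann l x) = ann l (T x)) \<Longrightarrow>
    (\<And>l x. l \<in> J \<Longrightarrow> T (cre l x) = cre l (T x)) \<Longrightarrow> T \<in> com J"
  unfolding com_def by (auto intro: commutantI)

text \<open>The vector \<open>v\<close> has no particles outside \<open>J\<close> and
  \<open>u\<close> has none inside, so the vacuum is the only component they share.\<close>

lemma cinner_vacuum_factor:
  assumes J: "J \<subseteq> L"
    and v: "\<And>l. l \<in> L - J \<Longrightarrow> ann l v = 0" and u: "\<And>l. l \<in> J \<Longrightarrow> ann l u = 0"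
  shows "cinner v u = cinner v (fvec []) * cinner (fvec []) u"
proof -
  define u' where "u' = u - cinner u (fvec []) *\<^sub>C fvec []"
  have vac: "cinner (fvec []) (fvec []) = 1"
    by (rule fvec_normalized) auto
  have ann_vac: "ann l (fvec []) = 0" if "l \<in> L" for l
    using that by (intro ann_fvec_notin) auto
  have u'_ann: "ann l u' = 0" if "l \<in> J" for l
    using that J u ann_vac by (auto simp: u'_def blinfun.diff_right bounded_ops_scaleC)
  have u'_vac: "cinner (fvec []) u' = 0"
    by (simp add: u'_def cinner_simps vac) (rule cinner_commute)
  \<comment> \<open>All basis vectors supported in \<open>J\<close> lie in \<open>W\<close>. Since
    \<open>v\<close> has no other components, it equals its projection onto \<open>W\<close> and is
    therefore orthogonal to \<open>u'\<close>; no expansion into a series is involved.\<close>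
  define W where "W = {x. cinner x u' = 0} \<inter>
      (\<Inter>s\<in>{s \<in> lists L. distinct s \<and> \<not> set s \<subseteq> J}. {x. cinner x (fvec s) = 0})"
  have W: "csubspace W"
    unfolding W_def by (intro csubspace_Int csubspace_INT csubspace_cinner_eq_zero_left)
  have "closed W"
    unfolding W_def by (intro closed_Int closed_INT ballI closed_cinner_eq_zero_left)
  obtain P where "P \<in> bounded_ops" and P: "\<And>v. P v \<in> closure W"
    "\<And>v x. x \<in> W \<Longrightarrow> cinner x (P v) = cinner x v"
    using projection_exists [OF W] by blast
  then have P_W: "P v \<in> W" for v
    using \<open>closed W\<close> by (simp add: closure_closed)
  have fvec_W: "fvec s \<in> W" if s: "s \<in> lists L" "distinct s" "set s \<subseteq> J" for s
    unfolding W_def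
  proof (intro IntI INT_I CollectI)
    show "cinner (fvec s) u' = 0"
    proof (cases s)
      case (Cons l t)
      then show ?thesis
        using s u'_ann by (simp add: cre_fvec [symmetric] cinner_cre_left cinner_simps)
    qed (simp add: u'_vac)
    fix t assume "t \<in> {s \<in> lists L. distinct s \<and> \<not> set s \<subseteq> J}"
    then obtain l where l: "t \<in> lists L" "l \<in> set t" "l \<notin> J"
      by blast
    then have "cinner (fvec t) (fvec s) = 0"
      using s by (intro fvec_orthogonal [of t s l]) auto
    then show "cinner (fvec s) (fvec t) = 0"
      by (metis cinner_commute complex_cnj_zero)
  qed
  have "v - P v = 0"
  proof (rule eq_zero_of_orthogonal_total [OF total_fvec])
    fix x assume "x \<in> fvec ` {s \<in> lists L. distinct s}"
    then obtain s where s: "x = fvec s" "s \<in> lists L" "distinct s"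
      by blast
    show "cinner x (v - P v) = 0"
    proof (cases "set s \<subseteq> J")
      case True
      then show ?thesis
        using P(2) [OF fvec_W, of s v] s by (simp add: cinner_simps)
    next
      case False
      then have "cinner (P v) x = 0"
        using P_W [of v] s unfolding W_def by blast
      then have "cinner x (P v) = 0"
        by (metis cinner_commute complex_cnj_zero)
      moreover have "cinner x v = 0"
      proof -
        obtain l where l: "l \<in> set s" "l \<notin> J"
          using False by blast
        then have "l \<in> L - J"
          using s by auto
        then have "cinner (fvec (l # remove1 l s)) v = 0"
          using v by (simp add: cre_fvec [symmetric] cinner_cre_left cinner_simps)
        then show ?thesis
          using fvec_move_to_front [OF l(1)] s by (auto simp: cinner_simps)
      qed
      ultimately show ?thesis
        by (simp add: cinner_simps)
    qed
  qed
  then have "v \<in> W"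
    using P_W [of v] by simp
  then have "cinner v u' = 0"
    by (simp add: W_def)
  then have "cinner v u = cnj (cinner u (fvec [])) * cinner v (fvec [])"
    by (simp add: u'_def cinner_simps)
  then show ?thesis
    by (simp only: cinner_commute [of "fvec []" u] mult.commute)
qed

end

section \<open>The parity operator and the twist\<close>

locale parity =
  fixes \<Gamma> :: "'f :: complex_hilbert_space op"
  assumes Gamma_bounded [simp]: "\<Gamma> \<in> bounded_ops" and adj_Gamma [simp]: "adj \<Gamma> = \<Gamma>"
    and Gamma_square: "\<Gamma> o\<^sub>L \<Gamma> = id_blinfun"
begin

lemma Gamma_Gamma [simp]: "\<Gamma> (\<Gamma> x) = x"
  by (metis Gamma_square blinfun_apply_blinfun_compose blinfun_apply_id_blinfun id_apply)

lemma cinner_Gamma: "cinner (\<Gamma> x) y = cinner x (\<Gamma> y)"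
  using cinner_adj_left [of \<Gamma> x y] by simp

lemma Gamma_scaleC: "\<Gamma> (k *\<^sub>C x) = k *\<^sub>C \<Gamma> x"
  by (rule bounded_ops_scaleC [OF Gamma_bounded])

text \<open>A square root of \<open>\<i> \<Gamma>\<close>: multiplication by an eighth root of unity
  on even vectors and by its conjugate on odd ones. \<open>V'\<close> is its adjoint and
  inverse.\<close>

definition V :: "'f op" where
  "V = scaleC_op (of_real (1 / sqrt 2)) (id_blinfun + scaleC_op \<i> \<Gamma>)"

definition V' :: "'f op" where
  "V' = scaleC_op (of_real (1 / sqrt 2)) (id_blinfun - scaleC_op \<i> \<Gamma>)"

lemma V_apply: "V x = of_real (1 / sqrt 2) *\<^sub>C (x + \<i> *\<^sub>C \<Gamma> x)"
  and V'_apply: "V' x = of_real (1 / sqrt 2) *\<^sub>C (x - \<i> *\<^sub>C \<Gamma> x)"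
  by (simp_all add: V_def V'_def blinfun.add_left blinfun.diff_left)

lemma V_bounded [simp]: "V \<in> bounded_ops"
  and V'_bounded [simp]: "V' \<in> bounded_ops"
  by (simp_all add: V_def V'_def bounded_ops_scaleC_op bounded_ops_add bounded_ops_diff)

lemma adj_V [simp]: "adj V = V'"
  unfolding V_def V'_def
  by (simp add: adj_scaleC_op adj_add bounded_ops_add bounded_ops_scaleC_op)
    (auto intro!: blinfun_eqI simp: scaleC_minus_left blinfun.add_left blinfun.diff_left)

lemma adj_V' [simp]: "adj V' = V"
  by (metis V_bounded adj_V adj_adj)

lemma half_scaleC: "of_real (1 / sqrt 2) *\<^sub>C of_real (1 / sqrt 2) *\<^sub>C (x + x) = x"
proof -
  have "complex_of_real (1 / sqrt 2) * of_real (1 / sqrt 2) * 2 = of_real (1 / sqrt 2 * (1 / sqrt 2) * 2)"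
    by (simp only: of_real_mult of_real_numeral)
  also have "\<dots> = 1"
    by simp
  finally have "complex_of_real (1 / sqrt 2) * of_real (1 / sqrt 2) * 2 = 1" .
  moreover have "x + x = 2 *\<^sub>C x"
    using scaleC_add_left [of 1 1 x] by simp
  ultimately show ?thesis
    by (simp only: scaleC_scaleC mult.assoc scaleC_one)
qed

lemma V_V' [simp]: "V (V' x) = x"
proof -
  have "V (V' x) = of_real (1 / sqrt 2) *\<^sub>C of_real (1 / sqrt 2) *\<^sub>C (x + x)"
    unfolding V_apply V'_apply Gamma_scaleC
    by (simp add: blinfun.diff_right Gamma_scaleC scaleC_add_right scaleC_diff_right scaleC_scaleC
        mult_ac scaleC_minus_left)
  then show ?thesis
    by (simp only: half_scaleC)
qed

lemma V'_V [simp]: "V' (V x) = x"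
proof -
  have "V' (V x) = of_real (1 / sqrt 2) *\<^sub>C of_real (1 / sqrt 2) *\<^sub>C (x + x)"
    unfolding V_apply V'_apply Gamma_scaleC
    by (simp add: blinfun.add_right Gamma_scaleC scaleC_add_right scaleC_diff_right scaleC_scaleC
        mult_ac scaleC_minus_left)
  then show ?thesis
    by (simp only: half_scaleC)
qed

text \<open>\<open>twist\<close> fixes even operators and multiplies odd ones by \<open>\<i> \<Gamma>\<close>.\<close>

definition twist :: "'f op \<Rightarrow> 'f op" where "twist b = V o\<^sub>L b o\<^sub>L V'"
definition untwist :: "'f op \<Rightarrow> 'f op" where "untwist b = V' o\<^sub>L b o\<^sub>L V"

lemma twist_apply: "twist b x = V (b (V' x))"
  and untwist_apply: "untwist b x = V' (b (V x))"
  by (simp_all add: twist_def untwist_def)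

lemma twist_untwist [simp]: "twist (untwist b) = b"
  and untwist_twist [simp]: "untwist (twist b) = b"
  by (auto intro!: blinfun_eqI simp: twist_apply untwist_apply)

lemma twist_eq_zero: "twist b = 0 \<Longrightarrow> b = 0"
proof -
  assume "twist b = 0"
  then have "untwist (twist b) = untwist 0"
    by simp
  also have "untwist 0 = 0"
    by (rule blinfun_eqI) (simp add: untwist_apply)
  finally show ?thesis
    by simp
qed

lemma twist_bounded: "b \<in> bounded_ops \<Longrightarrow> twist b \<in> bounded_ops"
  and untwist_bounded: "b \<in> bounded_ops \<Longrightarrow> untwist b \<in> bounded_ops"
  by (simp_all add: twist_def untwist_def bounded_ops_compose)

text \<open>Moving an odd operator past \<open>V\<close> changes the sign of \<open>\<Gamma>\<close>
  and so turns \<open>V\<close> into \<open>V'\<close>, which equals \<open>V\<close> composed with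
  \<open>- \<i> \<Gamma>\<close>.\<close>

lemma odd_V:
  assumes a: "a \<in> bounded_ops" and odd: "\<And>x. \<Gamma> (a x) = - a (\<Gamma> x)"
  shows "a (V y) = V ((- \<i>) *\<^sub>C \<Gamma> (a y))"
proof -
  have "V ((- \<i>) *\<^sub>C \<Gamma> (a y)) = of_real (1 / sqrt 2) *\<^sub>C (a y - \<i> *\<^sub>C \<Gamma> (a y))"
    by (simp add: V_apply Gamma_scaleC scaleC_scaleC scaleC_minus_left scaleC_minus_right
        scaleC_diff_right blinfun.minus_right algebra_simps)
  moreover have "a (V y) = of_real (1 / sqrt 2) *\<^sub>C (a y - \<i> *\<^sub>C \<Gamma> (a y))"
    using a by (simp add: V_apply bounded_ops_scaleC blinfun.add_right odd scaleC_minus_right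
        scaleC_diff_right)
  ultimately show ?thesis
    by simp
qed

text \<open>Pulled back through \<open>V\<close>, an odd \<open>a\<close> becomes
  \<open>- \<i> \<Gamma> a\<close>. Commuting with \<open>a\<close> after the twist is thus
  commuting with \<open>\<Gamma> a\<close> before it, and both inclusions of the duality can be
  decided on generators.\<close>

lemma twist_commutes_odd_iff:
  assumes a: "a \<in> bounded_ops" and odd: "\<And>x. \<Gamma> (a x) = - a (\<Gamma> x)" and b: "b \<in> bounded_ops"
  shows "(\<forall>x. twist b (a x) = a (twist b x)) \<longleftrightarrow> (\<forall>x. b (\<Gamma> (a x)) = \<Gamma> (a (b x)))"
proof -
  have 1: "twist b (a (V y)) = V ((- \<i>) *\<^sub>C b (\<Gamma> (a y)))" for y
    by (simp only: odd_V [OF a odd] twist_apply V'_V bounded_ops_scaleC [OF b])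
  have 2: "a (twist b (V y)) = V ((- \<i>) *\<^sub>C \<Gamma> (a (b y)))" for y
    by (simp only: odd_V [OF a odd] twist_apply V'_V)
  have cancel: "V ((- \<i>) *\<^sub>C u) = V ((- \<i>) *\<^sub>C v) \<longleftrightarrow> u = v" for u v
  proof
    assume "V ((- \<i>) *\<^sub>C u) = V ((- \<i>) *\<^sub>C v)"
    then have "\<i> *\<^sub>C V' (V ((- \<i>) *\<^sub>C u)) = \<i> *\<^sub>C V' (V ((- \<i>) *\<^sub>C v))"
      by (simp only:)
    then show "u = v"
      by (simp only: V'_V scaleC_scaleC) simp
  qed simp
  show ?thesis
  proof
    assume *: "\<forall>x. twist b (a x) = a (twist b x)"
    show "\<forall>x. b (\<Gamma> (a x)) = \<Gamma> (a (b x))"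
    proof
      fix y
      show "b (\<Gamma> (a y)) = \<Gamma> (a (b y))"
        using spec [OF *, of "V y"] by (simp only: 1 2 cancel)
    qed
  next
    assume *: "\<forall>x. b (\<Gamma> (a x)) = \<Gamma> (a (b x))"
    show "\<forall>x. twist b (a x) = a (twist b x)"
    proof
      fix x
      have "twist b (a (V (V' x))) = a (twist b (V (V' x)))"
        by (simp only: 1 2 *)
      then show "twist b (a x) = a (twist b x)"
        by simp
    qed
  qed
qed

end

locale fock_parity = fock_lattice w cr L e + parity \<Gamma>
  for w :: "'h :: complex_hilbert_space list \<Rightarrow> 'f :: complex_hilbert_space"
    and cr :: "'h \<Rightarrow> 'f op" and L :: "'l set" and e :: "'l \<Rightarrow> 'h" and \<Gamma> :: "'f op" +
  assumes Gamma_fvec: "\<And>s. s \<in> lists L \<Longrightarrow> \<Gamma> (fvec s) = (if even (length s) then fvec s else - fvec s)"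
begin

lemma Gamma_cre: "l \<in> L \<Longrightarrow> \<Gamma> (cre l x) = - cre l (\<Gamma> x)"
proof -
  assume l: "l \<in> L"
  have "\<Gamma> o\<^sub>L cre l = scaleC_op (- 1) (cre l o\<^sub>L \<Gamma>)"
  proof (rule op_eqI_fvec)
    fix s assume "s \<in> lists L"
    then show "(\<Gamma> o\<^sub>L cre l) (fvec s) = (scaleC_op (- 1) (cre l o\<^sub>L \<Gamma>)) (fvec s)"
      using l by (simp add: cre_fvec Gamma_fvec scaleC_minus_left blinfun.minus_right)
  qed (simp_all add: bounded_ops_compose bounded_ops_scaleC_op)
  then have "(\<Gamma> o\<^sub>L cre l) x = (scaleC_op (- 1) (cre l o\<^sub>L \<Gamma>)) x"
    by simp
  then show ?thesis
    by (simp add: scaleC_minus_left)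
qed

lemma Gamma_ann: "l \<in> L \<Longrightarrow> \<Gamma> (ann l x) = - ann l (\<Gamma> x)"
proof (rule cinner_ext_left)
  show "cinner (\<Gamma> (ann l x)) z = cinner (- ann l (\<Gamma> x)) z" if "l \<in> L" for z
    using that by (simp add: cinner_Gamma cinner_ann_left Gamma_cre cinner_simps)
qed

text \<open>At different sites the sign of anticommutation cancels the sign from passing
  \<open>\<Gamma>\<close>, which acts as a Klein factor.\<close>

lemma Gamma_gen_in_com:
  assumes J: "J \<subseteq> L" and k: "k \<in> J" and K: "K \<subseteq> L - J"
  shows "\<Gamma> o\<^sub>L ann k \<in> com K" "\<Gamma> o\<^sub>L cre k \<in> com K"
proof -
  have *: "l \<in> L" "k \<in> L" "k \<noteq> l" if "l \<in> K" for l
    using that J k K by auto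
  have "ann l (cre k x) = - cre k (ann l x)" "ann k (cre l x) = - cre l (ann k x)" if "l \<in> K" for l x
    using canonical_anticommutation [of l k x] canonical_anticommutation [of k l x] * [OF that]
    by (auto simp: eq_neg_iff_add_eq_0)
  then show "\<Gamma> o\<^sub>L ann k \<in> com K" "\<Gamma> o\<^sub>L cre k \<in> com K"
    using *
    by (auto intro!: comI simp: bounded_ops_compose Gamma_ann Gamma_cre blinfun.minus_right
        ann_anticommute [of k] cre_anticommute [of k])
qed

text \<open>The easy inclusion: elements of the algebra of \<open>K\<close> commute with
  \<open>\<Gamma> o\<^sub>L ann k\<close> and \<open>\<Gamma> o\<^sub>L cre k\<close> for
  \<open>k\<close> in \<open>J\<close>. It is used for both halves of the lattice, once for the
  duality and once to see that \<open>\<zeta>\<close> separates the algebra of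
  \<open>I\<close>.\<close>

lemma twist_lattice_algebra:
  assumes J: "J \<subseteq> L" and K: "K \<subseteq> L - J" and b: "b \<in> lattice_algebra cr e K"
  shows "twist b \<in> com J"
proof (rule comI)
  have b': "b \<in> commutant (com K)"
    using b by (simp add: lattice_algebra_eq)
  then have bb: "b \<in> bounded_ops"
    by (rule commutant_bounded_ops)
  then show "twist b \<in> bounded_ops"
    by (rule twist_bounded)
  fix k x assume k: "k \<in> J"
  then have kL: "k \<in> L"
    using J by blast
  have "\<forall>x. b (\<Gamma> (ann k x)) = \<Gamma> (ann k (b x))" "\<forall>x. b (\<Gamma> (cre k x)) = \<Gamma> (cre k (b x))"
    using commutantD [OF b' Gamma_gen_in_com(1) [OF J k K]]
      commutantD [OF b' Gamma_gen_in_com(2) [OF J k K]] by simp_all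
  then show "twist b (ann k x) = ann k (twist b x)" "twist b (cre k x) = cre k (twist b x)"
    using twist_commutes_odd_iff [OF ann_bounded Gamma_ann [OF kL] bb]
      twist_commutes_odd_iff [OF cre_bounded Gamma_cre [OF kL] bb] by blast+
qed

text \<open>\<open>\<D>\<close> is generated by the operators \<open>\<Gamma> a\<^sub>k\<close>, \<open>k \<in> J\<close>, which commute with the algebra of \<open>L - J\<close>.\<close>

lemma untwist_commutant:
  assumes J: "J \<subseteq> L" and c: "c \<in> com J"
  shows "untwist c \<in> lattice_algebra cr e (L - J)"
proof -
  define b where "b = untwist c"
  have bb: "b \<in> bounded_ops"
    using c com_bounded by (auto simp: b_def intro: untwist_bounded)
  define G where "G = (\<lambda>k. \<Gamma> o\<^sub>L ann k) ` J \<union> adj ` (\<lambda>k. \<Gamma> o\<^sub>L ann k) ` J"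
  have adj_gen: "adj (\<Gamma> o\<^sub>L ann k) x = - \<Gamma> (cre k x)" if "k \<in> J" for k x
    using that J by (simp add: adj_compose Gamma_cre subset_iff)
  define \<C> where "\<C> = commutant (com (L - J))"
  define \<D> where "\<D> = commutant (commutant G)"
  have G: "G \<subseteq> bounded_ops" "adj ` G \<subseteq> G"
    by (auto simp: G_def bounded_ops_compose image_image)
  have G': "commutant G \<subseteq> bounded_ops"
    by (auto intro: commutant_bounded_ops)
  have b_G: "b \<in> commutant G"
  proof (rule commutantI)
    show "b \<in> bounded_ops"
      by (rule bb)
    fix X x assume "X \<in> G"
    then obtain k where k: "k \<in> J" and X: "X = \<Gamma> o\<^sub>L ann k \<or> X = adj (\<Gamma> o\<^sub>L ann k)"
      unfolding G_def by blast
    then have kL: "k \<in> L"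
      using J by blast
    have "\<forall>x. twist b (ann k x) = ann k (twist b x)" "\<forall>x. twist b (cre k x) = cre k (twist b x)"
      using comD [OF c k] by (simp_all add: b_def)
    then have "b (\<Gamma> (ann k x)) = \<Gamma> (ann k (b x))" "b (\<Gamma> (cre k x)) = \<Gamma> (cre k (b x))"
      using twist_commutes_odd_iff [OF ann_bounded Gamma_ann [OF kL] bb]
        twist_commutes_odd_iff [OF cre_bounded Gamma_cre [OF kL] bb] by blast+
    then show "b (X x) = X (b x)"
      using X by (auto simp: adj_gen [OF k] blinfun.minus_right)
  qed
  have adj_G: "adj ` commutant G \<subseteq> commutant G"
    using adj_commutant [OF G] by blast
  have C: "\<C> \<subseteq> bounded_ops" "adj ` \<C> \<subseteq> \<C>"
    unfolding \<C>_def using adj_commutant [OF com_bounded com_adj]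
    by (auto intro: commutant_bounded_ops)
  have D: "\<D> \<subseteq> bounded_ops" "adj ` \<D> \<subseteq> \<D>"
    unfolding \<D>_def using adj_commutant [OF G' adj_G]
    by (auto intro: commutant_bounded_ops)
  have "G \<subseteq> com (L - J)"
    unfolding G_def using Gamma_gen_in_com [OF J] com_adj by blast
  then have "\<C> \<subseteq> commutant G"
    unfolding \<C>_def by (rule commutant_antimono)
  then have CD: "C (D x) = D (C x)" if "C \<in> \<C>" "D \<in> \<D>" for C D x
    using that unfolding \<D>_def by (metis commutantD subsetD)
  have b_D: "b \<in> commutant \<D>"
    unfolding \<D>_def using subset_double_commutant [OF G'] b_G by blast
  have ann_C: "ann l \<in> \<C>" and cre_C: "cre l \<in> \<C>" if "l \<in> L - J" for l
    using gens_in_algebra [of l "L - J"] that by (simp_all add: lattice_algebra_eq \<C>_def)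
  have G_D: "G \<subseteq> \<D>"
    unfolding \<D>_def by (rule subset_double_commutant [OF G(1)])
  \<comment> \<open>Entries outside \<open>J\<close> are created by operators of \<open>\<C>\<close>
    and entries in \<open>J\<close> by operators of \<open>\<D>\<close>; the factors
    \<open>\<Gamma>\<close> contribute only signs on basis vectors.\<close>
  have total: "total_set {x. \<exists>C\<in>\<C>. \<exists>D\<in>\<D>. x = C (D (fvec []))}"
  proof -
    have D_fvec: "\<exists>D\<in>\<D>. fvec s = D (fvec [])" if "s \<in> lists J" for s
      using that
    proof (induction s)
      case Nil
      show ?case
        by (rule bexI [of _ id_blinfun]) (simp_all add: \<D>_def commutant_id)
    next
      case (Cons k s)
      then obtain D where D: "D \<in> \<D>" "fvec s = D (fvec [])"
        by blast
      have "k # s \<in> lists L"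
        using Cons J by auto
      then have "\<Gamma> (fvec (k # s)) = fvec (k # s) \<or> \<Gamma> (fvec (k # s)) = - fvec (k # s)"
        by (simp add: Gamma_fvec)
      moreover have "- \<Gamma> (fvec (k # s)) = (adj (\<Gamma> o\<^sub>L ann k) o\<^sub>L D) (fvec [])"
        using Cons.hyps by (simp add: D(2) adj_gen flip: cre_fvec)
      moreover have D': "adj (\<Gamma> o\<^sub>L ann k) o\<^sub>L D \<in> \<D>"
      proof -
        have "adj (\<Gamma> o\<^sub>L ann k) \<in> \<D>"
          using G_D Cons.hyps by (auto simp: G_def)
        then show ?thesis
          using D(1) unfolding \<D>_def by (rule commutant_compose)
      qed
      moreover have "scaleC_op (- 1) (adj (\<Gamma> o\<^sub>L ann k) o\<^sub>L D) \<in> \<D>"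
        using D' unfolding \<D>_def by (intro commutant_scaleC_op G')
      ultimately show ?case
        by (metis minus_minus scaleC_minus_left scaleC_one scaleC_op_apply)
    qed
    have C_fvec: "\<exists>C\<in>\<C>. \<forall>s. fvec (t @ s) = C (fvec s)" if "t \<in> lists (L - J)" for t
      using that
    proof (induction t)
      case Nil
      show ?case
        by (rule bexI [of _ id_blinfun]) (simp_all add: \<C>_def commutant_id)
    next
      case (Cons l t)
      then obtain C where C: "C \<in> \<C>" "\<forall>s. fvec (t @ s) = C (fvec s)"
        by blast
      have "cre l o\<^sub>L C \<in> \<C>"
        using cre_C [OF Cons.hyps(1)] C(1) unfolding \<C>_def by (rule commutant_compose)
      moreover have "fvec ((l # t) @ s) = (cre l o\<^sub>L C) (fvec s)" for s
        using C(2) cre_fvec [of l "t @ s"] by simp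
      ultimately show ?case
        by blast
    qed
    have in_CD: "\<exists>C\<in>\<C>. \<exists>D\<in>\<D>. fvec s = C (D (fvec []))" if s: "s \<in> lists L" "distinct s" for s
    proof -
      define t where "t = filter (\<lambda>l. l \<notin> J) s"
      define r where "r = filter (\<lambda>l. l \<in> J) s"
      have "t \<in> lists (L - J)" "r \<in> lists J"
        using s by (auto simp: t_def r_def)
      then obtain C D where C: "C \<in> \<C>" "\<forall>s. fvec (t @ s) = C (fvec s)"
        and D: "D \<in> \<D>" "fvec r = D (fvec [])"
        using C_fvec D_fvec by metis
      have "fvec s = fvec (t @ r) \<or> fvec s = - fvec (t @ r)"
        by (rule fvec_perm_distinct) (use s in \<open>auto simp: t_def r_def\<close>)
      moreover have "fvec (t @ r) = C (D (fvec []))"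
        using C(2) D(2) by simp
      moreover have "scaleC_op (- 1) C \<in> \<C>"
        using C(1) unfolding \<C>_def by (intro commutant_scaleC_op com_bounded)
      ultimately show ?thesis
        using C(1) D(1) by (metis scaleC_minus_left scaleC_one scaleC_op_apply)
    qed
    then have "fvec ` {s \<in> lists L. distinct s} \<subseteq> {x. \<exists>C\<in>\<C>. \<exists>D\<in>\<D>. x = C (D (fvec []))}"
      by blast
    then show ?thesis
      using total_fvec unfolding total_set_iff by (meson subset_trans)
  qed
  have "b o\<^sub>L X = X o\<^sub>L b" if X: "X \<in> com (L - J)" for X
  proof (rule commuting_of_product_vacuum [OF C D CD _ b_D total])
    show "X \<in> commutant \<C>"
      unfolding \<C>_def using X subset_double_commutant [OF com_bounded] by blast
    fix C C' D D' X b
    assume CC: "C \<in> \<C>" "C' \<in> \<C>" and DD: "D \<in> \<D>" "D' \<in> \<D>"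
      and X: "X \<in> commutant \<C>" and b: "b \<in> commutant \<D>"
    show "cinner (D' (X (D (fvec [])))) (C' (b (C (fvec []))))
        = cinner (D' (X (D (fvec [])))) (fvec []) * cinner (fvec []) (C' (b (C (fvec []))))"
    \<comment> \<open>For \<open>l\<close> outside \<open>J\<close>, \<open>ann l\<close> belongs to
      \<open>\<C>\<close> and passes \<open>D'\<close>, \<open>X\<close> and \<open>D\<close> down
      to the vacuum. For \<open>k\<close> in \<open>J\<close>,
      \<open>\<Gamma> o\<^sub>L ann k\<close> belongs to \<open>\<D>\<close> and passes
      \<open>C'\<close>, \<open>b\<close> and \<open>C\<close>.\<close>
    proof (rule cinner_vacuum_factor [OF J])
      fix l assume l: "l \<in> L - J"
      have "ann l (D' (X (D (fvec [])))) = D' (X (D (ann l (fvec []))))"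
        using CD [OF ann_C [OF l]] DD commutantD [OF X ann_C [OF l], symmetric] by simp
      also have "ann l (fvec []) = 0"
        using l by (intro ann_fvec_notin) auto
      finally show "ann l (D' (X (D (fvec [])))) = 0"
        by simp
    next
      fix k assume k: "k \<in> J"
      then have g: "\<Gamma> o\<^sub>L ann k \<in> \<D>"
        using G_D by (auto simp: G_def)
      have "(\<Gamma> o\<^sub>L ann k) (C' (b (C (fvec [])))) = C' (b (C ((\<Gamma> o\<^sub>L ann k) (fvec []))))"
        using CD [OF _ g] CC commutantD [OF b g] by metis
      also have "(\<Gamma> o\<^sub>L ann k) (fvec []) = 0"
        using k J ann_fvec_notin [of "[]" k] by auto
      finally have "\<Gamma> (ann k (C' (b (C (fvec []))))) = 0"
        by simp
      then show "ann k (C' (b (C (fvec [])))) = 0"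
        by (metis Gamma_Gamma blinfun.zero_right)
    qed
  qed
  then have "b \<in> commutant (com (L - J))"
    using bb by (simp add: commutant_def)
  then show ?thesis
    by (simp add: lattice_algebra_eq b_def)
qed

end

section \<open>The entangled vector\<close>

context fock_lattice
begin

lemma number_fvec:
  assumes s: "s \<in> lists L" "distinct s" and l: "l \<in> L"
  shows "cre l (ann l (fvec s)) = (if l \<in> set s then fvec s else 0)"
proof (cases "l \<in> set s")
  case True
  have "ann l (fvec (l # remove1 l s)) = fvec (remove1 l s)"
    using s l by (intro ann_fvec_Cons) (auto dest: notin_set_remove1)
  then show ?thesis
    using fvec_move_to_front [OF True] True by (auto simp: cre_fvec blinfun.minus_right)
next
  case False
  then show ?thesis
    using s l by (simp add: ann_fvec_notin)
qed

text \<open>At a site of \<open>J\<close> occupied in only one of \<open>s\<close> and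
  \<open>t\<close>, the number operator has eigenvalue 1 on one vector and 0 on the other, and
  \<open>T\<close> commutes with it.\<close>

lemma com_matrix_zero:
  assumes J: "J \<subseteq> L" and T: "T \<in> com J"
    and s: "s \<in> lists L" "distinct s" and t: "t \<in> lists L" "distinct t"
    and st: "set s \<inter> J \<noteq> set t \<inter> J"
  shows "cinner (T (fvec s)) (fvec t) = 0"
proof -
  obtain l where l: "l \<in> J" "l \<in> set s \<longleftrightarrow> l \<notin> set t"
    using st by blast
  then have lL: "l \<in> L"
    using J by blast
  have "cinner (T (cre l (ann l (fvec s)))) (fvec t) = cinner (T (fvec s)) (cre l (ann l (fvec t)))"
    using comD [OF T l(1)] by (simp add: cinner_cre_left cinner_ann_left)
  then show ?thesis
    using l(2) by (auto simp: number_fvec [OF s lL] number_fvec [OF t lL] cinner_simps split: if_splits)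
qed

text \<open>\<open>T\<close> commutes with the number operators of \<open>J\<close>, so \<open>T (fvec s)\<close> and \<open>fvec t\<close> overlap only if \<open>s\<close>
  and \<open>t\<close> have the same entries in \<open>J\<close>; hence \<open>T \<zeta> = 0\<close> decouples into \<open>T (fvec (g s)) = 0\<close>.\<close>

lemma com_separating:
  assumes J: "J \<subseteq> L" and T: "T \<in> com J" and zero: "T \<zeta> = 0"
    and sum: "((\<lambda>s. r s *\<^sub>R fvec (g s)) has_sum \<zeta>) S"
    and r: "\<And>s. s \<in> S \<Longrightarrow> r s \<noteq> 0"
    and g: "\<And>s. s \<in> S \<Longrightarrow> g s \<in> lists L" "\<And>s. s \<in> S \<Longrightarrow> distinct (g s)"
    and inj: "\<And>s s'. s \<in> S \<Longrightarrow> s' \<in> S \<Longrightarrow> set (g s) \<inter> J = set (g s') \<inter> J \<Longrightarrow> s = s'"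
    and surj: "\<And>F. finite F \<Longrightarrow> F \<subseteq> L - J \<Longrightarrow> \<exists>s\<in>S. set (g s) - J = F"
  shows "T = 0"
proof -
  have Tg: "T (fvec (g s)) = 0" if s: "s \<in> S" for s
  proof (rule eq_zero_of_orthogonal_total [OF total_fvec])
    fix x assume "x \<in> fvec ` {s \<in> lists L. distinct s}"
    then obtain t where t: "x = fvec t" "t \<in> lists L" "distinct t"
      by blast
    have "cinner (T (fvec (g s))) (fvec t) = 0"
    proof (cases "set (g s) \<inter> J = set t \<inter> J")
      case False
      then show ?thesis
        using J T g [OF s] t(2,3) by (intro com_matrix_zero)
    next
      case True
      have "bounded_linear (\<lambda>x. cinner (T x) (fvec t))"
        by (rule bounded_linear_compose [OF cinner.bounded_linear_left blinfun.bounded_linear_right])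
      then have "((\<lambda>s. cinner (T (r s *\<^sub>R fvec (g s))) (fvec t)) has_sum cinner (T \<zeta>) (fvec t)) S"
        using sum by (rule has_sum_bounded_linear)
      moreover have "((\<lambda>s. cinner (T (r s *\<^sub>R fvec (g s))) (fvec t))
          has_sum cinner (T (r s *\<^sub>R fvec (g s))) (fvec t)) S"
      proof (rule has_sum_finite_neutralI [of "{s}"])
        fix s' assume s': "s' \<in> S - {s}"
        then have "set (g s') \<inter> J \<noteq> set t \<inter> J"
          using inj [OF _ s, of s'] True by auto
        then have "cinner (T (fvec (g s'))) (fvec t) = 0"
          using s' by (intro com_matrix_zero [OF J T] g t) auto
        then show "cinner (T (r s' *\<^sub>R fvec (g s'))) (fvec t) = 0"
          by (simp add: blinfun.scaleR_right cinner.scaleR_left)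
      qed (use s in auto)
      ultimately have "cinner (T (r s *\<^sub>R fvec (g s))) (fvec t) = cinner (T \<zeta>) (fvec t)"
        using has_sum_unique by blast
      then show ?thesis
        using r [OF s] by (simp add: zero blinfun.scaleR_right cinner.scaleR_left cinner_simps)
    qed
    then have "cinner (T (fvec (g s))) x = 0"
      by (simp add: t)
    then show "cinner x (T (fvec (g s))) = 0"
      by (subst cinner_commute) simp
  qed
  \<comment> \<open>Ladder operators of \<open>J\<close> commute with \<open>T\<close>, so the
    vanishing of \<open>T\<close> passes between lists that agree outside \<open>J\<close>; in this
    way every list is reached from some \<open>g s\<close>.\<close>
  have strip: "T (fvec t) = 0"
    if "s \<in> lists J" "s @ t \<in> lists L" "distinct (s @ t)" "T (fvec (s @ t)) = 0" for s t
    using that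
  proof (induction s)
    case (Cons l s)
    have "ann l (fvec (l # s @ t)) = fvec (s @ t)"
      using Cons.prems J Cons.hyps by (intro ann_fvec_Cons) auto
    then have "T (fvec (s @ t)) = ann l (T (fvec (l # s @ t)))"
      using comD(1) [OF T, of l "fvec (l # s @ t)"] Cons by auto
    then show ?case
      using Cons by (intro Cons.IH) auto
  qed simp
  have extend: "T (fvec (s @ t)) = 0" if "s \<in> lists J" "T (fvec t) = 0" for s t
    using that
  proof (induction s)
    case (Cons l s)
    then show ?case
      using comD(2) [OF T, of l "fvec (s @ t)"] by (simp add: cre_fvec)
  qed simp
  show ?thesis
  proof (rule op_eqI_fvec)
    show "T \<in> bounded_ops" "0 \<in> bounded_ops"
      using T com_bounded by auto
    fix t assume t: "t \<in> lists L" "distinct t"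
    define t1 where "t1 = filter (\<lambda>l. l \<in> J) t"
    define t2 where "t2 = filter (\<lambda>l. l \<notin> J) t"
    have "finite (set t - J)" "set t - J \<subseteq> L - J"
      using t by auto
    then obtain s where s: "s \<in> S" "set (g s) - J = set t - J"
      using surj by blast
    define s1 where "s1 = filter (\<lambda>l. l \<in> J) (g s)"
    have "set t2 = set (g s) - J"
      unfolding s(2) by (auto simp: t2_def)
    then have "set (g s) = set (s1 @ t2)"
      by (auto simp: s1_def)
    moreover have dist: "distinct (s1 @ t2)"
      using g(2) [OF s(1)] t(2) by (auto simp: s1_def t2_def)
    ultimately have "fvec (g s) = fvec (s1 @ t2) \<or> fvec (g s) = - fvec (s1 @ t2)"
      using g(2) [OF s(1)] by (intro fvec_perm_distinct)
    then have "T (fvec (s1 @ t2)) = 0"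
      using Tg [OF s(1)] by (auto simp: blinfun.minus_right)
    then have "T (fvec t2) = 0"
      by (rule strip [rotated -1]) (use dist g(1) [OF s(1)] t in \<open>auto simp: s1_def t2_def\<close>)
    then have "T (fvec (t1 @ t2)) = 0"
      by (intro extend) (auto simp: t1_def)
    moreover have "fvec t = fvec (t1 @ t2) \<or> fvec t = - fvec (t1 @ t2)"
      by (rule fvec_perm_distinct) (use t in \<open>auto simp: t1_def t2_def\<close>)
    ultimately show "T (fvec t) = (0 :: 'f op) (fvec t)"
      by (auto simp: blinfun.minus_right)
  qed
qed

lemma fock_vector_eq: "fock_vector w cr e s = fvec s"
  by (induction s) (simp_all add: fock_vector_def fvec_def cr_w)

end

lemma ordering_systemD:
  assumes "ordering_system J S"
  shows "s \<in> S \<Longrightarrow> distinct s" "s \<in> S \<Longrightarrow> set s \<subseteq> J"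
    "s \<in> S \<Longrightarrow> t \<in> S \<Longrightarrow> set s = set t \<Longrightarrow> s = t"
    "finite F \<Longrightarrow> F \<subseteq> J \<Longrightarrow> \<exists>s\<in>S. set s = F"
proof -
  have bij: "bij_betw set S {F. F \<subseteq> J \<and> finite F}"
    using assms by (simp add: ordering_system_def)
  show "s \<in> S \<Longrightarrow> distinct s"
    using assms by (simp add: ordering_system_def)
  show "s \<in> S \<Longrightarrow> set s \<subseteq> J"
    using bij_betwE [OF bij] by blast
  show "s \<in> S \<Longrightarrow> t \<in> S \<Longrightarrow> set s = set t \<Longrightarrow> s = t"
    using bij_betw_imp_inj_on [OF bij] by (auto dest: inj_onD)
  show "finite F \<Longrightarrow> F \<subseteq> J \<Longrightarrow> \<exists>s\<in>S. set s = F"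
    using bij_betw_imp_surj_on [OF bij] by (metis (mono_tags, lifting) imageE mem_Collect_eq)
qed

locale fock_entangled = fock_parity w cr L e \<Gamma>
  for w :: "'h :: complex_hilbert_space list \<Rightarrow> 'f :: complex_hilbert_space"
    and cr :: "'h \<Rightarrow> 'f op" and L :: "'l set" and e :: "'l \<Rightarrow> 'h" and \<Gamma> :: "'f op" +
  fixes I :: "'l set" and S :: "'l list set" and \<iota> :: "'l \<Rightarrow> 'l" and p :: "'l list \<Rightarrow> real"
  assumes I: "I \<subseteq> L" and S: "ordering_system I S" and \<iota>: "bij_betw \<iota> I (L - I)"
    and p_pos: "\<And>s. s \<in> S \<Longrightarrow> p s > 0" and p_sum: "p summable_on S"
begin

definition \<zeta> :: 'f where "\<zeta> = entangled_vector fvec \<iota> p S"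

lemma \<iota>_image: "\<iota> ` I = L - I"
  using \<iota> by (rule bij_betw_imp_surj_on)

lemma \<iota>_inj: "inj_on \<iota> I"
  using \<iota> by (rule bij_betw_imp_inj_on)

lemma pair_list:
  assumes s: "s \<in> S"
  shows "s @ map \<iota> s \<in> lists L" "distinct (s @ map \<iota> s)"
    "set (s @ map \<iota> s) \<inter> I = set s" "set (s @ map \<iota> s) - I = \<iota> ` set s"
proof -
  have set: "set s \<subseteq> I" and \<iota>s: "\<iota> ` set s \<subseteq> L - I"
    using ordering_systemD(2) [OF S s] \<iota>_image by auto
  show "s @ map \<iota> s \<in> lists L"
    using set \<iota>s I by (auto simp: image_subset_iff)
  show "distinct (s @ map \<iota> s)"
    using set \<iota>s ordering_systemD(1) [OF S s] inj_on_subset [OF \<iota>_inj set]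
    by (auto simp: distinct_map)
  show "set (s @ map \<iota> s) \<inter> I = set s" "set (s @ map \<iota> s) - I = \<iota> ` set s"
    using set \<iota>s by auto
qed

text \<open>The infinite sum in \<open>entangled_vector\<close> would default to 0 without
  convergence. Here the summands are orthogonal with squared norms \<open>p s\<close>.\<close>

lemma has_sum_\<zeta>: "((\<lambda>s. sqrt (p s) *\<^sub>R fvec (s @ map \<iota> s)) has_sum \<zeta>) S"
proof -
  have "(\<lambda>s. sqrt (p s) *\<^sub>R fvec (s @ map \<iota> s)) summable_on S"
  proof (rule summable_on_orthogonal)
    show "inner (sqrt (p s) *\<^sub>R fvec (s @ map \<iota> s)) (sqrt (p t) *\<^sub>R fvec (t @ map \<iota> t)) = 0"
      if st: "s \<in> S" "t \<in> S" "s \<noteq> t" for s t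
    proof -
      have "set s \<noteq> set t"
        using ordering_systemD(3) [OF S st(1,2)] st(3) by blast
      then have ne: "set (s @ map \<iota> s) \<inter> I \<noteq> set (t @ map \<iota> t) \<inter> I"
        unfolding pair_list(3) [OF st(1)] pair_list(3) [OF st(2)] .
      have "id_blinfun \<in> com I"
        unfolding com_def by (rule commutant_id)
      from com_matrix_zero [OF I this pair_list(1,2) [OF st(1)] pair_list(1,2) [OF st(2)] ne]
      have "cinner (fvec (s @ map \<iota> s)) (fvec (t @ map \<iota> t)) = 0"
        by simp
      then show ?thesis
        by (simp add: inner_eq_Re_cinner cinner.scaleR_left cinner.scaleR_right)
    qed
    have "(norm (sqrt (p s) *\<^sub>R fvec (s @ map \<iota> s)))\<^sup>2 = p s" if "s \<in> S" for s
    proof -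
      have "complex_of_real ((norm (fvec (s @ map \<iota> s)))\<^sup>2) = 1"
        using fvec_normalized [OF pair_list(1,2) [OF that]] by (simp only: cinner_same)
      then have "(norm (fvec (s @ map \<iota> s)))\<^sup>2 = 1"
        using of_real_eq_1_iff by blast
      then show ?thesis
        using p_pos [OF that] by (simp add: power_mult_distrib)
    qed
    then show "(\<lambda>s. (norm (sqrt (p s) *\<^sub>R fvec (s @ map \<iota> s)))\<^sup>2) summable_on S"
      using p_sum summable_on_cong by force
  qed
  then show ?thesis
    unfolding \<zeta>_def entangled_vector_def by (rule has_sum_infsum)
qed

text \<open>Each list \<open>s @ map \<iota> s\<close> has even length.\<close>

lemma Gamma_\<zeta>: "\<Gamma> \<zeta> = \<zeta>"
proof -
  have "((\<lambda>s. \<Gamma> (sqrt (p s) *\<^sub>R fvec (s @ map \<iota> s))) has_sum \<Gamma> \<zeta>) S"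
    by (rule has_sum_bounded_linear [OF blinfun.bounded_linear_right has_sum_\<zeta>])
  moreover have "\<Gamma> (sqrt (p s) *\<^sub>R fvec (s @ map \<iota> s)) = sqrt (p s) *\<^sub>R fvec (s @ map \<iota> s)"
    if "s \<in> S" for s
    using Gamma_fvec [OF pair_list(1) [OF that]] by (simp add: blinfun.scaleR_right)
  ultimately have "((\<lambda>s. sqrt (p s) *\<^sub>R fvec (s @ map \<iota> s)) has_sum \<Gamma> \<zeta>) S"
    using has_sum_cong by force
  then show ?thesis
    using has_sum_\<zeta> has_sum_unique by blast
qed

lemma separating_com_I:
  assumes "T \<in> com I" "T \<zeta> = 0"
  shows "T = 0"
proof (rule com_separating [OF I assms has_sum_\<zeta>])
  show "sqrt (p s) \<noteq> 0" if "s \<in> S" for s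
    using p_pos [OF that] by simp
  show "s = s'" if "s \<in> S" "s' \<in> S" "set (s @ map \<iota> s) \<inter> I = set (s' @ map \<iota> s') \<inter> I" for s s'
    using that(3) unfolding pair_list(3) [OF that(1)] pair_list(3) [OF that(2)]
    by (rule ordering_systemD(3) [OF S that(1,2)])
  show "\<exists>s\<in>S. set (s @ map \<iota> s) - I = F" if F: "finite F" "F \<subseteq> L - I" for F
  proof -
    obtain E where E: "E \<subseteq> I" "finite E" "F = \<iota> ` E"
      using F \<iota>_image finite_subset_image by metis
    then obtain s where "s \<in> S" "set s = E"
      using ordering_systemD(4) [OF S] by metis
    then show ?thesis
      using pair_list(4) E(3) by metis
  qed
qed (rule pair_list; assumption)+

text \<open>Mirror image of \<open>separating_com_I\<close>. There surjectivity of
  \<open>\<iota>\<close> produces every finite occupation of the complement; here its injectivity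
  recovers \<open>s\<close> from its image.\<close>

lemma separating_com_compl:
  assumes "T \<in> com (L - I)" "T \<zeta> = 0"
  shows "T = 0"
proof (rule com_separating [OF _ assms has_sum_\<zeta>])
  have set_eq: "set (s @ map \<iota> s) \<inter> (L - I) = \<iota> ` set s" "set (s @ map \<iota> s) - (L - I) = set s"
    if "s \<in> S" for s
    using pair_list [OF that] by auto
  show "L - I \<subseteq> L"
    by blast
  show "sqrt (p s) \<noteq> 0" if "s \<in> S" for s
    using p_pos [OF that] by simp
  show "s = s'"
    if "s \<in> S" "s' \<in> S" "set (s @ map \<iota> s) \<inter> (L - I) = set (s' @ map \<iota> s') \<inter> (L - I)" for s s'
  proof -
    have "\<iota> ` set s = \<iota> ` set s'"
      using that(3) unfolding set_eq [OF that(1)] set_eq [OF that(2)] .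
    then have "set s = set s'"
      using inj_on_image_eq_iff [OF \<iota>_inj] ordering_systemD(2) [OF S] that(1,2) by metis
    then show ?thesis
      by (rule ordering_systemD(3) [OF S that(1,2)])
  qed
  show "\<exists>s\<in>S. set (s @ map \<iota> s) - (L - I) = F" if F: "finite F" "F \<subseteq> L - (L - I)" for F
  proof -
    have "F \<subseteq> I"
      using F(2) by blast
    then obtain s where "s \<in> S" "set s = F"
      using ordering_systemD(4) [OF S F(1)] by blast
    then show ?thesis
      using set_eq(2) by blast
  qed
qed (rule pair_list; assumption)+

lemma cyclic:
  "closure (orbit (lattice_algebra cr e I) \<zeta>) = UNIV"
  "closure (orbit (lattice_algebra cr e (L - I)) \<zeta>) = UNIV"
proof -
  have *: "closure (orbit (lattice_algebra cr e J) \<zeta>) = UNIV"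
    if "\<And>T. T \<in> com J \<Longrightarrow> T \<zeta> = 0 \<Longrightarrow> T = 0" for J
    unfolding lattice_algebra_eq
  proof (rule cyclic_of_separating [OF com_bounded com_adj])
    show "T = 0" if "T \<in> commutant (commutant (com J))" "T \<zeta> = 0" for T
      using that commutant_lattice_algebra [of J, unfolded lattice_algebra_eq]
        \<open>\<And>T. T \<in> com J \<Longrightarrow> T \<zeta> = 0 \<Longrightarrow> T = 0\<close> by simp
  qed
  show "closure (orbit (lattice_algebra cr e I) \<zeta>) = UNIV"
    by (rule *) (rule separating_com_I)
  show "closure (orbit (lattice_algebra cr e (L - I)) \<zeta>) = UNIV"
    by (rule *) (rule separating_com_compl)
qed

end

section \<open>Closure properties of von Neumann algebras and criteria for positivity\<close>

lemma von_neumann_algebra_double_commutant: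
  assumes C: "C \<subseteq> bounded_ops" "adj ` C \<subseteq> C"
  shows "von_neumann_algebra (commutant C)"
  unfolding von_neumann_algebra_def
  using triple_commutant [OF C(1)] adj_commutant [OF C] commutant_bounded_ops by blast

text \<open>All of these are properties of commutants, as \<open>M\<close> is the commutant of
  \<open>commutant M\<close>.\<close>

lemma
  fixes M :: "'a :: complex_hilbert_space op set"
  assumes M: "von_neumann_algebra M"
  shows vn_bounded: "a \<in> M \<Longrightarrow> a \<in> bounded_ops"
    and vn_adj: "a \<in> M \<Longrightarrow> adj a \<in> M"
    and vn_id: "id_blinfun \<in> M"
    and vn_add: "a \<in> M \<Longrightarrow> b \<in> M \<Longrightarrow> a + b \<in> M"
    and vn_diff: "a \<in> M \<Longrightarrow> b \<in> M \<Longrightarrow> a - b \<in> M"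
    and vn_scaleC: "a \<in> M \<Longrightarrow> scaleC_op k a \<in> M"
    and vn_compose: "a \<in> M \<Longrightarrow> b \<in> M \<Longrightarrow> a o\<^sub>L b \<in> M"
    and vn_double_commutant: "commutant (commutant M) = M"
proof -
  show MM: "commutant (commutant M) = M" and "a \<in> M \<Longrightarrow> a \<in> bounded_ops" "a \<in> M \<Longrightarrow> adj a \<in> M"
    using M by (auto simp: von_neumann_algebra_def)
  have C: "commutant M \<subseteq> bounded_ops"
    by (auto intro: commutant_bounded_ops)
  show "id_blinfun \<in> M" "a \<in> M \<Longrightarrow> b \<in> M \<Longrightarrow> a + b \<in> M" "a \<in> M \<Longrightarrow> b \<in> M \<Longrightarrow> a - b \<in> M"
    "a \<in> M \<Longrightarrow> scaleC_op k a \<in> M" "a \<in> M \<Longrightarrow> b \<in> M \<Longrightarrow> a o\<^sub>L b \<in> M"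
    using commutant_id [of "commutant M"] commutant_add [OF _ _ C, of a b]
      commutant_diff [OF _ _ C, of a b] commutant_scaleC_op [OF _ C, of a k]
      commutant_compose [of a "commutant M" b] by (simp_all add: MM)
qed

lemma von_neumann_algebra_commutant:
  assumes "von_neumann_algebra M"
  shows "von_neumann_algebra (commutant M)"
  using assms
  by (intro von_neumann_algebra_double_commutant) (auto intro: vn_bounded vn_adj)

lemma positive_op_iff_matrix:
  fixes T :: "'a :: complex_hilbert_space op"
  shows "positive_op T \<longleftrightarrow> positive_matrix 1 (\<lambda>_ _. T)"
proof -
  have "(\<forall>x. cinner (T x) x \<in> \<real>\<^sub>\<ge>\<^sub>0) \<longleftrightarrow> (\<forall>v :: nat \<Rightarrow> 'a. cinner (T (v 0)) (v 0) \<in> \<real>\<^sub>\<ge>\<^sub>0)"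
    (is "?P \<longleftrightarrow> ?Q")
  proof
    assume ?Q
    show ?P
    proof
      fix x
      show "cinner (T x) x \<in> \<real>\<^sub>\<ge>\<^sub>0"
        using \<open>?Q\<close> [rule_format, of "\<lambda>_. x"] .
    qed
  qed simp
  then show ?thesis
    by (simp add: positive_op_def positive_matrix_def)
qed

text \<open>Makes positivity of the dual map the case \<open>n = 1\<close> of its
  \<open>n\<close>-positivity.\<close>

lemma positive_map_iff: "positive_map M T \<longleftrightarrow> n_positive_map 1 M T"
proof
  assume *: "positive_map M T"
  show "n_positive_map 1 M T"
    unfolding n_positive_map_def
  proof (intro allI impI, elim conjE)
    fix X :: "nat \<Rightarrow> nat \<Rightarrow> 'a op"
    assume X: "\<forall>i<1. \<forall>j<1. X i j \<in> M" "positive_matrix 1 X"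
    then have "positive_op (X 0 0)" "X 0 0 \<in> M"
      by (auto simp: positive_op_iff_matrix positive_matrix_def)
    then have "positive_op (T (X 0 0))"
      using * by (simp add: positive_map_def)
    then show "positive_matrix 1 (\<lambda>i j. T (X i j))"
      by (simp add: positive_op_iff_matrix positive_matrix_def)
  qed
next
  assume *: "n_positive_map 1 M T"
  show "positive_map M T"
    unfolding positive_map_def positive_op_iff_matrix
    using *[unfolded n_positive_map_def, rule_format, of "\<lambda>_ _. x" for x] by blast
qed

text \<open>The quadratic form at \<open>v\<close> is the squared norm of the sum of the vectors
  \<open>a j (v j)\<close>.\<close>

lemma positive_matrix_gram:
  assumes "\<And>i. i < n \<Longrightarrow> a i \<in> bounded_ops"
  shows "positive_matrix n (\<lambda>i j. adj (a i) o\<^sub>L a j)"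
  unfolding positive_matrix_def
proof
  fix v
  have "(\<Sum>i<n. \<Sum>j<n. cinner ((adj (a i) o\<^sub>L a j) (v j)) (v i))
      = (\<Sum>i<n. \<Sum>j<n. cinner (a j (v j)) (a i (v i)))"
    by (intro sum.cong refl) (simp add: assms cinner_adj_left)
  also have "\<dots> = cinner (\<Sum>j<n. a j (v j)) (\<Sum>i<n. a i (v i))"
    by (simp add: cinner.sum_left cinner.sum_right)
  finally show "(\<Sum>i<n. \<Sum>j<n. cinner ((adj (a i) o\<^sub>L a j) (v j)) (v i)) \<in> \<real>\<^sub>\<ge>\<^sub>0"
    by (simp add: cinner_same)
qed

lemma total_set_of_dense: "closure W = UNIV \<Longrightarrow> total_set W"
  unfolding total_set_iff using closure_minimal by (metis top.extremum_uniqueI)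

lemma commuting_positive_ops:
  fixes X b :: "'a :: complex_hilbert_space op"
  assumes "b \<in> bounded_ops" "positive_op b" "positive_op X" "\<And>x. b (X x) = X (b x)"
  shows "cinner (X (b \<zeta>)) \<zeta> \<in> \<real>\<^sub>\<ge>\<^sub>0"
  using commuting_positive_matrices [of 1 "\<lambda>_ _. b" "\<lambda>_ _. X" \<zeta>] assms
  by (simp add: positive_op_iff_matrix)

text \<open>Serves both to bound a positive operator by its norm and to write a Hermitian one as a
  difference of positive ones.\<close>

lemma positive_op_norm_plus:
  assumes h: "h \<in> bounded_ops" "adj h = h"
  shows "positive_op (scaleC_op (of_real (norm h)) id_blinfun + h)"
    "positive_op (scaleC_op (of_real (norm h)) id_blinfun - h)"
proof -
  have real: "Im (cinner (h x) x) = 0" for x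
    using cinner_adj_left [OF h(1), of x x] cinner_commute [of "h x" x] h(2)
    by (simp add: complex_eq_iff)
  have bound: "\<bar>Re (cinner (h x) x)\<bar> \<le> norm h * (norm x)\<^sup>2" for x
  proof -
    have "\<bar>Re (cinner (h x) x)\<bar> \<le> norm (h x) * norm x"
      using abs_Re_le_cmod cmod_cinner_le by (rule order_trans)
    also have "\<dots> \<le> norm h * norm x * norm x"
      by (intro mult_right_mono norm_blinfun) simp
    finally show ?thesis
      by (simp add: power2_eq_square)
  qed
  have "0 \<le> norm h * (norm x)\<^sup>2 + Re (cinner (h x) x)" "0 \<le> norm h * (norm x)\<^sup>2 - Re (cinner (h x) x)"
    for x
    using bound [of x] by linarith+
  then show "positive_op (scaleC_op (of_real (norm h)) id_blinfun + h)"
    "positive_op (scaleC_op (of_real (norm h)) id_blinfun - h)"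
    using real
    by (simp_all add: positive_op_def nonneg_Reals_iff_Re blinfun.add_left blinfun.diff_left
        cinner_simps cinner_same)
qed

section \<open>Dual maps\<close>

text \<open>On the orbit, \<open>\<psi>\<close> defines a sesquilinear form whose value at
  \<open>a \<zeta>\<close> and \<open>b \<zeta>\<close> is
  \<open>\<psi> (adj b o\<^sub>L a)\<close>. Positivity and domination make it bounded, hence the
  form of an operator \<open>T\<close>, and moving factors of \<open>M\<close> across the form shows
  that \<open>T\<close> commutes with \<open>M\<close>.\<close>

lemma radon_nikodym:
  fixes M :: "'a :: complex_hilbert_space op set" and \<psi> :: "'a op \<Rightarrow> complex"
  assumes M: "von_neumann_algebra M"
    and cyclic: "closure (orbit M \<zeta>) = UNIV"
    and sep: "\<And>a. a \<in> M \<Longrightarrow> a \<zeta> = 0 \<Longrightarrow> a = 0"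
    and add: "\<And>a b. a \<in> M \<Longrightarrow> b \<in> M \<Longrightarrow> \<psi> (a + b) = \<psi> a + \<psi> b"
    and scale: "\<And>k a. a \<in> M \<Longrightarrow> \<psi> (scaleC_op k a) = k * \<psi> a"
    and pos: "\<And>a. a \<in> M \<Longrightarrow> \<psi> (adj a o\<^sub>L a) \<in> \<real>\<^sub>\<ge>\<^sub>0"
    and dom: "\<And>a. a \<in> M \<Longrightarrow> Re (\<psi> (adj a o\<^sub>L a)) \<le> K * (norm (a \<zeta>))\<^sup>2"
    and K: "0 \<le> K"
  shows "\<exists>c\<in>commutant M. \<forall>a\<in>M. \<psi> a = cinner (a (c \<zeta>)) \<zeta>"
proof -
  note bounded = vn_bounded [OF M] and compose = vn_compose [OF M] and adjM = vn_adj [OF M]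
  define W where "W = orbit M \<zeta>"
  have W: "csubspace W"
    unfolding W_def using csubspace_orbit [of "commutant M" \<zeta>] vn_double_commutant [OF M]
    by (metis commutant_bounded_ops subsetI)
  have total: "total_set W"
    using cyclic unfolding W_def by (rule total_set_of_dense)
  have "\<exists>a\<in>M. a \<zeta> = x" if "x \<in> W" for x
    using that by (auto simp: W_def orbit_def)
  \<comment> \<open>As \<open>\<zeta>\<close> is separating, \<open>\<alpha> x\<close> is the only
    element of \<open>M\<close> carrying \<open>\<zeta>\<close> to \<open>x\<close>, so this choice
    is automatically linear.\<close>
  then obtain \<alpha> where \<alpha>: "\<And>x. x \<in> W \<Longrightarrow> \<alpha> x \<in> M" "\<And>x. x \<in> W \<Longrightarrow> \<alpha> x \<zeta> = x"
    by metis
  have \<alpha>_eq: "\<alpha> x = a" if "x \<in> W" "a \<in> M" "a \<zeta> = x" for x a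
    using sep [of "\<alpha> x - a"] that vn_diff [OF M] \<alpha> by (simp add: blinfun.diff_left)
  have \<alpha>_add: "\<alpha> (x + y) = \<alpha> x + \<alpha> y" if "x \<in> W" "y \<in> W" for x y
    using that by (intro \<alpha>_eq csubspace_add [OF W] vn_add [OF M] \<alpha>) (simp_all add: blinfun.add_left \<alpha>)
  have \<alpha>_scale: "\<alpha> (k *\<^sub>C x) = scaleC_op k (\<alpha> x)" if "x \<in> W" for k x
    using that by (intro \<alpha>_eq csubspace_scaleC [OF W] vn_scaleC [OF M] \<alpha>) (simp_all add: \<alpha>)
  define q where "q x y = \<psi> (adj (\<alpha> y) o\<^sub>L \<alpha> x)" for x y
  have q_add_left: "q (u + v) y = q u y + q v y" if "u \<in> W" "v \<in> W" "y \<in> W" for u v y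
  proof -
    have "adj (\<alpha> y) o\<^sub>L \<alpha> (u + v) = (adj (\<alpha> y) o\<^sub>L \<alpha> u) + (adj (\<alpha> y) o\<^sub>L \<alpha> v)"
      using that by (intro blinfun_eqI) (simp add: \<alpha>_add blinfun.add_left blinfun.add_right)
    then show ?thesis
      using that by (simp add: q_def add compose adjM \<alpha>)
  qed
  have q_add_right: "q y (u + v) = q y u + q y v" if "u \<in> W" "v \<in> W" "y \<in> W" for u v y
  proof -
    have "adj (\<alpha> (u + v)) o\<^sub>L \<alpha> y = (adj (\<alpha> u) o\<^sub>L \<alpha> y) + (adj (\<alpha> v) o\<^sub>L \<alpha> y)"
      using that by (intro blinfun_eqI) (simp add: \<alpha>_add adj_add bounded \<alpha> blinfun.add_left)
    then show ?thesis
      using that by (simp add: q_def add compose adjM \<alpha>)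
  qed
  have q_scale_left: "q (k *\<^sub>C u) y = k * q u y" if "u \<in> W" "y \<in> W" for k u y
  proof -
    have "adj (\<alpha> y) o\<^sub>L \<alpha> (k *\<^sub>C u) = scaleC_op k (adj (\<alpha> y) o\<^sub>L \<alpha> u)"
      using that
      by (intro blinfun_eqI) (simp add: \<alpha>_scale bounded_ops_scaleC [OF bounded] adjM \<alpha>)
    then show ?thesis
      using that by (simp add: q_def scale compose adjM \<alpha>)
  qed
  have q_scale_right: "q y (k *\<^sub>C u) = cnj k * q y u" if "u \<in> W" "y \<in> W" for k u y
  proof -
    have "adj (\<alpha> (k *\<^sub>C u)) o\<^sub>L \<alpha> y = scaleC_op (cnj k) (adj (\<alpha> u) o\<^sub>L \<alpha> y)"
      using that by (intro blinfun_eqI) (simp add: \<alpha>_scale adj_scaleC_op bounded \<alpha>)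
    then show ?thesis
      using that by (simp add: q_def scale compose adjM \<alpha>)
  qed
  have q_nonneg: "q u u \<in> \<real>\<^sub>\<ge>\<^sub>0" if "u \<in> W" for u
    unfolding q_def using that by (intro pos \<alpha>)
  have q_dom: "Re (q u u) \<le> K * (norm u)\<^sup>2" if "u \<in> W" for u
    unfolding q_def using dom [OF \<alpha>(1) [OF that]] by (simp add: \<alpha>(2) [OF that])
  have q_bound: "cmod (q x y) \<le> K * norm x * norm y" if "x \<in> W" "y \<in> W" for x y
    by (rule positive_form_bound [OF W q_add_left q_add_right q_scale_left q_scale_right q_nonneg
          q_dom that])
  have "\<exists>s. \<forall>x\<in>W. q x y = cinner x s" if y: "y \<in> W" for y
  proof -
    have bound: "cmod (q x y) \<le> (K * norm y) * norm x" if "x \<in> W" for x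
      using q_bound [OF that y] by (simp add: mult_ac)
    show ?thesis
      by (rule riesz [of W "\<lambda>x. q x y" "K * norm y",
            OF W q_add_left [OF _ _ y] q_scale_left [OF _ y] bound]) auto
  qed
  then obtain Q where Q: "\<And>x y. x \<in> W \<Longrightarrow> y \<in> W \<Longrightarrow> q x y = cinner x (Q y)"
    by metis
  have eqI: "u = v" if "\<And>x. x \<in> W \<Longrightarrow> cinner x u = cinner x v" for u v
    using eq_zero_of_orthogonal_total [OF total, of "u - v"] that by (simp add: cinner_simps)
  have Q_add: "Q (x + y) = Q x + Q y" if "x \<in> W" "y \<in> W" for x y
  proof (rule eqI)
    show "cinner z (Q (x + y)) = cinner z (Q x + Q y)" if z: "z \<in> W" for z
      using q_add_right [OF \<open>x \<in> W\<close> \<open>y \<in> W\<close> z] Q [OF z] csubspace_add [OF W] \<open>x \<in> W\<close> \<open>y \<in> W\<close>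
      by (simp add: cinner_add_right)
  qed
  have Q_scale: "Q (k *\<^sub>C x) = k *\<^sub>C Q x" if "x \<in> W" for k x
  proof (rule eqI)
    show "cinner z (Q (k *\<^sub>C x)) = cinner z (k *\<^sub>C Q x)" if z: "z \<in> W" for z
      using q_scale_right [OF \<open>x \<in> W\<close> z, of k] Q [OF z] csubspace_scaleC [OF W] \<open>x \<in> W\<close>
      by (simp add: cinner_scaleC_right)
  qed
  have Q_norm: "norm (Q y) \<le> K * norm y" if y: "y \<in> W" for y
  proof (rule norm_le_of_cinner_bound [of _ W])
    show "Q y \<in> closure W"
      using cyclic by (simp add: W_def)
    show "cmod (cinner x (Q y)) \<le> K * norm y * norm x" if "x \<in> W" for x
      using q_bound [OF that y] Q [OF that y] by (simp add: mult_ac)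
  qed (simp add: K)
  \<comment> \<open>\<open>Q\<close> is controlled on the orbit only; taking its adjoint as a form
    produces an operator defined everywhere.\<close>
  obtain T where T: "T \<in> bounded_ops" "\<And>y v. y \<in> W \<Longrightarrow> cinner (Q y) v = cinner y (T v)"
  proof (rule operator_of_form [OF W, of "\<lambda>v y. cinner (Q y) v" K])
    show "cmod (cinner (Q x) v) \<le> K * norm v * norm x" if "x \<in> W" for v x
    proof -
      have "cmod (cinner (Q x) v) \<le> norm (Q x) * norm v"
        by (rule cmod_cinner_le)
      also have "\<dots> \<le> K * norm x * norm v"
        using Q_norm [OF that] by (rule mult_right_mono) simp
      finally show ?thesis
        by (simp add: mult_ac)
    qed
    show thesis if "T \<in> bounded_ops" "\<And>v x. x \<in> W \<Longrightarrow> cinner (Q x) v = cinner x (T v)" for T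
      using that by (rule \<open>\<And>T. T \<in> bounded_ops \<Longrightarrow> (\<And>y v. y \<in> W \<Longrightarrow> cinner (Q y) v = cinner y (T v)) \<Longrightarrow> thesis\<close>)
  qed (simp_all add: Q_add Q_scale cinner_simps K)
  have T_form: "cinner (T x) y = q x y" if "x \<in> W" "y \<in> W" for x y
    using T(2) [OF that(2), of x] Q [OF that] cinner_commute by metis
  have T_M: "T \<in> commutant M"
  proof (rule commutantI)
    show "T \<in> bounded_ops"
      by (rule T(1))
    fix a x assume a: "a \<in> M"
    have "T o\<^sub>L a = a o\<^sub>L T"
    proof (rule op_eqI_total [OF _ _ total])
      fix x assume x: "x \<in> W"
      have ax: "a x \<in> W" "\<alpha> (a x) = a o\<^sub>L \<alpha> x"
      proof -
        have "(a o\<^sub>L \<alpha> x) \<zeta> = a x" "a o\<^sub>L \<alpha> x \<in> M"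
          using x a \<alpha> compose by simp_all
        then show "a x \<in> W" "\<alpha> (a x) = a o\<^sub>L \<alpha> x"
          unfolding W_def using orbitI [of "a o\<^sub>L \<alpha> x" M \<zeta>] \<alpha>_eq [of "a x" "a o\<^sub>L \<alpha> x"]
          by (simp_all add: W_def)
      qed
      have "cinner y (T (a x)) = cinner y (a (T x))" if y: "y \<in> W" for y
      proof -
        have ay: "adj a y \<in> W" "\<alpha> (adj a y) = adj a o\<^sub>L \<alpha> y"
        proof -
          have "(adj a o\<^sub>L \<alpha> y) \<zeta> = adj a y" "adj a o\<^sub>L \<alpha> y \<in> M"
            using y a \<alpha> compose adjM by simp_all
          then show "adj a y \<in> W" "\<alpha> (adj a y) = adj a o\<^sub>L \<alpha> y"
            unfolding W_def using orbitI [of "adj a o\<^sub>L \<alpha> y" M \<zeta>] \<alpha>_eq [of "adj a y" "adj a o\<^sub>L \<alpha> y"]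
            by (simp_all add: W_def)
        qed
        \<comment> \<open>The same element of \<open>M\<close> is read in two ways, with
          \<open>a\<close> acting on the first vector or its adjoint on the second.\<close>
        have "adj (\<alpha> y) o\<^sub>L (a o\<^sub>L \<alpha> x) = adj (adj a o\<^sub>L \<alpha> y) o\<^sub>L \<alpha> x"
          using a y \<alpha> by (intro blinfun_eqI) (simp add: adj_compose bounded adjM)
        then have "cinner (T (a x)) y = q x (adj a y)"
          unfolding T_form [OF ax(1) y] q_def ax(2) ay(2) by simp
        also have "\<dots> = cinner (a (T x)) y"
          using T_form [OF x ay(1)] a by (simp add: cinner_adj_right bounded)
        finally show ?thesis
          by (metis cinner_commute)
      qed
      then show "(T o\<^sub>L a) x = (a o\<^sub>L T) x"
        using eqI by simp
    qed (simp_all add: bounded_ops_compose T a bounded)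
    then show "T (a x) = a (T x)"
      by (metis blinfun_apply_blinfun_compose)
  qed
  have "\<psi> a = cinner (a (T \<zeta>)) \<zeta>" if a: "a \<in> M" for a
  proof -
    have z: "\<zeta> \<in> W" "\<alpha> \<zeta> = id_blinfun"
      using orbitI [OF vn_id [OF M], of \<zeta>] \<alpha>_eq [of \<zeta> id_blinfun] vn_id [OF M]
      by (simp_all add: W_def)
    have az: "a \<zeta> \<in> W" "\<alpha> (a \<zeta>) = a"
      using orbitI [OF a] \<alpha>_eq [of "a \<zeta>" a] a by (simp_all add: W_def)
    have "cinner (a (T \<zeta>)) \<zeta> = cinner (T (a \<zeta>)) \<zeta>"
      using commutantD [OF T_M a] by simp
    also have "\<dots> = q (a \<zeta>) \<zeta>"
      by (rule T_form [OF az(1) z(1)])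
    also have "\<dots> = \<psi> (id_blinfun o\<^sub>L a)"
      by (simp add: q_def z az)
    also have "id_blinfun o\<^sub>L a = a"
      by (rule blinfun_eqI) simp
    finally show ?thesis
      by simp
  qed
  then show ?thesis
    using T_M by blast
qed

section \<open>Dual maps for an abstract twisted pair of algebras\<close>

text \<open>Collects what the duality argument takes from the Fock space, so that dual maps can be
  built without reference to sites or particles.\<close>

locale twisted_pair = parity \<Gamma>
  for \<Gamma> :: "'f :: complex_hilbert_space op" +
  fixes M N :: "'f op set" and \<zeta> :: 'f
  assumes M: "von_neumann_algebra M" and N: "von_neumann_algebra N"
    and Gamma_zeta: "\<Gamma> \<zeta> = \<zeta>"
    and gamma_M: "\<And>a. a \<in> M \<Longrightarrow> parity_automorphism \<Gamma> a \<in> M"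
    and gamma_N: "\<And>b. b \<in> N \<Longrightarrow> parity_automorphism \<Gamma> b \<in> N"
    and twist_N: "\<And>b. b \<in> N \<Longrightarrow> twist b \<in> commutant M"
    and untwist_M: "\<And>c. c \<in> commutant M \<Longrightarrow> untwist c \<in> N"
    and cyclic_M: "closure (orbit M \<zeta>) = UNIV" and cyclic_N: "closure (orbit N \<zeta>) = UNIV"
    and sep_M: "\<And>a. a \<in> M \<Longrightarrow> a \<zeta> = 0 \<Longrightarrow> a = 0"
begin

abbreviation "\<gamma> \<equiv> parity_automorphism \<Gamma>"
abbreviation "B \<equiv> vector_form \<zeta>"
abbreviation "\<phi> \<equiv> vector_state \<zeta>"

text \<open>The same formula as \<open>B\<close>, under a separate name for second arguments in the
  commutant of \<open>M\<close>, where positivity is available.\<close>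

definition B' :: "'f op \<Rightarrow> 'f op \<Rightarrow> complex" where
  "B' a c = cinner (a (c \<zeta>)) \<zeta>"

lemma B_eq: "B a b = cinner (a (b \<zeta>)) \<zeta>"
  by (simp add: vector_form_def vector_state_def)

lemma gamma_apply: "\<gamma> a x = \<Gamma> (a (\<Gamma> x))"
  by (simp add: parity_automorphism_def)

lemma gamma_gamma [simp]: "\<gamma> (\<gamma> a) = a"
  by (rule blinfun_eqI) (simp add: gamma_apply)

lemma cinner_V: "cinner (V x) y = cinner x (V' y)"
  and cinner_V': "cinner (V' x) y = cinner x (V y)"
  using cinner_adj_right [of V x y] cinner_adj_right [of V' x y] by simp_all

lemma B_gamma: "B (\<gamma> a) b = B a (\<gamma> b)"
  by (simp add: B_eq gamma_apply cinner_Gamma Gamma_zeta)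

lemma V'_zeta: "V' \<zeta> = (of_real (1 / sqrt 2) * (1 - \<i>)) *\<^sub>C \<zeta>"
proof -
  have "\<zeta> - \<i> *\<^sub>C \<zeta> = (1 - \<i>) *\<^sub>C \<zeta>"
    by (simp add: scaleC_diff_left)
  then show ?thesis
    by (simp only: V'_apply Gamma_zeta scaleC_scaleC)
qed

text \<open>Since \<open>\<zeta>\<close> is even, \<open>V'\<close> acts on it as the scalar
  \<open>(1 - \<i>) / sqrt 2\<close>; the other factor \<open>1 / sqrt 2\<close> comes from
  \<open>V\<close>.\<close>

lemma twist_zeta:
  assumes b: "b \<in> bounded_ops"
  shows "twist b \<zeta> = ((1 - \<i>) / 2) *\<^sub>C (b \<zeta> + \<i> *\<^sub>C \<Gamma> (b \<zeta>))"
proof -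
  have "complex_of_real (1 / sqrt 2) * of_real (1 / sqrt 2) = of_real (1 / sqrt 2 * (1 / sqrt 2))"
    by (simp only: of_real_mult)
  also have "\<dots> = 1 / 2"
    by simp
  finally have half: "complex_of_real (1 / sqrt 2) * of_real (1 / sqrt 2) = 1 / 2" .
  have "twist b \<zeta> = (of_real (1 / sqrt 2) * (1 - \<i>)) *\<^sub>C V (b \<zeta>)"
    unfolding twist_apply V'_zeta
    by (simp only: bounded_ops_scaleC [OF b] bounded_ops_scaleC [OF V_bounded])
  also have "\<dots> = (of_real (1 / sqrt 2) * (1 - \<i>) * of_real (1 / sqrt 2)) *\<^sub>C (b \<zeta> + \<i> *\<^sub>C \<Gamma> (b \<zeta>))"
    by (simp only: V_apply scaleC_scaleC)
  also have "complex_of_real (1 / sqrt 2) * (1 - \<i>) * of_real (1 / sqrt 2)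
      = (of_real (1 / sqrt 2) * of_real (1 / sqrt 2)) * (1 - \<i>)"
    by (simp only: mult_ac)
  finally show ?thesis
    by (simp only: half) simp
qed

lemma B'_twist:
  assumes a: "a \<in> bounded_ops" and b: "b \<in> bounded_ops"
  shows "B' a (twist b) = (1 - \<i>) / 2 * (B a b + \<i> * B (\<gamma> a) b)"
proof -
  have "cinner (a (\<Gamma> (b \<zeta>))) \<zeta> = B (\<gamma> a) b"
    by (simp add: B_eq gamma_apply cinner_Gamma Gamma_zeta)
  then show ?thesis
    unfolding B'_def twist_zeta [OF b]
    by (simp add: bounded_ops_scaleC [OF a] blinfun.add_right cinner_simps B_eq)
qed

lemma gamma_bounded: "a \<in> bounded_ops \<Longrightarrow> \<gamma> a \<in> bounded_ops"
  by (simp add: parity_automorphism_def bounded_ops_compose)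

text \<open>\<open>B'_twist\<close> at \<open>a\<close> and at \<open>\<gamma> a\<close> gives two
  linear equations for \<open>B a b\<close> and \<open>B (\<gamma> a) b\<close>; this solves
  them.\<close>

lemma B_eq_B'_twist:
  assumes a: "a \<in> bounded_ops" and b: "b \<in> bounded_ops"
  shows "B a b = (1 + \<i>) / 2 * (B' a (twist b) - \<i> * B' (\<gamma> a) (twist b))"
  unfolding B'_twist [OF assms] B'_twist [OF gamma_bounded [OF a] b] gamma_gamma
  by (simp add: algebra_simps add_divide_distrib diff_divide_distrib)

lemma sep_commutant: "c \<in> commutant M \<Longrightarrow> c \<zeta> = 0 \<Longrightarrow> c = 0"
proof -
  assume c: "c \<in> commutant M" "c \<zeta> = 0"
  show "c = 0"
  proof (rule op_eqI_total [OF _ _ total_set_of_dense [OF cyclic_M]])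
    fix x assume "x \<in> orbit M \<zeta>"
    then show "c x = (0 :: 'f op) x"
      by (rule orbitE) (use commutantD [OF c(1)] c(2) in simp)
  qed (use c commutant_bounded_ops in auto)
qed

lemma sep_N:
  assumes b: "b \<in> N" and zero: "b \<zeta> = 0"
  shows "b = 0"
proof -
  have "twist b \<zeta> = 0"
    using vn_bounded [OF N b] zero by (simp add: twist_zeta)
  then have "twist b = 0"
    by (intro sep_commutant twist_N b)
  then show ?thesis
    by (rule twist_eq_zero)
qed

lemma zeta_dense_eq_zero:
  assumes "closure (orbit A \<zeta>) = UNIV" and "\<And>a. a \<in> A \<Longrightarrow> cinner (a \<zeta>) y = 0"
  shows "y = 0"
  using total_set_of_dense [OF assms(1)]
  by (rule eq_zero_of_orthogonal_total) (auto simp: orbit_def assms(2))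

text \<open>Cyclicity for \<open>M\<close> fixes \<open>b \<zeta>\<close>, and
  \<open>\<zeta>\<close> separates \<open>N\<close>. Uniqueness of the dual among all maps rests on
  this, as do its linearity, unitality and evenness.\<close>

lemma B_nondegenerate_N:
  assumes b: "b \<in> N" "c \<in> N" and eq: "\<And>a. a \<in> M \<Longrightarrow> B a b = B a c"
  shows "b = c"
proof -
  have "(b - c) \<zeta> = 0"
  proof (rule zeta_dense_eq_zero [OF cyclic_M])
    fix a assume a: "a \<in> M"
    have "cinner ((b - c) \<zeta>) (a \<zeta>) = B (adj a) b - B (adj a) c"
      using vn_bounded [OF M a] by (simp add: B_eq cinner_adj_left blinfun.diff_left cinner_simps)
    also have "\<dots> = 0"
      using eq [OF vn_adj [OF M a]] by simp
    finally show "cinner (a \<zeta>) ((b - c) \<zeta>) = 0"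
      by (metis cinner_commute complex_cnj_zero)
  qed
  then have "b - c = 0"
    by (intro sep_N vn_diff [OF N] b)
  then show ?thesis
    by simp
qed

lemma B_nondegenerate_M:
  assumes a: "a \<in> M" "a' \<in> M" and eq: "\<And>b. b \<in> N \<Longrightarrow> B a b = B a' b"
  shows "a = a'"
proof -
  have "adj (a - a') \<zeta> = 0"
  proof (rule zeta_dense_eq_zero [OF cyclic_N])
    fix b assume b: "b \<in> N"
    have "cinner (b \<zeta>) (adj (a - a') \<zeta>) = B a b - B a' b"
      using vn_bounded [OF M vn_diff [OF M a]]
      by (simp add: B_eq cinner_adj_right blinfun.diff_left cinner_simps)
    then show "cinner (b \<zeta>) (adj (a - a') \<zeta>) = 0"
      using eq [OF b] by simp
  qed
  then have "adj (a - a') = 0"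
    by (intro sep_M vn_adj [OF M] vn_diff [OF M] a)
  then have "adj (adj (a - a')) = adj 0"
    by simp
  moreover have "adj (0 :: 'f op) = 0"
    by (rule adj_eqI) (simp add: cinner_simps)
  ultimately show ?thesis
    using vn_bounded [OF M vn_diff [OF M a]] by simp
qed

end

locale twisted_pair_map = twisted_pair \<Gamma> M N \<zeta>
  for \<Gamma> :: "'f :: complex_hilbert_space op" and M N :: "'f op set" and \<zeta> :: 'f +
  fixes \<Psi> :: "'f op \<Rightarrow> 'f op"
  assumes \<Psi>_M: "\<And>a. a \<in> M \<Longrightarrow> \<Psi> a \<in> M" and \<Psi>_linear: "linear_map_on M \<Psi>"
    and \<Psi>_positive: "positive_map M \<Psi>" and \<Psi>_even: "even_map \<gamma> M \<Psi>"
    and \<Psi>_state: "\<And>a. a \<in> M \<Longrightarrow> \<phi> (\<Psi> a) = \<phi> a"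
begin

lemma \<Psi>_add: "a \<in> M \<Longrightarrow> b \<in> M \<Longrightarrow> \<Psi> (a + b) = \<Psi> a + \<Psi> b"
  and \<Psi>_scale: "a \<in> M \<Longrightarrow> \<Psi> (scaleC_op k a) = scaleC_op k (\<Psi> a)"
  using \<Psi>_linear by (simp_all add: linear_map_on_def)

lemma \<Psi>_gamma: "a \<in> M \<Longrightarrow> \<Psi> (\<gamma> a) = \<gamma> (\<Psi> a)"
  using \<Psi>_even by (simp add: even_map_def)

lemma gram_positive: "a \<in> bounded_ops \<Longrightarrow> positive_op (adj a o\<^sub>L a)"
  by (simp add: positive_op_def cinner_adj_left cinner_same)

text \<open>The functional is positive since \<open>\<Psi> (adj a o\<^sub>L a)\<close> and
  \<open>b\<close> are commuting positive operators. The domination constant \<open>norm b\<close>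
  arises by applying the same fact to \<open>norm b - b\<close> and using that \<open>\<phi>\<close>
  is invariant under \<open>\<Psi>\<close>.\<close>

lemma dual_of_positive:
  assumes b: "b \<in> commutant M" and pos: "positive_op b"
  shows "\<exists>c\<in>commutant M. \<forall>a\<in>M. B' (\<Psi> a) b = B' a c"
proof -
  define \<psi> where "\<psi> a = B' (\<Psi> a) b" for a
  note bounded = vn_bounded [OF M]
  have bb: "b \<in> bounded_ops"
    using b by (rule commutant_bounded_ops)
  have gram: "\<Psi> (adj a o\<^sub>L a) \<in> M" "positive_op (\<Psi> (adj a o\<^sub>L a))" if a: "a \<in> M" for a
    using \<Psi>_positive vn_compose [OF M vn_adj [OF M a] a] gram_positive [OF bounded [OF a]]
    by (auto simp: positive_map_def intro: \<Psi>_M)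
  have "\<exists>c\<in>commutant M. \<forall>a\<in>M. \<psi> a = cinner (a (c \<zeta>)) \<zeta>"
  proof (rule radon_nikodym [OF M cyclic_M sep_M])
    show "\<psi> (x + y) = \<psi> x + \<psi> y" if "x \<in> M" "y \<in> M" for x y
      using that by (simp add: \<psi>_def B'_def \<Psi>_add blinfun.add_left cinner_simps)
    show "\<psi> (scaleC_op k x) = k * \<psi> x" if "x \<in> M" for k x
      using that by (simp add: \<psi>_def B'_def \<Psi>_scale cinner_simps)
    show "\<psi> (adj a o\<^sub>L a) \<in> \<real>\<^sub>\<ge>\<^sub>0" if a: "a \<in> M" for a
      unfolding \<psi>_def B'_def
      by (rule commuting_positive_ops [OF bb pos gram(2) [OF a]])
         (rule commutantD [OF b gram(1) [OF a]])
    show "Re (\<psi> (adj a o\<^sub>L a)) \<le> norm b * (norm (a \<zeta>))\<^sup>2" if a: "a \<in> M" for a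
    proof -
      define d where "d = scaleC_op (of_real (norm b)) id_blinfun - b"
      have d: "d \<in> bounded_ops" "positive_op d"
        using bb positive_op_norm_plus [OF bb positive_op_hermitian [OF bb pos]]
        by (simp_all add: d_def bounded_ops_diff bounded_ops_scaleC_op)
      define X where "X = \<Psi> (adj a o\<^sub>L a)"
      have X: "X \<in> M" "positive_op X" "X \<in> bounded_ops"
        using gram [OF a] bounded by (simp_all add: X_def)
      have "cinner (X (d \<zeta>)) \<zeta> \<in> \<real>\<^sub>\<ge>\<^sub>0"
      proof (rule commuting_positive_ops [OF d X(2)])
        show "d (X x) = X (d x)" for x
          using commutantD [OF b X(1)] bounded_ops_scaleC [OF X(3)]
          by (simp add: d_def blinfun.diff_left blinfun.diff_right)
      qed
      then have "Re (cinner (X (b \<zeta>)) \<zeta>) \<le> norm b * Re (cinner (X \<zeta>) \<zeta>)"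
        using bounded_ops_scaleC [OF X(3)]
        by (simp add: d_def blinfun.diff_left blinfun.diff_right cinner_simps nonneg_Reals_iff_Re)
      also have "cinner (X \<zeta>) \<zeta> = cinner (a \<zeta>) (a \<zeta>)"
        using \<Psi>_state [OF vn_compose [OF M vn_adj [OF M a] a]] bounded [OF a]
        by (simp add: X_def vector_state_def cinner_adj_left)
      finally show ?thesis
        by (simp add: \<psi>_def B'_def X_def cinner_same)
    qed
  qed auto
  then show ?thesis
    by (simp add: \<psi>_def B'_def)
qed

lemma B'_diff_right: "B' a (c - d) = B' a c - B' a d"
  and B'_scale_right: "a \<in> bounded_ops \<Longrightarrow> B' a (scaleC_op k c) = k * B' a c"
  by (simp_all add: B'_def blinfun.add_left blinfun.add_right blinfun.diff_left blinfun.diff_right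
      cinner_simps bounded_ops_scaleC)

text \<open>The elements with a dual partner are closed under differences and multiples, and such
  combinations of positive elements exhaust the commutant.\<close>

lemma dual_commutant_exists:
  assumes b: "b \<in> commutant M"
  shows "\<exists>c\<in>commutant M. \<forall>a\<in>M. B' (\<Psi> a) b = B' a c"
proof -
  let ?P = "\<lambda>b. \<exists>c\<in>commutant M. \<forall>a\<in>M. B' (\<Psi> a) b = B' a c"
  note M' = von_neumann_algebra_commutant [OF M]
  note bounded = vn_bounded [OF M]
  have diff: "?P (x - y)" if P: "?P x" "?P y" for x y
  proof -
    obtain c d where "c \<in> commutant M" "d \<in> commutant M"
      "\<forall>a\<in>M. B' (\<Psi> a) x = B' a c" "\<forall>a\<in>M. B' (\<Psi> a) y = B' a d"
      using P by blast
    then show ?thesis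
      by (intro bexI [of _ "c - d"]) (simp_all add: B'_diff_right vn_diff [OF M'])
  qed
  have scale: "?P (scaleC_op k x)" if P: "?P x" for k x
  proof -
    obtain c where "c \<in> commutant M" "\<forall>a\<in>M. B' (\<Psi> a) x = B' a c"
      using P by blast
    then show ?thesis
      by (intro bexI [of _ "scaleC_op k c"])
         (simp_all add: B'_scale_right bounded \<Psi>_M vn_scaleC [OF M'])
  qed
  have hermitian: "?P h" if h: "h \<in> commutant M" "adj h = h" for h
  proof -
    let ?k = "scaleC_op (of_real (norm h)) (id_blinfun :: 'f op)"
    have "positive_op ?k"
      by (simp add: positive_op_def cinner_simps cinner_same)
    then have "?P ?k"
      by (intro dual_of_positive vn_scaleC [OF M'] vn_id [OF M'])
    moreover have "?P (?k + h)"
      using positive_op_norm_plus(1) [OF vn_bounded [OF M' h(1)] h(2)]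
      by (intro dual_of_positive vn_add [OF M'] vn_scaleC [OF M'] vn_id [OF M'] h)
    ultimately have "?P ((?k + h) - ?k)"
      by (rule diff [rotated])
    then show ?thesis
      by simp
  qed
  define h1 where "h1 = b + adj b"
  \<comment> \<open>The factor \<open>\<i>\<close> makes the skew part Hermitian, and
    \<open>b\<close> is half of \<open>h1 - \<i> h2\<close>, a combination of exactly the two kinds
    covered by \<open>diff\<close> and \<open>scale\<close>.\<close>
  define h2 where "h2 = scaleC_op \<i> (b - adj b)"
  have bb: "b \<in> bounded_ops"
    using vn_bounded [OF M' b] .
  have "?P h1"
    unfolding h1_def
    by (rule hermitian) (use b bb in \<open>simp_all add: vn_add [OF M'] vn_adj [OF M'] adj_add add.commute\<close>)
  moreover have "?P h2"
    unfolding h2_def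
  proof (rule hermitian)
    show "scaleC_op \<i> (b - adj b) \<in> commutant M"
      using b by (intro vn_scaleC [OF M'] vn_diff [OF M'] vn_adj [OF M'])
    show "adj (scaleC_op \<i> (b - adj b)) = scaleC_op \<i> (b - adj b)"
      using bb by (simp add: adj_scaleC_op bounded_ops_diff adj_diff)
        (auto intro!: blinfun_eqI simp: blinfun.diff_left scaleC_diff_right scaleC_minus_left)
  qed
  ultimately have "?P (scaleC_op (1/2) (h1 - scaleC_op \<i> h2))"
    by (intro scale diff)
  moreover have "scaleC_op (1/2) (h1 - scaleC_op \<i> h2) = b"
  proof (rule blinfun_eqI)
    fix x
    have "2 *\<^sub>C b x = b x + b x"
      using scaleC_add_left [of 1 1 "b x"] by simp
    then have "scaleC_op (1/2) (h1 - scaleC_op \<i> h2) x = (1/2) *\<^sub>C 2 *\<^sub>C b x"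
      by (simp add: h1_def h2_def blinfun.add_left blinfun.diff_left scaleC_scaleC scaleC_minus_left)
    then show "scaleC_op (1/2) (h1 - scaleC_op \<i> h2) x = b x"
      by (simp add: scaleC_scaleC)
  qed
  ultimately show ?thesis
    by simp
qed

lemma dual_exists:
  assumes b: "b \<in> N"
  shows "\<exists>c\<in>N. \<forall>a\<in>M. B (\<Psi> a) b = B a c"
proof -
  obtain c where c: "c \<in> commutant M" "\<forall>a\<in>M. B' (\<Psi> a) (twist b) = B' a c"
    using dual_commutant_exists [OF twist_N [OF b]] by blast
  have uN: "untwist c \<in> N"
    by (rule untwist_M [OF c(1)])
  have "B (\<Psi> a) b = B a (untwist c)" if a: "a \<in> M" for a
  proof -
    have "\<gamma> (\<Psi> a) = \<Psi> (\<gamma> a)"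
      using \<Psi>_gamma [OF a] by simp
    then show ?thesis
      using c(2) a gamma_M [OF a]
      by (simp add: B_eq_B'_twist vn_bounded [OF M] vn_bounded [OF N] \<Psi>_M b uN)
  qed
  then show ?thesis
    using uN by blast
qed

lemma dual_unique: "\<exists>!\<Phi>. is_dual_map B M N \<Psi> \<Phi>"
proof (rule ex_ex1I)
  have "\<forall>b. \<exists>c. b \<in> N \<longrightarrow> c \<in> N \<and> (\<forall>a\<in>M. B (\<Psi> a) b = B a c)"
    using dual_exists by blast
  then obtain F where "\<forall>b. b \<in> N \<longrightarrow> F b \<in> N \<and> (\<forall>a\<in>M. B (\<Psi> a) b = B a (F b))"
    by metis
  \<comment> \<open>Restriction to \<open>N\<close> supplies the extensionality that
    \<open>is_dual_map\<close> demands.\<close>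
  then have "is_dual_map B M N \<Psi> (restrict F N)"
    by (auto simp: is_dual_map_def)
  then show "\<exists>\<Phi>. is_dual_map B M N \<Psi> \<Phi>"
    by blast
  fix \<Phi> \<Phi>' assume D: "is_dual_map B M N \<Psi> \<Phi>" "is_dual_map B M N \<Psi> \<Phi>'"
  show "\<Phi> = \<Phi>'"
  proof (rule PiE_ext)
    show "\<Phi> \<in> N \<rightarrow>\<^sub>E N" "\<Phi>' \<in> N \<rightarrow>\<^sub>E N"
      using D by (simp_all add: is_dual_map_def)
    fix b assume b: "b \<in> N"
    show "\<Phi> b = \<Phi>' b"
    proof (rule B_nondegenerate_N)
      show "\<Phi> b \<in> N" "\<Phi>' b \<in> N"
        using D b by (auto simp: is_dual_map_def)
      show "B a (\<Phi> b) = B a (\<Phi>' b)" if "a \<in> M" for a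
        using D b that unfolding is_dual_map_def by metis
    qed
  qed
qed

context
  fixes \<Phi> assumes dual: "is_dual_map B M N \<Psi> \<Phi>"
begin

lemma \<Phi>_N: "b \<in> N \<Longrightarrow> \<Phi> b \<in> N"
  and \<Phi>_dual: "a \<in> M \<Longrightarrow> b \<in> N \<Longrightarrow> B a (\<Phi> b) = B (\<Psi> a) b"
  using dual by (auto simp: is_dual_map_def)

text \<open>Moves the duality relation to \<open>B'\<close>, where positivity and faithfulness can
  be tested.\<close>

lemma \<Phi>_twist:
  assumes a: "a \<in> M" and b: "b \<in> N"
  shows "B' a (twist (\<Phi> b)) = B' (\<Psi> a) (twist b)"
proof -
  note bounded = vn_bounded [OF M] vn_bounded [OF N]
  have "\<gamma> (\<Psi> a) = \<Psi> (\<gamma> a)"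
    using \<Psi>_gamma [OF a] by simp
  then show ?thesis
    using a b gamma_M [OF a] by (simp add: B'_twist bounded \<Psi>_M \<Phi>_N \<Phi>_dual)
qed

lemma \<Phi>_linear: "linear_map_on N \<Phi>"
  unfolding linear_map_on_def
proof (intro conjI ballI allI)
  note bounded = vn_bounded [OF M]
  have addB: "B a (x + y) = B a x + B a y" for a x y
    by (simp add: B_eq blinfun.add_left blinfun.add_right cinner_simps)
  have scaleB: "B a (scaleC_op k x) = k * B a x" if "a \<in> M" for a k x
    using bounded [OF that] by (simp add: B_eq bounded_ops_scaleC cinner_simps)
  show "\<Phi> (x + y) = \<Phi> x + \<Phi> y" if xy: "x \<in> N" "y \<in> N" for x y
    by (rule B_nondegenerate_N) (use xy in \<open>simp_all add: \<Phi>_N vn_add [OF N] addB \<Phi>_dual\<close>)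
  show "\<Phi> (scaleC_op k x) = scaleC_op k (\<Phi> x)" if x: "x \<in> N" for k x
    by (rule B_nondegenerate_N) (use x in \<open>simp_all add: \<Phi>_N vn_scaleC [OF N] scaleB \<Phi>_dual \<Psi>_M\<close>)
qed

text \<open>Since \<open>B a id_blinfun\<close> is \<open>\<phi> a\<close>, unitality of the dual is
  invariance of \<open>\<phi>\<close> under \<open>\<Psi>\<close>. \<open>\<Phi>_state\<close>
  exchanges the two roles.\<close>

lemma \<Phi>_unital: "\<Phi> id_blinfun = id_blinfun"
proof (rule B_nondegenerate_N)
  have id: "B a id_blinfun = \<phi> a" for a
    by (simp add: B_eq vector_state_def)
  show "B a (\<Phi> id_blinfun) = B a id_blinfun" if a: "a \<in> M" for a
    using \<Phi>_dual [OF a vn_id [OF N]] \<Psi>_state [OF a] by (simp add: id)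
qed (simp_all add: \<Phi>_N vn_id [OF N])

lemma \<Phi>_even: "even_map \<gamma> N \<Phi>"
  unfolding even_map_def
proof
  fix b assume b: "b \<in> N"
  show "\<Phi> (\<gamma> b) = \<gamma> (\<Phi> b)"
  proof (rule B_nondegenerate_N)
    show "B a (\<Phi> (\<gamma> b)) = B a (\<gamma> (\<Phi> b))" if a: "a \<in> M" for a
      using a b gamma_M [OF a] gamma_N [OF b]
      by (simp add: \<Phi>_dual \<Psi>_gamma flip: B_gamma)
  qed (use b in \<open>simp_all add: \<Phi>_N gamma_N\<close>)
qed

lemma adj_twist: "b \<in> bounded_ops \<Longrightarrow> adj (twist b) = twist (adj b)"
  by (rule adj_eqI) (simp add: twist_apply cinner_V cinner_V' [symmetric] cinner_adj_right)

text \<open>For \<open>y = twist x\<close>, the vanishing of the dual at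
  \<open>adj x o\<^sub>L x\<close> says that the positive operator \<open>\<Psi> id_blinfun\<close>
  has zero form at \<open>y \<zeta>\<close>. Injectivity gives \<open>y \<zeta> = 0\<close>, and
  \<open>\<zeta>\<close> separates the commutant.\<close>

lemma \<Phi>_faithful:
  assumes inj: "inj (blinfun_apply (\<Psi> id_blinfun))"
  shows "faithful_map N \<Phi>"
  unfolding faithful_map_def
proof (intro ballI impI)
  fix x assume x: "x \<in> N" and zero: "\<Phi> (adj x o\<^sub>L x) = 0"
  note M' = von_neumann_algebra_commutant [OF M]
  define X where "X = \<Psi> id_blinfun"
  define y where "y = twist x"
  have X: "X \<in> M" "X \<in> bounded_ops"
    unfolding X_def using vn_id [OF M] \<Psi>_M vn_bounded [OF M] by auto
  have "positive_op (id_blinfun :: 'f op)"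
    by (simp add: positive_op_def cinner_same)
  then have X_pos: "positive_op X"
    using \<Psi>_positive vn_id [OF M] by (simp add: positive_map_def X_def)
  have xb: "x \<in> bounded_ops"
    using vn_bounded [OF N x] .
  have y: "y \<in> commutant M" "y \<in> bounded_ops"
    using twist_N [OF x] commutant_bounded_ops by (auto simp: y_def)
  have "twist (adj x o\<^sub>L x) = adj y o\<^sub>L y"
    unfolding y_def adj_twist [OF xb] by (rule blinfun_eqI) (simp add: twist_apply)
  moreover have "B' X (twist (adj x o\<^sub>L x)) = B' id_blinfun (twist (\<Phi> (adj x o\<^sub>L x)))"
    unfolding X_def
    by (rule \<Phi>_twist [symmetric]) (use x in \<open>simp_all add: vn_id [OF M] vn_compose [OF N] vn_adj [OF N]\<close>)
  moreover have "B' id_blinfun (twist (\<Phi> (adj x o\<^sub>L x))) = 0"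
    by (simp add: zero B'_def twist_apply cinner_simps)
  ultimately have "cinner (X (adj y (y \<zeta>))) \<zeta> = 0"
    by (simp add: B'_def)
  moreover have "X (adj y (y \<zeta>)) = adj y (X (y \<zeta>))"
    using commutantD [OF vn_adj [OF M' y(1)] X(1)] by simp
  ultimately have "cinner (X (y \<zeta>)) (y \<zeta>) = 0"
    using y(2) by (simp add: cinner_adj_left)
  then have "X (y \<zeta>) = 0"
    by (rule positive_op_eq_zero [OF X(2) X_pos])
  then have "X (y \<zeta>) = X 0"
    by simp
  then have "y \<zeta> = 0"
    using inj unfolding X_def by (rule injD [rotated])
  then have "y = 0"
    by (rule sep_commutant [OF y(1)])
  then show "x = 0"
    unfolding y_def by (rule twist_eq_zero)
qed

lemma \<Phi>_n_positive:
  assumes pos: "n_positive_map n M \<Psi>"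
  shows "n_positive_map n N \<Phi>"
  unfolding n_positive_map_def
proof (intro allI impI, elim conjE)
  fix Y :: "nat \<Rightarrow> nat \<Rightarrow> 'f op"
  assume Y: "\<forall>i<n. \<forall>j<n. Y i j \<in> N" and Y_pos: "positive_matrix n Y"
  define b where "b i j = twist (Y i j)" for i j
  define c where "c i j = twist (\<Phi> (Y i j))" for i j
  have b: "b i j \<in> commutant M" if "i < n" "j < n" for i j
    using Y that twist_N by (auto simp: b_def)
  have b_bounded: "b i j \<in> bounded_ops" if "i < n" "j < n" for i j
    using b [OF that] by (rule commutant_bounded_ops)
  have c: "c i j \<in> commutant M" if "i < n" "j < n" for i j
    using Y that twist_N \<Phi>_N by (auto simp: c_def)
  \<comment> \<open>Twisting every entry conjugates the matrix by a diagonal unitary, which amounts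
    to the substitution of \<open>V' (v i)\<close> for \<open>v i\<close>.\<close>
  have b_pos: "positive_matrix n b"
    unfolding positive_matrix_def b_def twist_apply cinner_V
    by (rule allI) (rule positive_matrixD [OF Y_pos, of "\<lambda>i. V' (v i)" for v])
  have gram: "(\<Sum>i<n. \<Sum>j<n. cinner (c i j (a j \<zeta>)) (a i \<zeta>)) \<in> \<real>\<^sub>\<ge>\<^sub>0"
    if a: "\<And>i. i < n \<Longrightarrow> a i \<in> M" for a
  proof -
    have aa: "adj (a i) o\<^sub>L a j \<in> M" if "i < n" "j < n" for i j
      using a that by (intro vn_compose [OF M] vn_adj [OF M])
    have "cinner (c i j (a j \<zeta>)) (a i \<zeta>) = cinner (\<Psi> (adj (a i) o\<^sub>L a j) (b i j \<zeta>)) \<zeta>"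
      if ij: "i < n" "j < n" for i j
    proof -
      \<comment> \<open>\<open>c i j\<close> lies in the commutant and slides past
        \<open>a j\<close>, while \<open>a i\<close> crosses the inner product as its
        adjoint.\<close>
      have "cinner (c i j (a j \<zeta>)) (a i \<zeta>) = B' (adj (a i) o\<^sub>L a j) (c i j)"
        using a ij commutantD [OF c [OF ij], of "a j" \<zeta>] vn_bounded [OF M]
        by (simp add: B'_def cinner_adj_left)
      also have "\<dots> = B' (\<Psi> (adj (a i) o\<^sub>L a j)) (b i j)"
        unfolding c_def b_def using aa [OF ij] Y ij by (intro \<Phi>_twist) auto
      finally show ?thesis
        by (simp add: B'_def)
    qed
    then have "(\<Sum>i<n. \<Sum>j<n. cinner (c i j (a j \<zeta>)) (a i \<zeta>))
        = (\<Sum>i<n. \<Sum>j<n. cinner (\<Psi> (adj (a i) o\<^sub>L a j) (b i j \<zeta>)) \<zeta>)"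
      by (intro sum.cong refl) simp
    also have "\<dots> \<in> \<real>\<^sub>\<ge>\<^sub>0"
    proof (rule commuting_positive_matrices [OF b_bounded _ b_pos])
      show "b i j (\<Psi> (adj (a k) o\<^sub>L a l) x) = \<Psi> (adj (a k) o\<^sub>L a l) (b i j x)"
        if "i < n" "j < n" "k < n" "l < n" for i j k l x
        using that aa by (intro commutantD [OF b] \<Psi>_M)
      have "positive_matrix n (\<lambda>i j. adj (a i) o\<^sub>L a j)"
        by (intro positive_matrix_gram vn_bounded [OF M] a)
      then show "positive_matrix n (\<lambda>i j. \<Psi> (adj (a i) o\<^sub>L a j))"
        using pos [unfolded n_positive_map_def, THEN spec, of "\<lambda>i j. adj (a i) o\<^sub>L a j"] aa by simp
    qed
    finally show ?thesis .
  qed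
  \<comment> \<open>Each component of an arbitrary family is approximated by vectors of the orbit,
    and the nonnegative reals are closed.\<close>
  have c_pos: "(\<Sum>i<n. \<Sum>j<n. cinner (c i j (v j)) (v i)) \<in> \<real>\<^sub>\<ge>\<^sub>0" for v
  proof -
    have "\<exists>a. (\<forall>m. a m \<in> M) \<and> (\<lambda>m. a m \<zeta>) \<longlonglongrightarrow> x" for x
    proof -
      have "x \<in> closure (orbit M \<zeta>)"
        by (simp add: cyclic_M)
      then obtain u where u: "\<forall>m. u m \<in> orbit M \<zeta>" "u \<longlonglongrightarrow> x"
        unfolding closure_sequential by blast
      then have "\<forall>m. \<exists>a. a \<in> M \<and> u m = a \<zeta>"
        by (auto simp: orbit_def)
      then obtain a where a: "\<forall>m. a m \<in> M \<and> u m = a m \<zeta>"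
        by metis
      then have "u = (\<lambda>m. a m \<zeta>)"
        by (simp add: fun_eq_iff)
      then show ?thesis
        using a u(2) by (intro exI [of _ a]) simp
    qed
    then obtain a where a: "\<And>x m. a x m \<in> M" "\<And>x. (\<lambda>m. a x m \<zeta>) \<longlonglongrightarrow> x"
      by metis
    have "(\<lambda>m. \<Sum>i<n. \<Sum>j<n. cinner (c i j (a (v j) m \<zeta>)) (a (v i) m \<zeta>))
        \<longlonglongrightarrow> (\<Sum>i<n. \<Sum>j<n. cinner (c i j (v j)) (v i))"
      by (intro tendsto_sum cinner.tendsto blinfun.tendsto tendsto_const a)
    then show ?thesis
      by (rule closed_sequentially [OF closed_nonneg_Reals_complex, rotated]) (intro gram a)
  qed
  show "positive_matrix n (\<lambda>i j. \<Phi> (Y i j))"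
    unfolding positive_matrix_def
  proof
    fix v
    have "cinner (\<Phi> (Y i j) (v j)) (v i) = cinner (c i j (V (v j))) (V (v i))" for i j
      using cinner_V [of "\<Phi> (Y i j) (v j)" "V (v i)"] by (simp add: c_def twist_apply)
    then show "(\<Sum>i<n. \<Sum>j<n. cinner (\<Phi> (Y i j) (v j)) (v i)) \<in> \<real>\<^sub>\<ge>\<^sub>0"
      using c_pos [of "\<lambda>i. V (v i)"] by simp
  qed
qed

lemma \<Phi>_positive: "positive_map N \<Phi>"
  using \<Phi>_n_positive [of 1] \<Psi>_positive by (simp add: positive_map_iff)

lemma \<Phi>_state:
  assumes unital: "\<Psi> id_blinfun = id_blinfun" and b: "b \<in> N"
  shows "\<phi> (\<Phi> b) = \<phi> b"
  using \<Phi>_dual [OF vn_id [OF M] b] by (simp add: unital B_eq vector_state_def)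

text \<open>With the arguments exchanged, the equation for the dual of \<open>\<Phi>\<close> is the
  one already satisfied by \<open>\<Psi>\<close>, and \<open>B_nondegenerate_M\<close> admits no
  other solution. The restriction is there because duals are extensional, while
  \<open>\<Psi>\<close> is arbitrary outside \<open>M\<close>.\<close>

lemma bidual:
  shows "is_dual_map (\<lambda>b a. B a b) N M \<Phi> \<Theta> \<longleftrightarrow> \<Theta> = restrict \<Psi> M"
proof
  assume D: "is_dual_map (\<lambda>b a. B a b) N M \<Phi> \<Theta>"
  show "\<Theta> = restrict \<Psi> M"
  proof (rule PiE_ext)
    show "\<Theta> \<in> M \<rightarrow>\<^sub>E M" "restrict \<Psi> M \<in> M \<rightarrow>\<^sub>E M"
      using D by (auto simp: is_dual_map_def \<Psi>_M)
    fix a assume a: "a \<in> M"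
    show "\<Theta> a = restrict \<Psi> M a"
    proof (rule B_nondegenerate_M)
      show "\<Theta> a \<in> M" "restrict \<Psi> M a \<in> M"
        using D a by (auto simp: is_dual_map_def \<Psi>_M)
      show "B (\<Theta> a) b = B (restrict \<Psi> M a) b" if b: "b \<in> N" for b
        using D a b \<Phi>_dual [OF a b] by (simp add: is_dual_map_def)
    qed
  qed
next
  assume "\<Theta> = restrict \<Psi> M"
  then show "is_dual_map (\<lambda>b a. B a b) N M \<Phi> \<Theta>"
    by (auto simp: is_dual_map_def \<Psi>_M \<Phi>_dual)
qed

end

end

section \<open>The local algebras as a twisted pair, and the conclusion\<close>

lemma (in fock_parity) gamma_com:
  assumes J: "J \<subseteq> L" and X: "X \<in> com J"
  shows "parity_automorphism \<Gamma> X \<in> com J"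
proof (rule comI)
  show "parity_automorphism \<Gamma> X \<in> bounded_ops"
    using subsetD [OF com_bounded X] by (simp add: parity_automorphism_def bounded_ops_compose)
  fix l x assume l: "l \<in> J"
  then have "l \<in> L"
    using J by blast
  then show "parity_automorphism \<Gamma> X (ann l x) = ann l (parity_automorphism \<Gamma> X x)"
    "parity_automorphism \<Gamma> X (cre l x) = cre l (parity_automorphism \<Gamma> X x)"
    using comD [OF X l]
    by (simp_all add: parity_automorphism_def Gamma_ann Gamma_cre blinfun.minus_right)
qed

text \<open>Invariance passes from \<open>com J\<close>, where the sign changes of the generators
  cancel, to its commutant.\<close>

lemma (in fock_parity) gamma_lattice_algebra:
  assumes J: "J \<subseteq> L" and a: "a \<in> lattice_algebra cr e J"
  shows "parity_automorphism \<Gamma> a \<in> lattice_algebra cr e J"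
proof -
  have a': "a \<in> commutant (com J)"
    using a by (simp add: lattice_algebra_eq)
  have "parity_automorphism \<Gamma> a \<in> commutant (com J)"
  proof (rule commutantI)
    show "parity_automorphism \<Gamma> a \<in> bounded_ops"
      using commutant_bounded_ops [OF a'] by (simp add: parity_automorphism_def bounded_ops_compose)
    fix X x assume "X \<in> com J"
    from commutantD [OF a' gamma_com [OF J this], of "\<Gamma> x"]
    have "a (\<Gamma> (X x)) = \<Gamma> (X (\<Gamma> (a (\<Gamma> x))))"
      by (simp add: parity_automorphism_def)
    then show "parity_automorphism \<Gamma> a (X x) = X (parity_automorphism \<Gamma> a x)"
      by (simp add: parity_automorphism_def)
  qed
  then show ?thesis
    by (simp add: lattice_algebra_eq)
qed

lemma (in fock_entangled) twisted_pair:
  "twisted_pair \<Gamma> (lattice_algebra cr e I) (lattice_algebra cr e (L - I)) \<zeta>"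
proof unfold_locales
  show vn: "von_neumann_algebra (lattice_algebra cr e I)"
    "von_neumann_algebra (lattice_algebra cr e (L - I))"
    unfolding lattice_algebra_eq
    by (rule von_neumann_algebra_double_commutant [OF com_bounded com_adj])+
  show "\<Gamma> \<zeta> = \<zeta>"
    by (rule Gamma_\<zeta>)
  show "parity_automorphism \<Gamma> a \<in> lattice_algebra cr e I" if "a \<in> lattice_algebra cr e I" for a
    using I that by (rule gamma_lattice_algebra)
  show "parity_automorphism \<Gamma> b \<in> lattice_algebra cr e (L - I)"
    if "b \<in> lattice_algebra cr e (L - I)" for b
    using _ that by (rule gamma_lattice_algebra) blast
  show "twist b \<in> commutant (lattice_algebra cr e I)" if "b \<in> lattice_algebra cr e (L - I)" for b
    unfolding commutant_lattice_algebra by (rule twist_lattice_algebra [OF I order_refl that])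
  show "untwist c \<in> lattice_algebra cr e (L - I)" if "c \<in> commutant (lattice_algebra cr e I)" for c
    using I that unfolding commutant_lattice_algebra by (rule untwist_commutant)
  show "closure (orbit (lattice_algebra cr e I) \<zeta>) = UNIV"
    "closure (orbit (lattice_algebra cr e (L - I)) \<zeta>) = UNIV"
    by (rule cyclic)+
  \<comment> \<open>The twist sends the algebra of \<open>I\<close> into \<open>com (L - I)\<close>,
    for which \<open>\<zeta>\<close> is already known to be separating, and it preserves
    annihilation of the even vector \<open>\<zeta>\<close>.\<close>
  show "a = 0" if a: "a \<in> lattice_algebra cr e I" and zero: "a \<zeta> = 0" for a
  proof -
    have "a \<in> bounded_ops"
      using vn_bounded [OF vn(1) a] .
    then have "twist a \<zeta> = 0"
      using zero
      by (simp add: twist_apply V'_apply Gamma_\<zeta> bounded_ops_scaleC blinfun.diff_right)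
    moreover have "twist a \<in> com (L - I)"
      using I by (intro twist_lattice_algebra [OF _ _ a]) auto
    ultimately have "twist a = 0"
      by (intro separating_com_compl)
    then show ?thesis
      by (rule twist_eq_zero)
  qed
qed

theorem (in twisted_pair_map) dual_map_properties:
  defines "\<Phi> \<equiv> dual_map B M N \<Psi>"
  defines "\<Theta> \<equiv> dual_map (\<lambda>b a. B a b) N M \<Phi>"
  shows "(\<exists>!\<Phi>. is_dual_map B M N \<Psi> \<Phi>) \<and>
    linear_map_on N \<Phi> \<and> positive_map N \<Phi> \<and> unital_map \<Phi> \<and>
    (inj (blinfun_apply (\<Psi> id_blinfun)) \<longrightarrow> faithful_map N \<Phi>) \<and>
    even_map \<gamma> N \<Phi> \<and>
    (\<forall>n. n_positive_map n M \<Psi> \<longrightarrow> n_positive_map n N \<Phi>) \<and>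
    (completely_positive_map M \<Psi> \<longrightarrow> completely_positive_map N \<Phi>) \<and>
    (unital_map \<Psi> \<longrightarrow>
      (\<forall>b\<in>N. \<phi> (\<Phi> b) = \<phi> b) \<and>
      (\<exists>!\<Theta>. is_dual_map (\<lambda>b a. B a b) N M \<Phi> \<Theta>) \<and>
      (\<forall>a\<in>M. \<Theta> a = \<Psi> a))"
proof -
  have dual: "is_dual_map B M N \<Psi> \<Phi>"
    unfolding \<Phi>_def dual_map_def by (rule theI' [OF dual_unique])
  note bidual = bidual [OF dual]
  have "\<Theta> = restrict \<Psi> M"
    unfolding \<Theta>_def dual_map_def bidual by simp
  then have "\<forall>a\<in>M. \<Theta> a = \<Psi> a"
    by simp
  moreover have "\<exists>!\<Theta>. is_dual_map (\<lambda>b a. B a b) N M \<Phi> \<Theta>"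
    unfolding bidual by blast
  ultimately show ?thesis
    unfolding unital_map_def completely_positive_map_def
    using dual_unique \<Phi>_linear [OF dual] \<Phi>_positive [OF dual] \<Phi>_unital [OF dual]
      \<Phi>_faithful [OF dual] \<Phi>_even [OF dual] \<Phi>_n_positive [OF dual] \<Phi>_state [OF dual]
    by blast
qed

theorem theorem12p4:
  fixes L I :: "'l set"
    and e :: "'l \<Rightarrow> 'h :: complex_hilbert_space"
    and w :: "'h list \<Rightarrow> 'f :: complex_hilbert_space"
    and cr :: "'h \<Rightarrow> 'f op"
    and D :: "'l set \<Rightarrow> 'l list set"
    and \<iota> :: "'l \<Rightarrow> 'l"
    and p :: "'l list \<Rightarrow> real"
    and f :: "'l list \<Rightarrow> 'f"
    and A :: "'l set \<Rightarrow> 'f op set"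
    and \<zeta> :: 'f
    and \<phi> :: "'f op \<Rightarrow> complex"
    and B :: "'f op \<Rightarrow> 'f op \<Rightarrow> complex"
    and \<Gamma> :: "'f op"
    and \<gamma> :: "'f op \<Rightarrow> 'f op"
    and \<Psi> \<Psi>\<^sub>d \<Psi>\<^sub>d\<^sub>d :: "'f op \<Rightarrow> 'f op"
  assumes "countable L" and "orthonormal_basis L e"
    and "antisymmetric_fock_space w" and "creation_operators w cr"
    and "f = fock_vector w cr e" and "A = lattice_algebra cr e"
    and "\<forall>J\<subseteq>L. ordering_system J (D J)"
    and "I \<subseteq> L" and "bij_betw \<iota> I (L - I)"
    and "\<forall>s\<in>D I. p s > 0" and "(p has_sum 1) (D I)"
    and "\<zeta> = entangled_vector f \<iota> p (D I)"
    and "\<phi> = vector_state \<zeta>" and "B = vector_form \<zeta>"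
    and "parity_operator f (D L) \<Gamma>" and "\<gamma> = parity_automorphism \<Gamma>"
    and "\<Psi> \<in> A I \<rightarrow> A I" and "linear_map_on (A I) \<Psi>"
    and "positive_map (A I) \<Psi>" and "even_map \<gamma> (A I) \<Psi>"
    and "\<forall>a\<in>A I. \<phi> (\<Psi> a) = \<phi> a"
    and "\<Psi>\<^sub>d = dual_map B (A I) (A (L - I)) \<Psi>"
    and "\<Psi>\<^sub>d\<^sub>d = dual_map (\<lambda>b a. B a b) (A (L - I)) (A I) \<Psi>\<^sub>d"
  shows "(\<exists>!\<Phi>. is_dual_map B (A I) (A (L - I)) \<Psi> \<Phi>) \<and>
    linear_map_on (A (L - I)) \<Psi>\<^sub>d \<and>
    positive_map (A (L - I)) \<Psi>\<^sub>d \<and>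
    unital_map \<Psi>\<^sub>d \<and>
    (inj (blinfun_apply (\<Psi> id_blinfun)) \<longrightarrow> faithful_map (A (L - I)) \<Psi>\<^sub>d) \<and>
    even_map \<gamma> (A (L - I)) \<Psi>\<^sub>d \<and>
    (\<forall>n. n_positive_map n (A I) \<Psi> \<longrightarrow> n_positive_map n (A (L - I)) \<Psi>\<^sub>d) \<and>
    (completely_positive_map (A I) \<Psi> \<longrightarrow> completely_positive_map (A (L - I)) \<Psi>\<^sub>d) \<and>
    (unital_map \<Psi> \<longrightarrow>
      (\<forall>b\<in>A (L - I). \<phi> (\<Psi>\<^sub>d b) = \<phi> b) \<and>
      (\<exists>!\<Theta>. is_dual_map (\<lambda>b a. B a b) (A (L - I)) (A I) \<Psi>\<^sub>d \<Theta>) \<and>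
      (\<forall>a\<in>A I. \<Psi>\<^sub>d\<^sub>d a = \<Psi> a))"
proof -
  interpret fock_lattice w cr L e
    by unfold_locales fact+
  have f: "f = fvec"
    unfolding assms(5) by (rule ext) (rule fock_vector_eq)
  have D: "ordering_system J (D J)" if "J \<subseteq> L" for J
    using assms(7) that by blast
  have parity: "\<Gamma> \<in> bounded_ops" "adj \<Gamma> = \<Gamma>" "\<Gamma> o\<^sub>L \<Gamma> = id_blinfun"
    and Gamma_D: "\<forall>s\<in>D L. \<Gamma> (fvec s) = (if even (length s) then fvec s else - fvec s)"
    using assms(15) by (simp_all add: parity_operator_def f)
  \<comment> \<open>Parity is prescribed on the chosen orderings only. Reordering costs a sign and
    keeps the length, and lists with repeated entries give 0.\<close>
  have "\<Gamma> (fvec s) = (if even (length s) then fvec s else - fvec s)" if s: "s \<in> lists L" for s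
  proof (cases "distinct s")
    case True
    note DL = ordering_systemD [OF D [OF order_refl]]
    have "finite (set s)" "set s \<subseteq> L"
      using s by auto
    then obtain t where t: "t \<in> D L" "set t = set s"
      using DL(4) by blast
    then have "length t = length s"
      using True DL(1) by (metis distinct_card)
    moreover have "fvec s = fvec t \<or> fvec s = - fvec t"
      using True DL(1) t by (intro fvec_perm_distinct) auto
    ultimately show ?thesis
      using Gamma_D t(1) by (auto simp: blinfun.minus_right)
  qed (simp add: fvec_not_distinct)
  then interpret fock_parity w cr L e \<Gamma>
    by unfold_locales (use parity in auto)
  interpret E: fock_entangled w cr L e \<Gamma> I "D I" \<iota> p
    using D [OF assms(8)] assms(8-11)
    by unfold_locales (auto simp: summable_on_def)
  have \<zeta>: "E.\<zeta> = \<zeta>"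
    unfolding E.\<zeta>_def assms(12) f ..
  have "twisted_pair_map \<Gamma> (A I) (A (L - I)) \<zeta> \<Psi>"
    using E.twisted_pair assms(17-21)
    unfolding twisted_pair_map_def twisted_pair_map_axioms_def \<zeta> assms(6,13,16) by blast
  then show ?thesis
    unfolding assms(13,14,16,22,23) by (rule twisted_pair_map.dual_map_properties)
qed

end
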